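(* Let $s\ge 2$, let $\pi$ be a probability vector on $\{1,\dots,s\}$ and let $M$ be a symmetric $s\times s$ matrix with non-negative entries such that $d:=\sum_j M_{ij}\pi_j>0$ does not depend on $i$. Let $A=M-d\mathbf{1}\mathbf{1}^T$, where $\mathbf 1$ is the all-ones vector, and let $T=\frac1d\operatorname{diag}(\pi)M$ have eigenvalues $1=\lambda_1\ge|\lambda_2|\ge\cdots\ge|\lambda_s|$. Fix a sequence $a_n$ with $a_n=o(n)$ and $a_n=\omega(\sqrt n)$. Let $(G,\sigma)$ be drawn from the stochastic block model with parameters $(n,M,\pi)$, let $\Omega_n$ be the event that $\big||\{u:\sigma_u=i\}|-n\pi_i\big|\le a_n$ for all $i\in\{1,\dots,s\}$, and let $\tilde{\mathbb{P}}_n$ be the law of $G$ conditioned on $\Omega_n$. Let $\mathbb{Q}_n$ be the law of the Erdős–Rényi graph $\mathcal{G}(n,d/n)$. If $Q(\pi,A/\sqrt{2d})<1$, then $$\lim_{n\to\infty}\mathbb{E}_{\mathbb{Q}_n}\left(\frac{d\tilde{\mathbb{P}}_n}{d\mathbb{Q}_n}\right)^2=\prod_{i,j=2}^s\psi(d\lambda_i\lambda_j)<\infty,\qquad \psi(x)=(1-x)^{-1/2}e^{-x/2-x^2/4}.$$ On the other hand, if $Q(\pi,A/\sqrt{2d})>1$, then $$\lim_{n\to\infty}\mathbb{E}_{\mathbb{Q}_n}\left(\frac{d\tilde{\mathbb{P}}_n}{d\mathbb{Q}_n}\right)^2=\infty.$$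
   Context: Stochastic block model $(n,M,\pi)$: each vertex $v\in\{1,\dots,n\}$ receives an independent label $\sigma_v\in\{1,\dots,s\}$ with distribution $\pi$; conditionally on the labels, each edge $\{u,v\}$ is included independently with probability $M_{\sigma_u,\sigma_v}/n$ ($n$ large). $M,\pi$ are fixed as $n\to\infty$. Definition of $Q$: let $\Delta_{s^2}(\pi)$ be the set of probability vectors $\alpha=(\alpha_{ij})_{i,j=1}^s$ with both marginals equal to $\pi$: $\alpha_{ij}\ge0$, $\sum_i\alpha_{ij}=\pi_j$ for all $j$, $\sum_j\alpha_{ij}=\pi_i$ for all $i$. Let $p=\pi\otimes\pi$, i.e. $p_{ij}=\pi_i\pi_j$, and $D(\alpha,p)=\sum_{ij}\alpha_{ij}\log(\alpha_{ij}/p_{ij})$ (Kullback–Leibler divergence, with terms with $\alpha_{ij}=0$ equal to $0$). For an $s\times s$ matrix $B$, $$Q(\pi,B)=\sup_{\alpha\in\Delta_{s^2}(\pi),\ \alpha\ne p}\frac{(\alpha-p)^T(B\otimes B)(\alpha-p)}{D(\alpha,p)},$$ where $(B\otimes B)_{(ij),(k\ell)}=B_{ik}B_{j\ell}$. *)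

theory Defs
  imports "HOL-Probability.Probability" "HOL-Library.Landau_Symbols"
    "Jordan_Normal_Form.Char_Poly"
begin

text \<open>Labels, vertices and eigenvalues are numbered from \<open>0\<close>: the labels are \<open>{..<s}\<close>, the vertices
  \<open>{..<n}\<close>. The label distribution \<open>\<pi>\<close> is a pmf supported in \<open>{..<s}\<close>; zero weights are allowed.\<close>

text \<open>Simple graphs on \<open>{..<n}\<close> are encoded by the indicator of their edges, the edge joining
  \<open>u < v\<close> being the pair \<open>(u, v)\<close>; the indicator is \<open>False\<close> outside \<open>vertex_pairs n\<close>.\<close>

type_synonym graph = "nat \<times> nat \<Rightarrow> bool"

definition vertex_pairs :: "nat \<Rightarrow> (nat \<times> nat) set" where
  "vertex_pairs n = {(u, v). u < v \<and> v < n}"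

text \<open>\<open>bernoulli_pmf\<close> truncates its parameter to \<open>[0, 1]\<close>, so the next two definitions have the
  intended meaning once \<open>n\<close> is at least \<open>d\<close> and every entry of \<open>M\<close>.\<close>

definition sbm :: "nat \<Rightarrow> real mat \<Rightarrow> nat pmf \<Rightarrow> (graph \<times> (nat \<Rightarrow> nat)) pmf" where
  "sbm n M \<pi> =
     bind_pmf (Pi_pmf {..<n} 0 (\<lambda>_. \<pi>)) (\<lambda>\<sigma>.
       map_pmf (\<lambda>G. (G, \<sigma>))
         (Pi_pmf (vertex_pairs n) False
           (\<lambda>(u, v). bernoulli_pmf (M $$ (\<sigma> u, \<sigma> v) / real n))))"

definition erdos_renyi :: "nat \<Rightarrow> real \<Rightarrow> graph pmf" where
  "erdos_renyi n q = Pi_pmf (vertex_pairs n) False (\<lambda>_. bernoulli_pmf q)"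

definition balanced :: "nat \<Rightarrow> nat pmf \<Rightarrow> nat \<Rightarrow> real \<Rightarrow> (graph \<times> (nat \<Rightarrow> nat)) set" where
  "balanced s \<pi> n a =
     {(G, \<sigma>). \<forall>i<s. \<bar>real (card {u. u < n \<and> \<sigma> u = i}) - real n * pmf \<pi> i\<bar> \<le> a}"

text \<open>\<open>cond_pmf\<close> is unspecified when the conditioning event is null, which happens only for
  finitely many \<open>n\<close> if \<open>a n / sqrt n\<close> tends to infinity.\<close>

definition sbm_cond :: "nat \<Rightarrow> real mat \<Rightarrow> nat pmf \<Rightarrow> nat \<Rightarrow> real \<Rightarrow> graph pmf" where
  "sbm_cond s M \<pi> n a = map_pmf fst (cond_pmf (sbm n M \<pi>) (balanced s \<pi> n a))"

definition second_moment :: "'a pmf \<Rightarrow> 'a pmf \<Rightarrow> ennreal" where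
  "second_moment P Q =
     (\<integral>\<^sup>+ x. (RN_deriv (measure_pmf Q) (measure_pmf P) x)\<^sup>2 \<partial>measure_pmf Q)"

definition couplings :: "nat \<Rightarrow> nat pmf \<Rightarrow> real mat set" where
  "couplings s \<pi> =
     {\<alpha> \<in> carrier_mat s s.
        (\<forall>i<s. \<forall>j<s. \<alpha> $$ (i, j) \<ge> 0) \<and>
        (\<forall>j<s. (\<Sum>i<s. \<alpha> $$ (i, j)) = pmf \<pi> j) \<and>
        (\<forall>i<s. (\<Sum>j<s. \<alpha> $$ (i, j)) = pmf \<pi> i)}"

definition indep_coupling :: "nat \<Rightarrow> nat pmf \<Rightarrow> real mat" where
  "indep_coupling s \<pi> = mat s s (\<lambda>(i, j). pmf \<pi> i * pmf \<pi> j)"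

text \<open>Summands with \<open>\<alpha> $$ (i, j) = 0\<close> vanish. On \<open>couplings s \<pi>\<close>, a zero entry of
  \<open>indep_coupling s \<pi>\<close> forces the corresponding entry of \<open>\<alpha>\<close> to be zero.\<close>

definition KL_div :: "nat \<Rightarrow> real mat \<Rightarrow> real mat \<Rightarrow> real" where
  "KL_div s \<alpha> p = (\<Sum>i<s. \<Sum>j<s. \<alpha> $$ (i, j) * ln (\<alpha> $$ (i, j) / p $$ (i, j)))"

definition tensor_form :: "nat \<Rightarrow> real mat \<Rightarrow> real mat \<Rightarrow> real" where
  "tensor_form s B x =
     (\<Sum>i<s. \<Sum>j<s. \<Sum>k<s. \<Sum>l<s. x $$ (i, j) * (B $$ (i, k) * B $$ (j, l)) * x $$ (k, l))"

text \<open>The supremum is taken in the extended reals; it is \<open>-\<infinity>\<close> when \<open>\<pi>\<close> is a point mass, since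
  then \<open>indep_coupling s \<pi>\<close> is the only coupling.\<close>

definition Q_sup :: "nat \<Rightarrow> nat pmf \<Rightarrow> real mat \<Rightarrow> ereal" where
  "Q_sup s \<pi> B =
     (SUP \<alpha> \<in> couplings s \<pi> - {indep_coupling s \<pi>}.
        ereal (tensor_form s B (\<alpha> - indep_coupling s \<pi>) / KL_div s \<alpha> (indep_coupling s \<pi>)))"

text \<open>The formula is meaningful only for \<open>x < 1\<close>. Since \<open>psi\<close> never vanishes, a finite product of
  its values is finite exactly when all arguments are below \<open>1\<close>.\<close>

definition psi :: "real \<Rightarrow> ennreal" where
  "psi x = (if x < 1 then ennreal ((1 - x) powr (- 1 / 2) * exp (- x / 2 - x\<^sup>2 / 4)) else \<infinity>)"

end

theory Submission
  imports Defs
begin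

text \<open>Averaging the squared likelihood ratio over \<open>\<G>(n, d/n)\<close> leaves the product over \<open>u < v\<close> of
  \<open>1 + A(\<sigma>\<^sub>u, \<sigma>\<^sub>v) A(\<tau>\<^sub>u, \<tau>\<^sub>v) / (d (n - d))\<close>, averaged over two independent conditioned labellings.
  If \<open>\<alpha>\<close> is the empirical law of the pairs \<open>(\<sigma>\<^sub>u, \<tau>\<^sub>u)\<close>, the product is \<open>exp (n q(\<alpha>) + O(1))\<close> with
  \<open>q\<close> the quadratic form in the definition of \<open>Q\<close>, while \<open>\<alpha>\<close> has probability about
  \<open>exp (- n D(\<alpha>, p))\<close>; so \<open>Q\<close> decides which exponent wins.

  If \<open>Q < 1\<close>, empirical laws away from \<open>p\<close> are negligible by compactness and a count of types. Near \<open>p\<close>,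
  diagonalising the kernel turns \<open>n q(\<alpha>)\<close> into \<open>\<Sum> \<kappa> Y\<^sup>2 / 2\<close> with asymptotically independent standard
  normal \<open>Y\<close>. No local limit theorem is needed: \<open>exp (\<kappa> Y\<^sup>2 / 2)\<close> is the mean of \<open>exp (\<surd>\<kappa> g Y)\<close> over a
  standard normal \<open>g\<close>, the mean over the labels is then an \<open>n\<close>-th power, and one passes to the limit
  under the Gaussian integral.

  If \<open>Q > 1\<close>, tilting the labels to a coupling with \<open>q(\<alpha>) > D(\<alpha>, p)\<close> gives an exponentially large
  lower bound.\<close>

section \<open>Product weights on assignments\<close>

text \<open>The limit splits in two. The factors (1-x)^(-1/2) are Gaussian integrals of the leading
  exponent. The factors exp(-x/2-x^2/4) form a constant: the pairs u < v omit the diagonal of the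
  quadratic form, which costs half the trace of the kernel, and the second-order term of the
  logarithm costs a quarter of its squared Hilbert-Schmidt norm. That Q < 1 keeps all kernel
  eigenvalues below 1 is seen by moving p along an eigenfunction, where q and D are both quadratic
  to leading order. The obstacle is that fluctuations of order 1/sqrt n decide the limit, while
  compactness disposes only of laws at a fixed distance from p. The domination under the Gaussian
  integral has to cover all scales in between with a coefficient still below 1. The conditioning is
  felt only far from p: it keeps the marginals close to \<pi>, and q < D is available for couplings
  only. Under the product law and under every tilted coupling the event has probability tending to
  1. T is not symmetric and \<pi> may have zeros, so the kernel lives on the support and comes from
  a symmetrised matrix; eigenvalues 0 are harmless as psi(0) = 1.\<close>

lemma exp_le_quadratic:
  fixes x b :: real
  assumes "\<bar>x\<bar> \<le> b"
  shows "exp x \<le> 1 + x + exp b / 2 * x\<^sup>2"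
proof -
  obtain t where t: "\<bar>t\<bar> \<le> \<bar>x\<bar>" "exp x = (\<Sum>m<2. x ^ m / fact m) + exp t / fact 2 * x ^ 2"
    using Maclaurin_exp_le[of x 2] by blast
  have "exp t \<le> exp b" using t(1) assms by simp
  then have "exp t / 2 * x\<^sup>2 \<le> exp b / 2 * x\<^sup>2" by (intro mult_right_mono) auto
  then show ?thesis using t(2) by (simp add: numeral_2_eq_2)
qed

text \<open>The complex form of (1 + a/n)^n -> exp a, without logarithms: \<open>x n ^ n\<close> is
  compared with the exact power \<open>y n ^ n = exp a\<close>, using that n (x n - y n) tends to
  0.\<close>

lemma power_tendsto_exp:
  fixes x :: "nat \<Rightarrow> complex"
  assumes "(\<lambda>n. of_nat n * (x n - 1)) \<longlonglongrightarrow> a"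
  shows "(\<lambda>n. x n ^ n) \<longlonglongrightarrow> exp a"
proof -
  define y where "y n = exp (a / of_nat n)" for n
  have y_lim: "(\<lambda>n. of_nat n * (y n - 1)) \<longlonglongrightarrow> a"
  proof (cases "a = 0")
    case True then show ?thesis by (simp add: y_def)
  next
    case False
    have "((\<lambda>z::complex. (exp z - 1) / z) \<longlongrightarrow> 1) (at 0)"
      using DERIV_exp[of "0::complex"] by (simp add: has_field_derivative_iff)
    moreover have "filterlim (\<lambda>n. a / of_nat n) (at 0) sequentially"
      unfolding filterlim_at
    proof
      show "\<forall>\<^sub>F n in sequentially. a / of_nat n \<in> UNIV \<and> a / of_nat n \<noteq> 0"
        using eventually_gt_at_top[of 0] by eventually_elim (use False in auto)
      show "(\<lambda>n. a / of_nat n) \<longlonglongrightarrow> 0" by (rule lim_const_over_n)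
    qed
    ultimately have "(\<lambda>n. (exp (a / of_nat n) - 1) / (a / of_nat n)) \<longlonglongrightarrow> 1"
      by (rule filterlim_compose)
    then have "(\<lambda>n. a * ((exp (a / of_nat n) - 1) / (a / of_nat n))) \<longlonglongrightarrow> a * 1"
      by (intro tendsto_mult) auto
    then show ?thesis
      using False by (simp add: y_def mult.commute)
  qed
  have "Bseq (\<lambda>n. of_nat n * (x n - 1))" using assms convergentI convergent_imp_Bseq by blast
  then obtain C where C: "C > 0" "\<And>n. norm (of_nat n * (x n - 1)) \<le> C"
    unfolding Bseq_def by auto
  define R where "R = max C (norm a)"
  have yn: "norm (y n) \<le> exp (R / n)" if "n > 0" for n
  proof -
    have "norm (y n) \<le> exp (norm (a / of_nat n))" unfolding y_def by (rule norm_exp)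
    also have "\<dots> \<le> exp (R / n)" using that by (auto simp: R_def norm_divide divide_right_mono)
    finally show ?thesis .
  qed
  have xn: "norm (x n) \<le> exp (R / n)" if "n > 0" for n
  proof -
    have "real n * norm (x n - 1) \<le> C" using C(2)[of n] by (simp only: norm_mult norm_of_nat)
    then have "norm (x n - 1) \<le> C / n" using that by (simp add: field_simps)
    also have "\<dots> \<le> R / n" using that by (auto simp: R_def divide_right_mono)
    finally have "norm (x n) \<le> 1 + R / n" using norm_triangle_ineq[of "x n - 1" 1] by simp
    also have "\<dots> \<le> exp (R / n)" by (rule exp_ge_add_one_self)
    finally show ?thesis .
  qed
  have bd: "norm (x n ^ n - y n ^ n) \<le> exp R * norm (of_nat n * (x n - y n))" if n: "n > 0" for n
  proof -
    \<comment> \<open>Dividing by \<open>r\<close> puts both bases into the closed unit disc, where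
      n-th powers differ by at most n times the difference of the bases;
      \<open>r ^ n = exp R\<close> does not grow with n.\<close>
    define r where "r = exp (R / n)"
    have r: "r \<ge> 1" "r ^ n = exp R"
      using n C(1) unfolding r_def by (auto simp: R_def exp_of_nat_mult[symmetric])
    have "x n ^ n - y n ^ n = of_real (r ^ n) * ((x n / of_real r) ^ n - (y n / of_real r) ^ n)"
      using r(1) by (simp add: power_divide right_diff_distrib)
    then have "norm (x n ^ n - y n ^ n) = r ^ n * norm ((x n / of_real r) ^ n - (y n / of_real r) ^ n)"
      using r by (simp add: norm_mult norm_power)
    also have "norm ((x n / of_real r) ^ n - (y n / of_real r) ^ n) \<le>
        n * norm (x n / of_real r - y n / of_real r)"
      using xn[OF n] yn[OF n] r by (intro norm_power_diff) (auto simp: norm_divide r_def)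
    also have "norm (x n / of_real r - y n / of_real r) = norm (x n - y n) / r"
      using r by (simp add: norm_divide flip: diff_divide_distrib)
    also have "\<dots> \<le> norm (x n - y n)" using r by (simp add: divide_le_eq mult_le_cancel_left1)
    finally show ?thesis using r by (simp add: norm_mult mult_left_mono)
  qed
  have "(\<lambda>n. of_nat n * (x n - 1) - of_nat n * (y n - 1)) \<longlonglongrightarrow> a - a"
    by (intro tendsto_diff assms y_lim)
  then have "(\<lambda>n. of_nat n * (x n - y n)) \<longlonglongrightarrow> 0" by (simp add: algebra_simps)
  then have "(\<lambda>n. exp R * norm (of_nat n * (x n - y n))) \<longlonglongrightarrow> exp R * 0"
    by (intro tendsto_mult tendsto_norm_zero) auto
  then have lim: "(\<lambda>n. exp R * norm (of_nat n * (x n - y n))) \<longlonglongrightarrow> 0" by simp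
  have d0: "(\<lambda>n. x n ^ n - y n ^ n) \<longlonglongrightarrow> 0"
    by (rule Lim_null_comparison[OF _ lim])
       (rule eventually_mono[OF eventually_gt_at_top[of 0] bd])
  have yn_eq: "y n ^ n = exp a" if "n > 0" for n using that by (simp add: y_def flip: exp_of_nat_mult)
  have "(\<lambda>n. y n ^ n) \<longlonglongrightarrow> exp a"
    by (intro tendsto_eventually) (rule eventually_mono[OF eventually_gt_at_top[of 0] yn_eq])
  from tendsto_add[OF d0 this] show ?thesis by simp
qed

text \<open>Extensional functions keep the set finite and let sums of products factor over the
  vertices.\<close>

definition assignments :: "'a set \<Rightarrow> nat \<Rightarrow> (nat \<Rightarrow> 'a) set" where
  "assignments L n = (\<Pi>\<^sub>E u\<in>{..<n}. L)"

text \<open>Needed for three kinds of law: the product law \<open>w\<close>, a tilted coupling, and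
  the empirical law of the assignment itself.\<close>

definition weight :: "('a \<Rightarrow> real) \<Rightarrow> nat \<Rightarrow> (nat \<Rightarrow> 'a) \<Rightarrow> real" where
  "weight v n \<omega> = (\<Prod>u<n. v (\<omega> u))"

lemma finite_assignments [simp]: "finite L \<Longrightarrow> finite (assignments L n)"
  unfolding assignments_def by (intro finite_PiE) auto

lemma assignmentsD: "\<omega> \<in> assignments L n \<Longrightarrow> u < n \<Longrightarrow> \<omega> u \<in> L"
  unfolding assignments_def by auto

lemma sum_prod_assignments:
  fixes h :: "'a \<Rightarrow> 'b::comm_semiring_1"
  assumes "finite L"
  shows "(\<Sum>\<omega>\<in>assignments L n. \<Prod>u<n. h (\<omega> u)) = (\<Sum>l\<in>L. h l) ^ n"
  using prod_sum_PiE[of "{..<n}" "\<lambda>_. L" "\<lambda>_. h"] assms by (simp add: assignments_def)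

lemma weight_nonneg: "(\<And>l. l \<in> L \<Longrightarrow> v l \<ge> 0) \<Longrightarrow> \<omega> \<in> assignments L n \<Longrightarrow> weight v n \<omega> \<ge> 0"
  unfolding weight_def by (intro prod_nonneg) (auto dest: assignmentsD)

text \<open>Independence in the form of a generating function. The field is left general because
  real exponentials give the tail bounds and complex ones the Gaussian limit.\<close>

lemma sum_weight_exp:
  fixes h :: "'a \<Rightarrow> 'b::{real_normed_field,banach}"
  assumes "finite L"
  shows "(\<Sum>\<omega>\<in>assignments L n. of_real (weight v n \<omega>) * exp (\<Sum>u<n. h (\<omega> u))) =
    (\<Sum>l\<in>L. of_real (v l) * exp (h l)) ^ n"
  unfolding sum_prod_assignments[OF assms, symmetric]
  by (intro sum.cong) (auto simp: weight_def exp_sum prod.distrib)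

lemma sum_weight:
  assumes "finite L" "(\<Sum>l\<in>L. v l) = 1"
  shows "(\<Sum>\<omega>\<in>assignments L n. weight v n \<omega>) = 1"
  using sum_prod_assignments[OF assms(1), where h=v and n=n] assms(2) by (simp add: weight_def)

text \<open>With mean 0 the one-letter moment is at most 1 plus a variance term, hence at most an
  exponential, and n-th powers preserve this. For small \<open>b\<close> the factor
  \<open>exp b / 2\<close> is close to the Gaussian value 1/2, which the domination argument relies
  on.\<close>

lemma exp_moment_le:
  fixes h :: "'a \<Rightarrow> real"
  assumes L: "finite L" and v: "\<And>l. l \<in> L \<Longrightarrow> v l \<ge> 0" "(\<Sum>l\<in>L. v l) = 1"
    and h: "(\<Sum>l\<in>L. v l * h l) = 0" and b: "\<And>l. l \<in> L \<Longrightarrow> \<bar>h l\<bar> \<le> b"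
  shows "(\<Sum>\<omega>\<in>assignments L n. weight v n \<omega> * exp (\<Sum>u<n. h (\<omega> u))) \<le>
    exp (n * (exp b / 2 * (\<Sum>l\<in>L. v l * (h l)\<^sup>2)))"
proof -
  let ?s = "exp b / 2 * (\<Sum>l\<in>L. v l * (h l)\<^sup>2)"
  have "(\<Sum>l\<in>L. v l * exp (h l)) \<le> (\<Sum>l\<in>L. v l * (1 + h l + exp b / 2 * (h l)\<^sup>2))"
    by (intro sum_mono mult_left_mono exp_le_quadratic b v)
  also have "\<dots> = 1 + ?s"
    using v h by (simp add: algebra_simps sum.distrib sum_distrib_left)
  also have "\<dots> \<le> exp ?s" by (rule exp_ge_add_one_self)
  finally have "(\<Sum>l\<in>L. v l * exp (h l)) ^ n \<le> exp ?s ^ n"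
    by (intro power_mono) (auto intro!: sum_nonneg mult_nonneg_nonneg v)
  then show ?thesis using sum_weight_exp[OF L, of v n h] by (simp flip: exp_of_nat_mult)
qed

text \<open>At scale 1/sqrt n the n variances add up to a constant, so the bound is uniform in
  n.\<close>

lemma exp_moment_bounded:
  fixes g :: "'a \<Rightarrow> real"
  assumes L: "finite L" and v: "\<And>l. l \<in> L \<Longrightarrow> v l \<ge> 0" "(\<Sum>l\<in>L. v l) = 1"
    and g: "(\<Sum>l\<in>L. v l * g l) = 0"
  obtains C where "C > 0"
    "\<And>n. (\<Sum>\<omega>\<in>assignments L n. weight v n \<omega> * exp ((\<Sum>u<n. g (\<omega> u)) / sqrt n)) \<le> C"
proof -
  define b where "b = (\<Sum>l\<in>L. \<bar>g l\<bar>)"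
  have b: "\<bar>g l\<bar> \<le> b" if "l \<in> L" for l
    unfolding b_def using member_le_sum[of l L "\<lambda>l. \<bar>g l\<bar>"] L that by auto
  let ?s = "exp b / 2 * (\<Sum>l\<in>L. v l * (g l)\<^sup>2)"
  have s0: "?s \<ge> 0" by (auto intro!: mult_nonneg_nonneg sum_nonneg v)
  show thesis
  proof
    show "exp ?s > 0" by simp
    fix n :: nat
    show "(\<Sum>\<omega>\<in>assignments L n. weight v n \<omega> * exp ((\<Sum>u<n. g (\<omega> u)) / sqrt n)) \<le> exp ?s"
    proof (cases "n = 0")
      case True then show ?thesis using s0 by (simp add: assignments_def weight_def)
    next
      case False
      have "(\<Sum>\<omega>\<in>assignments L n. weight v n \<omega> * exp (\<Sum>u<n. g (\<omega> u) / sqrt n)) \<le>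
        exp (n * (exp b / 2 * (\<Sum>l\<in>L. v l * (g l / sqrt n)\<^sup>2)))"
      proof (rule exp_moment_le[OF L v])
        show "(\<Sum>l\<in>L. v l * (g l / sqrt n)) = 0" using g by (simp flip: sum_divide_distrib)
        fix l assume l: "l \<in> L"
        have "\<bar>g l / sqrt n\<bar> \<le> \<bar>g l\<bar>" using False by (simp add: divide_le_eq mult_le_cancel_left1)
        then show "\<bar>g l / sqrt n\<bar> \<le> b" using b[OF l] by linarith
      qed auto
      also have "n * (exp b / 2 * (\<Sum>l\<in>L. v l * (g l / sqrt n)\<^sup>2)) = ?s"
        using False by (simp add: power_divide flip: sum_divide_distrib)
      finally show ?thesis by (simp add: sum_divide_distrib)
    qed
  qed
qed

text \<open>A Chernoff bound with parameter 1/sqrt n: exponential moments stay bounded at that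
  scale, so any threshold of larger order than sqrt n is exceeded with vanishing weight.\<close>

lemma deviation_weight_tendsto_0:
  fixes g :: "'a \<Rightarrow> real"
  assumes L: "finite L" and v: "\<And>l. l \<in> L \<Longrightarrow> v l \<ge> 0" "(\<Sum>l\<in>L. v l) = 1"
    and g: "(\<Sum>l\<in>L. v l * g l) = 0"
    and b: "filterlim (\<lambda>n. b n / sqrt (real n)) at_top sequentially"
  shows "(\<lambda>n. \<Sum>\<omega>\<in>{\<omega> \<in> assignments L n. \<bar>\<Sum>u<n. g (\<omega> u)\<bar> > b n}. weight v n \<omega>) \<longlonglongrightarrow> 0"
proof -
  obtain C1 where C1: "\<And>n. (\<Sum>\<omega>\<in>assignments L n. weight v n \<omega> * exp ((\<Sum>u<n. g (\<omega> u)) / sqrt n)) \<le> C1"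
    using exp_moment_bounded[OF L v g] by blast
  have g': "(\<Sum>l\<in>L. v l * (- g l)) = 0" using g by (simp add: sum_negf)
  obtain C2 where C2: "\<And>n. (\<Sum>\<omega>\<in>assignments L n. weight v n \<omega> * exp ((\<Sum>u<n. - g (\<omega> u)) / sqrt n)) \<le> C2"
    using exp_moment_bounded[OF L v g'] by blast
  have main: "(\<Sum>\<omega>\<in>{\<omega> \<in> assignments L n. \<bar>\<Sum>u<n. g (\<omega> u)\<bar> > b n}. weight v n \<omega>)
      \<le> (C1 + C2) * exp (- (b n / sqrt n))" if n: "n > 0" for n
  proof -
    have "(\<Sum>\<omega>\<in>{\<omega> \<in> assignments L n. \<bar>\<Sum>u<n. g (\<omega> u)\<bar> > b n}. weight v n \<omega>) \<le>
      (\<Sum>\<omega>\<in>assignments L n. weight v n \<omega> * (exp ((\<Sum>u<n. g (\<omega> u)) / sqrt n)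
         + exp ((\<Sum>u<n. - g (\<omega> u)) / sqrt n)) * exp (- (b n / sqrt n)))"
    proof (rule order_trans[OF sum_mono sum_mono2])
      fix \<omega> assume w: "\<omega> \<in> {\<omega> \<in> assignments L n. \<bar>\<Sum>u<n. g (\<omega> u)\<bar> > b n}"
      define y where "y = (\<Sum>u<n. g (\<omega> u)) / sqrt n"
      have "b n / sqrt n \<le> \<bar>y\<bar>" using w n by (simp add: y_def field_simps abs_mult)
      then have "1 \<le> exp (\<bar>y\<bar>) * exp (- (b n / sqrt n))" by (simp flip: exp_add)
      also have "\<dots> \<le> (exp y + exp (- y)) * exp (- (b n / sqrt n))"
        by (intro mult_right_mono) (auto simp: abs_if)
      finally have "weight v n \<omega> * 1 \<le> weight v n \<omega> * ((exp y + exp (- y)) * exp (- (b n / sqrt n)))"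
        using w by (intro mult_left_mono weight_nonneg[OF v(1)]) auto
      then show "weight v n \<omega> \<le> weight v n \<omega> * (exp ((\<Sum>u<n. g (\<omega> u)) / sqrt n)
         + exp ((\<Sum>u<n. - g (\<omega> u)) / sqrt n)) * exp (- (b n / sqrt n))"
        by (simp add: y_def sum_negf mult.assoc)
    qed (use L in \<open>auto intro!: mult_nonneg_nonneg weight_nonneg[OF v(1)] simp: add_nonneg_nonneg\<close>)
    also have "\<dots> \<le> (C1 + C2) * exp (- (b n / sqrt n))"
      unfolding sum_distrib_right[symmetric] distrib_left sum.distrib
      by (intro mult_right_mono add_mono C1 C2) auto
    finally show ?thesis .
  qed
  have "filterlim (\<lambda>n. exp (- (b n / sqrt n))) (nhds 0) sequentially"
    by (rule filterlim_compose[OF exp_at_bot]) (use b in \<open>simp add: filterlim_uminus_at_top\<close>)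
  then have "(\<lambda>n. (C1 + C2) * exp (- (b n / sqrt n))) \<longlonglongrightarrow> (C1 + C2) * 0"
    by (intro tendsto_mult) auto
  then have lim: "(\<lambda>n. (C1 + C2) * exp (- (b n / sqrt n))) \<longlonglongrightarrow> 0" by simp
  show ?thesis
  proof (rule tendsto_sandwich[OF _ _ tendsto_const lim])
    show "\<forall>\<^sub>F n in sequentially. 0 \<le> (\<Sum>\<omega>\<in>{\<omega> \<in> assignments L n. \<bar>\<Sum>u<n. g (\<omega> u)\<bar> > b n}. weight v n \<omega>)"
      by (intro always_eventually allI sum_nonneg weight_nonneg[OF v(1)]) auto
    show "\<forall>\<^sub>F n in sequentially. (\<Sum>\<omega>\<in>{\<omega> \<in> assignments L n. \<bar>\<Sum>u<n. g (\<omega> u)\<bar> > b n}. weight v n \<omega>)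
        \<le> (C1 + C2) * exp (- (b n / sqrt n))"
      using eventually_gt_at_top[of 0] by eventually_elim (rule main)
  qed
qed

section \<open>Logarithmic expansion and sums over vertex pairs\<close>

text \<open>The remainder has derivative t^2 / (1 + t), which is at most 2 x^2 for |t| <= |x| <=
  1/2.\<close>

lemma abs_ln_one_plus_cubic:
  fixes x :: real
  assumes "\<bar>x\<bar> \<le> 1 / 2"
  shows "\<bar>ln (1 + x) - (x - x\<^sup>2 / 2)\<bar> \<le> 2 * \<bar>x\<bar> ^ 3"
proof -
  define f where "f t = ln (1 + t) - (t - t\<^sup>2 / 2)" for t :: real
  have "norm (f x - f 0) \<le> (2 * x\<^sup>2) * norm (x - 0)"
  proof (rule field_differentiable_bound[where S = "{- \<bar>x\<bar>..\<bar>x\<bar>}" and f' = "\<lambda>t. t\<^sup>2 / (1 + t)"])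
    fix t assume t: "t \<in> {- \<bar>x\<bar>..\<bar>x\<bar>}"
    then have t': "1 + t \<ge> 1 / 2" "\<bar>t\<bar> \<le> \<bar>x\<bar>" using assms by auto
    have "(f has_field_derivative 1 / (1 + t) - (1 - t)) (at t within {- \<bar>x\<bar>..\<bar>x\<bar>})"
      unfolding f_def using t' by (auto intro!: derivative_eq_intros)
    moreover have "1 / (1 + t) - (1 - t) = t\<^sup>2 / (1 + t)"
      using t' by (simp add: field_simps power2_eq_square)
    ultimately show "(f has_field_derivative t\<^sup>2 / (1 + t)) (at t within {- \<bar>x\<bar>..\<bar>x\<bar>})" by simp
    have "t\<^sup>2 \<le> x\<^sup>2" using t'(2) by (simp add: abs_le_square_iff)
    also have "\<dots> \<le> 2 * x\<^sup>2 * (1 + t)" using t'(1) mult_left_mono[of "1 / 2" "1 + t" "2 * x\<^sup>2"] by simp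
    finally show "norm (t\<^sup>2 / (1 + t)) \<le> 2 * x\<^sup>2" using t' by (simp add: divide_le_eq)
  qed auto
  then show ?thesis by (simp add: f_def power3_eq_cube power2_eq_square)
qed

lemma finite_vertex_pairs [simp]: "finite (vertex_pairs n)"
  by (rule finite_subset[of _ "{..<n} \<times> {..<n}"]) (auto simp: vertex_pairs_def)

lemma card_vertex_pairs_le: "card (vertex_pairs n) \<le> n\<^sup>2"
proof -
  have "vertex_pairs n \<subseteq> {..<n} \<times> {..<n}" by (auto simp: vertex_pairs_def)
  then show ?thesis using card_mono[of "{..<n} \<times> {..<n}" "vertex_pairs n"] by (simp add: power2_eq_square)
qed

text \<open>The sum over ordered pairs is a quadratic form in the label frequencies; the sum over
  edges differs from half of it by a diagonal that does not vanish in the limit.\<close>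

lemma sum_vertex_pairs:
  fixes k :: "nat \<Rightarrow> nat \<Rightarrow> real"
  assumes "\<And>u v. k u v = k v u"
  shows "(\<Sum>u<n. \<Sum>v<n. k u v) = 2 * (\<Sum>(u, v)\<in>vertex_pairs n. k u v) + (\<Sum>u<n. k u u)"
proof -
  have split: "{..<n} \<times> {..<n} = vertex_pairs n \<union> (prod.swap ` vertex_pairs n \<union> (\<lambda>u. (u, u)) ` {..<n})"
    by (auto simp: vertex_pairs_def image_iff)
  have "(\<Sum>u<n. \<Sum>v<n. k u v) = (\<Sum>(u, v)\<in>{..<n} \<times> {..<n}. k u v)"
    by (simp add: sum.cartesian_product)
  also have "\<dots> = (\<Sum>(u, v)\<in>vertex_pairs n. k u v) + (\<Sum>(u, v)\<in>prod.swap ` vertex_pairs n. k u v)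
      + (\<Sum>(u, v)\<in>(\<lambda>u. (u, u)) ` {..<n}. k u v)"
  proof -
    have "vertex_pairs n \<inter> (prod.swap ` vertex_pairs n \<union> (\<lambda>u. (u, u)) ` {..<n}) = {}"
      "prod.swap ` vertex_pairs n \<inter> (\<lambda>u. (u, u)) ` {..<n} = {}"
      by (auto simp: vertex_pairs_def)
    then show ?thesis unfolding split by (simp add: sum.union_disjoint)
  qed
  also have "(\<Sum>(u, v)\<in>prod.swap ` vertex_pairs n. k u v) = (\<Sum>(u, v)\<in>vertex_pairs n. k u v)"
    by (subst sum.reindex) (auto intro!: sum.cong simp: assms)
  also have "(\<Sum>(u, v)\<in>(\<lambda>u. (u, u)) ` {..<n}. k u v) = (\<Sum>u<n. k u u)"
    by (subst sum.reindex) (auto simp: inj_on_def)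
  finally show ?thesis by simp
qed

section \<open>Empirical laws and the kernel model\<close>

text \<open>The empirical law of \<open>\<omega>\<close>. For \<open>n = 0\<close> it is 0 by the
  convention for division, so formulas multiplied by \<open>n\<close> survive there.\<close>

definition freq :: "nat \<Rightarrow> (nat \<Rightarrow> 'a) \<Rightarrow> 'a \<Rightarrow> real" where
  "freq n \<omega> l = real (card {u. u < n \<and> \<omega> u = l}) / real n"

lemma freq_nonneg: "freq n \<omega> l \<ge> 0"
  by (simp add: freq_def)

lemma sum_assignment_eq_freq:
  fixes h :: "'a \<Rightarrow> real"
  assumes "finite L" "\<omega> \<in> assignments L n"
  shows "(\<Sum>u<n. h (\<omega> u)) = n * (\<Sum>l\<in>L. freq n \<omega> l * h l)"
proof (cases "n = 0")
  case False
  have "(\<Sum>u<n. h (\<omega> u)) = (\<Sum>l\<in>L. \<Sum>u\<in>{u\<in>{..<n}. \<omega> u = l}. h (\<omega> u))"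
    using assms by (subst sum.group) (auto dest: assignmentsD)
  also have "\<dots> = (\<Sum>l\<in>L. real (card {u. u < n \<and> \<omega> u = l}) * h l)"
    by (intro sum.cong) auto
  finally show ?thesis using False by (simp add: freq_def sum_distrib_left)
qed simp

lemma sum_freq:
  assumes "finite L" "\<omega> \<in> assignments L n" "n > 0"
  shows "(\<Sum>l\<in>L. freq n \<omega> l) = 1"
  using sum_assignment_eq_freq[OF assms(1,2), of "\<lambda>_. 1"] assms(3) by simp

text \<open>\<open>L\<close> stands for the set of label pairs of positive weight \<open>w\<close>; the kernel \<open>A \<otimes> A / d\<close> is given by its
  eigenvalues \<open>\<kappa>\<close> and eigenfunctions \<open>\<phi>\<close>, orthonormal in \<open>L\<^sup>2(w)\<close> and orthogonal to constants.\<close>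

locale kernel_model =
  fixes L :: "'a set" and w :: "'a \<Rightarrow> real" and J :: "'c set"
    and \<kappa> :: "'c \<Rightarrow> real" and \<phi> :: "'c \<Rightarrow> 'a \<Rightarrow> real" and d :: real
  assumes finL: "finite L" and finJ: "finite J"
    and w_pos: "\<And>l. l \<in> L \<Longrightarrow> w l > 0" and w_sum: "(\<Sum>l\<in>L. w l) = 1"
    and mean: "\<And>c. c \<in> J \<Longrightarrow> (\<Sum>l\<in>L. w l * \<phi> c l) = 0"
    and ortho: "\<And>c c'. c \<in> J \<Longrightarrow> c' \<in> J \<Longrightarrow>
      (\<Sum>l\<in>L. w l * \<phi> c l * \<phi> c' l) = (if c = c' then 1 else 0)"
    and d_pos: "d > 0"
begin

definition K :: "'a \<Rightarrow> 'a \<Rightarrow> real" where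
  "K l l' = (\<Sum>c\<in>J. \<kappa> c * \<phi> c l * \<phi> c l')"

text \<open>Half the quadratic form of \<open>K\<close>. Each \<open>\<phi> c\<close> has
  \<open>w\<close>-mean 0, so \<open>\<alpha>\<close> and \<open>\<alpha> - w\<close> give the same
  value.\<close>

definition quad :: "('a \<Rightarrow> real) \<Rightarrow> real" where
  "quad \<alpha> = (\<Sum>c\<in>J. \<kappa> c * (\<Sum>l\<in>L. \<alpha> l * \<phi> c l)\<^sup>2) / 2"

text \<open>The denominator is the Bernoulli variance: with q = d/n, n^2 q (1 - q) = d (n - d), and
  the factor 1/d sits inside \<open>K\<close>.\<close>

definition lr :: "nat \<Rightarrow> (nat \<Rightarrow> 'a) \<Rightarrow> real" where
  "lr n \<omega> = (\<Prod>(u, v)\<in>vertex_pairs n. 1 + K (\<omega> u) (\<omega> v) / (n - d))"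

definition dev :: "nat \<Rightarrow> (nat \<Rightarrow> 'a) \<Rightarrow> real" where
  "dev n \<omega> = (\<Sum>l\<in>L. \<bar>freq n \<omega> l - w l\<bar>)"

text \<open>\<open>exp (- c0)\<close> collects the exponential factors of \<open>psi\<close> over
  all eigenvalues \<open>\<kappa> c\<close>.\<close>

definition c0 :: real where
  "c0 = (\<Sum>c\<in>J. \<kappa> c) / 2 + (\<Sum>c\<in>J. (\<kappa> c)\<^sup>2) / 4"

lemma w_nonneg: "l \<in> L \<Longrightarrow> w l \<ge> 0"
  using w_pos by (simp add: less_imp_le)

lemma K_sym: "K l l' = K l' l"
  by (simp add: K_def mult_ac)

lemma dev_nonneg: "dev n \<omega> \<ge> 0"
  by (simp add: dev_def sum_nonneg)

lemma dev_le_2: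
  assumes "\<omega> \<in> assignments L n" "n > 0"
  shows "dev n \<omega> \<le> 2"
proof -
  have "dev n \<omega> \<le> (\<Sum>l\<in>L. freq n \<omega> l + w l)"
    unfolding dev_def by (intro sum_mono) (use w_nonneg freq_nonneg[of n \<omega>] in \<open>fastforce simp: abs_le_iff\<close>)
  then show ?thesis using sum_freq[OF finL assms] w_sum by (simp add: sum.distrib)
qed

lemma quad_eq: "quad \<alpha> = (\<Sum>l\<in>L. \<Sum>l'\<in>L. \<alpha> l * \<alpha> l' * K l l') / 2"
proof -
  have "(\<Sum>l\<in>L. \<Sum>l'\<in>L. \<alpha> l * \<alpha> l' * K l l') =
     (\<Sum>l\<in>L. \<Sum>l'\<in>L. \<Sum>c\<in>J. \<kappa> c * ((\<alpha> l * \<phi> c l) * (\<alpha> l' * \<phi> c l')))"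
    by (simp add: K_def sum_distrib_left mult_ac)
  also have "\<dots> = (\<Sum>l\<in>L. \<Sum>c\<in>J. \<Sum>l'\<in>L. \<kappa> c * ((\<alpha> l * \<phi> c l) * (\<alpha> l' * \<phi> c l')))"
    by (intro sum.cong refl sum.swap)
  also have "\<dots> = (\<Sum>c\<in>J. \<Sum>l\<in>L. \<Sum>l'\<in>L. \<kappa> c * ((\<alpha> l * \<phi> c l) * (\<alpha> l' * \<phi> c l')))"
    by (rule sum.swap)
  also have "\<dots> = (\<Sum>c\<in>J. \<kappa> c * (\<Sum>l\<in>L. \<alpha> l * \<phi> c l)\<^sup>2)"
    by (simp only: power2_eq_square sum_product, simp only: sum_distrib_left)
  finally show ?thesis by (simp add: quad_def)
qed

text \<open>The trace of the kernel as an operator on L^2(w).\<close>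

lemma sum_w_K_diag: "(\<Sum>l\<in>L. w l * K l l) = (\<Sum>c\<in>J. \<kappa> c)"
proof -
  have "(\<Sum>l\<in>L. w l * K l l) = (\<Sum>c\<in>J. \<kappa> c * (\<Sum>l\<in>L. w l * \<phi> c l * \<phi> c l))"
    by (simp add: K_def sum_distrib_left) (subst sum.swap, simp add: mult_ac)
  also have "\<dots> = (\<Sum>c\<in>J. \<kappa> c)" by (intro sum.cong) (simp_all add: ortho)
  finally show ?thesis .
qed

text \<open>The squared Hilbert-Schmidt norm of the kernel: orthonormality leaves only the diagonal
  of a double sum over eigenvalues.\<close>

lemma sum_w_K_sq: "(\<Sum>l\<in>L. \<Sum>l'\<in>L. w l * w l' * (K l l')\<^sup>2) = (\<Sum>c\<in>J. (\<kappa> c)\<^sup>2)"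
proof -
  have "(\<Sum>l\<in>L. \<Sum>l'\<in>L. w l * w l' * (K l l')\<^sup>2) = (\<Sum>l\<in>L. \<Sum>l'\<in>L. \<Sum>c\<in>J. \<Sum>c'\<in>J.
      \<kappa> c * \<kappa> c' * ((w l * \<phi> c l * \<phi> c' l) * (w l' * \<phi> c l' * \<phi> c' l')))"
    by (simp add: K_def power2_eq_square sum_product sum_distrib_left mult_ac)
  also have "\<dots> = (\<Sum>l\<in>L. \<Sum>c\<in>J. \<Sum>l'\<in>L. \<Sum>c'\<in>J.
      \<kappa> c * \<kappa> c' * ((w l * \<phi> c l * \<phi> c' l) * (w l' * \<phi> c l' * \<phi> c' l')))"
    by (intro sum.cong refl sum.swap)
  also have "\<dots> = (\<Sum>c\<in>J. \<Sum>l\<in>L. \<Sum>c'\<in>J. \<Sum>l'\<in>L.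
      \<kappa> c * \<kappa> c' * ((w l * \<phi> c l * \<phi> c' l) * (w l' * \<phi> c l' * \<phi> c' l')))"
    by (subst sum.swap) (intro sum.cong refl sum.swap)
  also have "\<dots> = (\<Sum>c\<in>J. \<Sum>c'\<in>J. \<Sum>l\<in>L. \<Sum>l'\<in>L.
      \<kappa> c * \<kappa> c' * ((w l * \<phi> c l * \<phi> c' l) * (w l' * \<phi> c l' * \<phi> c' l')))"
    by (intro sum.cong refl sum.swap)
  also have "\<dots> = (\<Sum>c\<in>J. \<Sum>c'\<in>J. \<kappa> c * \<kappa> c' *
      ((\<Sum>l\<in>L. w l * \<phi> c l * \<phi> c' l) * (\<Sum>l\<in>L. w l * \<phi> c l * \<phi> c' l)))"
    by (simp only: sum_product, simp only: sum_distrib_left)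
  also have "\<dots> = (\<Sum>c\<in>J. \<Sum>c'\<in>J. if c = c' then (\<kappa> c)\<^sup>2 else 0)"
    by (intro sum.cong) (auto simp: ortho power2_eq_square)
  also have "\<dots> = (\<Sum>c\<in>J. (\<kappa> c)\<^sup>2)" using finJ by simp
  finally show ?thesis .
qed

lemma phi_bounded: obtains F where "F > 0" "\<And>c l. c \<in> J \<Longrightarrow> l \<in> L \<Longrightarrow> \<bar>\<phi> c l\<bar> \<le> F"
proof
  let ?F = "1 + (\<Sum>c\<in>J. \<Sum>l\<in>L. \<bar>\<phi> c l\<bar>)"
  show "?F > 0" by (simp add: add_pos_nonneg sum_nonneg)
  fix c l assume "c \<in> J" "l \<in> L"
  then have "\<bar>\<phi> c l\<bar> \<le> (\<Sum>l\<in>L. \<bar>\<phi> c l\<bar>)" "(\<Sum>l\<in>L. \<bar>\<phi> c l\<bar>) \<le> (\<Sum>c\<in>J. \<Sum>l\<in>L. \<bar>\<phi> c l\<bar>)"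
    using finL finJ by (auto intro!: member_le_sum[of l L "\<lambda>l. \<bar>\<phi> c l\<bar>"]
        member_le_sum[of c J "\<lambda>c. \<Sum>l\<in>L. \<bar>\<phi> c l\<bar>"] sum_nonneg)
  then show "\<bar>\<phi> c l\<bar> \<le> ?F" by linarith
qed

lemma K_bounded: obtains B where "B > 0" "\<And>l l'. l \<in> L \<Longrightarrow> l' \<in> L \<Longrightarrow> \<bar>K l l'\<bar> \<le> B"
proof
  let ?B = "1 + (\<Sum>l\<in>L. \<Sum>l'\<in>L. \<bar>K l l'\<bar>)"
  show "?B > 0" by (simp add: add_pos_nonneg sum_nonneg)
  fix l l' assume "l \<in> L" "l' \<in> L"
  then have "\<bar>K l l'\<bar> \<le> (\<Sum>l'\<in>L. \<bar>K l l'\<bar>)" "(\<Sum>l'\<in>L. \<bar>K l l'\<bar>) \<le> (\<Sum>l\<in>L. \<Sum>l'\<in>L. \<bar>K l l'\<bar>)"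
    using finL by (auto intro!: member_le_sum[of l' L "\<lambda>l'. \<bar>K l l'\<bar>"]
        member_le_sum[of l L "\<lambda>l. \<Sum>l'\<in>L. \<bar>K l l'\<bar>"] sum_nonneg)
  then show "\<bar>K l l'\<bar> \<le> ?B" by linarith
qed

text \<open>As \<open>\<phi> c\<close> is centred, the frequency may be replaced by its deviation
  from \<open>w\<close>; spectral coordinates are therefore small near \<open>w\<close>.\<close>

lemma sum_freq_phi_le:
  assumes F: "\<And>c l. c \<in> J \<Longrightarrow> l \<in> L \<Longrightarrow> \<bar>\<phi> c l\<bar> \<le> F" and c: "c \<in> J"
  shows "\<bar>\<Sum>l\<in>L. freq n \<omega> l * \<phi> c l\<bar> \<le> F * dev n \<omega>"
proof -
  have "(\<Sum>l\<in>L. freq n \<omega> l * \<phi> c l) = (\<Sum>l\<in>L. (freq n \<omega> l - w l) * \<phi> c l)"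
    using mean[OF c] by (simp add: left_diff_distrib sum_subtractf)
  also have "\<bar>\<dots>\<bar> \<le> (\<Sum>l\<in>L. \<bar>freq n \<omega> l - w l\<bar> * F)"
    by (rule sum_abs[THEN order_trans], intro sum_mono) (auto simp: abs_mult intro!: mult_left_mono F c)
  finally show ?thesis by (simp add: dev_def sum_distrib_left mult.commute)
qed

lemma pair_sum_eq:
  assumes "\<omega> \<in> assignments L n" and k: "\<And>l l'. k l l' = k l' l"
  shows "(\<Sum>(u, v)\<in>vertex_pairs n. k (\<omega> u) (\<omega> v)) =
    (n\<^sup>2 * (\<Sum>l\<in>L. \<Sum>l'\<in>L. freq n \<omega> l * freq n \<omega> l' * k l l')
      - n * (\<Sum>l\<in>L. freq n \<omega> l * k l l)) / 2"
proof -
  note * = sum_assignment_eq_freq[OF finL assms(1)]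
  have "(\<Sum>u<n. \<Sum>v<n. k (\<omega> u) (\<omega> v)) = (\<Sum>u<n. n * (\<Sum>l'\<in>L. freq n \<omega> l' * k (\<omega> u) l'))"
    by (simp add: *)
  also have "\<dots> = n * (\<Sum>l\<in>L. freq n \<omega> l * (n * (\<Sum>l'\<in>L. freq n \<omega> l' * k l l')))"
    by (rule *)
  also have "\<dots> = n\<^sup>2 * (\<Sum>l\<in>L. \<Sum>l'\<in>L. freq n \<omega> l * freq n \<omega> l' * k l l')"
    by (simp add: power2_eq_square sum_distrib_left mult_ac)
  finally show ?thesis
    using sum_vertex_pairs[of "\<lambda>u v. k (\<omega> u) (\<omega> v)" n] k *[of "\<lambda>l. k l l"] by simp
qed

end

section \<open>Spectral decomposition and eigenvalues\<close>

text \<open>The determinant of the block matrix with rows (x I, X) and (Y, I) is found twice: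
  clearing the upper right block by left multiplication with \<open>?P\<close> leaves x I - X Y, by
  right multiplication with \<open>?R\<close> it leaves I - Y X / x.\<close>

lemma det_sylvester:
  fixes X Y :: "real mat"
  assumes X: "X \<in> carrier_mat n m" and Y: "Y \<in> carrier_mat m n" and x: "x \<noteq> 0"
  shows "x ^ m * det (x \<cdot>\<^sub>m 1\<^sub>m n - X * Y) = x ^ n * det (x \<cdot>\<^sub>m 1\<^sub>m m - Y * X)"
proof -
  let ?M = "four_block_mat (x \<cdot>\<^sub>m 1\<^sub>m n) X Y (1\<^sub>m m)"
  let ?P = "four_block_mat (1\<^sub>m n) (- X) (0\<^sub>m m n) (1\<^sub>m m)"
  let ?R = "four_block_mat (1\<^sub>m n) (- (1 / x) \<cdot>\<^sub>m X) (0\<^sub>m m n) (1\<^sub>m m)"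
  note c = X Y
  have M: "?M \<in> carrier_mat (n + m) (n + m)" and P: "?P \<in> carrier_mat (n + m) (n + m)"
    and R: "?R \<in> carrier_mat (n + m) (n + m)" using c by auto
  have detP: "det ?P = 1" by (subst det_four_block_mat_lower_left_zero) (use c in auto)
  have detR: "det ?R = 1" by (subst det_four_block_mat_lower_left_zero) (use c in auto)
  have PM: "?P * ?M = four_block_mat (x \<cdot>\<^sub>m 1\<^sub>m n - X * Y) (0\<^sub>m n m) Y (1\<^sub>m m)"
    by (subst mult_four_block_mat[of _ n n _ m _ m _ _ n _ m], insert c)
       (auto intro!: arg_cong2[where f = "\<lambda>a b. four_block_mat a b Y (1\<^sub>m m)"] eq_matI)
  have MR: "?M * ?R = four_block_mat (x \<cdot>\<^sub>m 1\<^sub>m n) (0\<^sub>m n m) Y (1\<^sub>m m - (1 / x) \<cdot>\<^sub>m (Y * X))"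
    by (subst mult_four_block_mat[of _ n n _ m _ m _ _ n _ m], insert c x)
       (auto intro!: arg_cong2[where f = "\<lambda>a b. four_block_mat (x \<cdot>\<^sub>m 1\<^sub>m n) a Y b"] eq_matI)
  have "det (?P * ?M) = det ?M" using det_mult[OF P M] detP by simp
  then have d1: "det ?M = det (x \<cdot>\<^sub>m 1\<^sub>m n - X * Y)"
    unfolding PM by (subst (asm) det_four_block_mat_upper_right_zero[of _ n _ m]) (use c in auto)
  have "det (?M * ?R) = det ?M" using det_mult[OF M R] detR by simp
  then have d2: "det ?M = x ^ n * det (1\<^sub>m m - (1 / x) \<cdot>\<^sub>m (Y * X))"
    unfolding MR by (subst (asm) det_four_block_mat_upper_right_zero[of _ n _ m]) (use c in \<open>auto simp: det_smult\<close>)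
  have "x \<cdot>\<^sub>m 1\<^sub>m m - Y * X = x \<cdot>\<^sub>m (1\<^sub>m m - (1 / x) \<cdot>\<^sub>m (Y * X))"
    by (rule eq_matI) (use c x in \<open>auto simp: field_simps\<close>)
  then have d3: "det (x \<cdot>\<^sub>m 1\<^sub>m m - Y * X) = x ^ m * det (1\<^sub>m m - (1 / x) \<cdot>\<^sub>m (Y * X))"
    using c by (simp add: det_smult)
  show ?thesis using d1 d2 d3 by simp
qed

section \<open>Spectral theorem for symmetric real forms\<close>

text \<open>A case of Tychonoff's theorem. Vectors and laws are total functions here, so coordinates
  outside the index set are pinned to 0 to obtain compactness.\<close>

lemma compact_box:
  "compact {f :: 'i \<Rightarrow> real. (\<forall>i\<in>I. f i \<in> {a..b}) \<and> (\<forall>i. i \<notin> I \<longrightarrow> f i = 0)}"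
proof -
  have "compactin (product_topology (\<lambda>_::'i. euclideanreal) UNIV) (PiE UNIV (\<lambda>i. if i \<in> I then {a..b} else {0}))"
    unfolding compactin_PiE by auto
  then have "compact (PiE UNIV (\<lambda>i. if i \<in> I then {a..b} else {0::real}))"
    by (simp add: euclidean_product_topology)
  also have "PiE UNIV (\<lambda>i. if i \<in> I then {a..b} else {0::real}) =
    {f. (\<forall>i\<in>I. f i \<in> {a..b}) \<and> (\<forall>i. i \<notin> I \<longrightarrow> f i = 0)}"
    by (auto simp: PiE_iff split: if_splits)
  finally show ?thesis .
qed

definition bil :: "nat \<Rightarrow> (nat \<Rightarrow> nat \<Rightarrow> real) \<Rightarrow> (nat \<Rightarrow> real) \<Rightarrow> (nat \<Rightarrow> real) \<Rightarrow> real" where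
  "bil s S x y = (\<Sum>i<s. \<Sum>j<s. x i * S i j * y j)"

lemma bil_add_right:
  fixes y z :: "nat \<Rightarrow> real"
  shows "bil s S x (\<lambda>i. y i + c * z i) = bil s S x y + c * bil s S x z"
  by (simp add: bil_def algebra_simps sum.distrib sum_distrib_left)

lemma bil_add_left:
  fixes y z :: "nat \<Rightarrow> real"
  shows "bil s S (\<lambda>i. y i + c * z i) x = bil s S y x + c * bil s S z x"
  by (simp add: bil_def algebra_simps sum.distrib sum_distrib_left)

lemma bil_sym:
  assumes "\<And>i j. i < s \<Longrightarrow> j < s \<Longrightarrow> S i j = S j i"
  shows "bil s S x y = bil s S y x"
  unfolding bil_def by (subst sum.swap) (auto intro!: sum.cong simp: assms)

lemma bil_unit_left: "i < s \<Longrightarrow> bil s S (\<lambda>k. if k = i then 1 else 0) y = (\<Sum>j<s. S i j * y j)"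
proof -
  assume i: "i < s"
  have "bil s S (\<lambda>k. if k = i then 1 else 0) y = (\<Sum>k<s. if k = i then (\<Sum>j<s. S i j * y j) else 0)"
    unfolding bil_def by (intro sum.cong) auto
  then show ?thesis using i by simp
qed

text \<open>The polynomial t -> form(u + t y) is non-negative and vanishes at t = 0, so its linear
  coefficient must vanish.\<close>

lemma psd_null_radical:
  fixes S :: "nat \<Rightarrow> nat \<Rightarrow> real" and u y :: "nat \<Rightarrow> real"
  assumes sym: "\<And>i j. i < s \<Longrightarrow> j < s \<Longrightarrow> S i j = S j i"
    and psd: "\<And>x. bil s S x x \<ge> 0" and u: "bil s S u u = 0"
  shows "bil s S u y = 0"
proof (rule ccontr)
  assume ne: "bil s S u y \<noteq> 0"
  define b where "b = bil s S u y"
  define e where "e = bil s S y y"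
  have e: "e \<ge> 0" using psd by (simp add: e_def)
  have *: "2 * t * b + t\<^sup>2 * e \<ge> 0" for t
    using psd[of "\<lambda>i. u i + t * y i"] u bil_sym[of s S y u, OF sym]
    by (simp add: bil_add_left bil_add_right b_def e_def algebra_simps power2_eq_square)
  \<comment> \<open>An approximate minimiser of the parabola; the \<open>+ 1\<close> avoids a
    division by 0 when \<open>e = 0\<close>.\<close>
  have "2 * (- b / (e + 1)) * b + (- b / (e + 1))\<^sup>2 * e = - (b\<^sup>2 * (e + 2) / (e + 1)\<^sup>2)"
  proof -
    define k where "k = e + 1"
    have k: "k > 0" "e = k - 1" using e by (auto simp: k_def)
    show ?thesis using k(1) unfolding k(2) by (simp add: field_simps power2_eq_square)
  qed
  also have "\<dots> < 0" using ne e by (simp add: b_def)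
  finally show False using *[of "- b / (e + 1)"] by simp
qed

text \<open>Let \<open>u\<close> maximise the absolute value of the form on the unit sphere. Maximal
  value times |x|^2, minus the form with the sign it has at \<open>u\<close>, is positive
  semidefinite and vanishes at \<open>u\<close>; hence \<open>u\<close> lies in its radical, which
  is the eigenvalue equation. The absolute value makes the eigenvalue nonzero even for negative
  forms.\<close>

lemma symmetric_form_max_eigenvector:
  fixes S :: "nat \<Rightarrow> nat \<Rightarrow> real"
  assumes sym: "\<And>i j. i < s \<Longrightarrow> j < s \<Longrightarrow> S i j = S j i"
    and ne: "i0 < s" "j0 < s" "S i0 j0 \<noteq> 0"
  obtains \<mu> u where "\<mu> \<noteq> 0" "(\<Sum>i<s. u i * u i) = 1" "\<And>i. i < s \<Longrightarrow> (\<Sum>j<s. S i j * u j) = \<mu> * u i"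
proof -
  define X where "X = {f :: nat \<Rightarrow> real. (\<forall>i\<in>{..<s}. f i \<in> {-1..1}) \<and> (\<forall>i. i \<notin> {..<s} \<longrightarrow> f i = 0)}
     \<inter> {f. (\<Sum>i<s. f i * f i) = 1}"
  have cont: "continuous_on UNIV (\<lambda>f :: nat \<Rightarrow> real. f i)" for i by simp
  have "closed {f :: nat \<Rightarrow> real. (\<Sum>i<s. f i * f i) = 1}"
    by (intro closed_Collect_eq continuous_intros cont)
  then have X: "compact X" unfolding X_def by (intro compact_Int_closed compact_box)
  define q where "q f = \<bar>bil s S f f\<bar>" for f
  have q_cont: "continuous_on X q" unfolding q_def bil_def
    by (intro continuous_intros continuous_on_subset[OF cont]) auto
  define e0 where "e0 = (\<lambda>k::nat. if k = i0 then 1 else (0::real))"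
  have "e0 \<in> X" using ne by (auto simp: X_def e0_def if_distrib cong: if_cong)
  then obtain u where u: "u \<in> X" "\<And>y. y \<in> X \<Longrightarrow> q y \<le> q u"
    using continuous_attains_sup[OF X _ q_cont] by blast
  have u1: "(\<Sum>i<s. u i * u i) = 1" using u by (simp add: X_def)
  have scale: "q y \<le> q u * (\<Sum>i<s. y i * y i)" for y
  proof (cases "(\<Sum>i<s. y i * y i) = 0")
    case True
    then have "y i = 0" if "i < s" for i using that by (simp add: sum_nonneg_eq_0_iff)
    then show ?thesis using True by (simp add: q_def bil_def)
  next
    case False
    define r where "r = sqrt (\<Sum>i<s. y i * y i)"
    have r: "r > 0" "r * r = (\<Sum>i<s. y i * y i)"
      using False by (auto simp: r_def sum_nonneg order.strict_iff_order)
    define z where "z = (\<lambda>i. if i < s then y i / r else 0)"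
    have z1: "(\<Sum>i<s. z i * z i) = 1"
    proof -
      have "(\<Sum>i<s. z i * z i) = (\<Sum>i<s. y i * y i / (r * r))" by (intro sum.cong) (auto simp: z_def)
      then show ?thesis using r False by (simp flip: sum_divide_distrib)
    qed
    have "z i * z i \<le> 1" if "i < s" for i
      using z1 member_le_sum[of i "{..<s}" "\<lambda>i. z i * z i"] that by auto
    then have "z i \<in> {-1..1}" if "i < s" for i
      using that by (auto simp: abs_le_iff[symmetric] abs_square_le_1[symmetric] power2_eq_square)
         (metis abs_le_iff abs_square_le_1 power2_eq_square neg_le_iff_le minus_le_iff)+
    then have "z \<in> X" using z1 by (auto simp: X_def z_def)
    have "bil s S y y = r * r * bil s S z z"
    proof -
      have "bil s S z z = (\<Sum>i<s. \<Sum>j<s. y i * S i j * y j / (r * r))"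
        unfolding bil_def by (intro sum.cong) (auto simp: z_def)
      then show ?thesis using r False by (simp add: bil_def flip: sum_divide_distrib)
    qed
    then have "q y = \<bar>r * r\<bar> * q z" by (simp only: q_def abs_mult)
    then have "q y = (r * r) * q z" using r(1) by simp
    also have "\<dots> \<le> (r * r) * q u" using u(2)[OF \<open>z \<in> X\<close>] r(1) by (intro mult_left_mono) auto
    finally show ?thesis using r by (simp add: mult.commute)
  qed
  have M_pos: "q u > 0"
  proof (rule ccontr)
    assume "\<not> q u > 0"
    then have "q u = 0" by (simp add: q_def)
    then have z: "bil s S y y = 0" for y using scale[of y] by (simp add: q_def)
    \<comment> \<open>Polarisation: a form vanishing on all vectors vanishes at
      \<open>e0 + e1\<close>, which isolates the entry \<open>S i0 j0\<close>.\<close>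
    define e1 where "e1 = (\<lambda>k::nat. if k = j0 then 1 else (0::real))"
    have "0 = bil s S (\<lambda>i. e0 i + 1 * e1 i) (\<lambda>i. e0 i + 1 * e1 i)" by (simp only: z)
    also have "\<dots> = 2 * bil s S e0 e1"
      using z[of e0] z[of e1] bil_sym[of s S e0 e1, OF sym] by (simp only: bil_add_left bil_add_right) simp
    also have "bil s S e0 e1 = S i0 j0"
      unfolding e0_def e1_def using ne by (simp add: bil_unit_left if_distrib cong: if_cong)
    finally show False using ne by simp
  qed
  define \<epsilon> where "\<epsilon> = sgn (bil s S u u)"
  have eps: "\<epsilon> * \<epsilon> = 1" "\<epsilon> * bil s S u u = q u" "\<epsilon> \<noteq> 0" "\<bar>\<epsilon>\<bar> = 1"
    using M_pos by (auto simp: \<epsilon>_def q_def sgn_if)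
  \<comment> \<open>The semidefinite comparison form, with \<open>u\<close> as null vector.\<close>
  define T where "T i j = (if i = j then q u else 0) - \<epsilon> * S i j" for i j
  have T: "bil s T x y = q u * (\<Sum>i<s. x i * y i) - \<epsilon> * bil s S x y" for x y
  proof -
    have "bil s T x y = (\<Sum>i<s. (\<Sum>j<s. if i = j then x i * q u * y j else 0)) - (\<Sum>i<s. \<Sum>j<s. \<epsilon> * (x i * S i j * y j))"
      unfolding bil_def T_def sum_subtractf[symmetric]
      by (intro sum.cong refl) (auto simp: algebra_simps)
    then show ?thesis by (simp add: bil_def sum_distrib_left mult_ac)
  qed
  have rad: "bil s T u y = 0" for y
  proof (rule psd_null_radical)
    show "bil s T x x \<ge> 0" for x
    proof -
      have "\<epsilon> * bil s S x x \<le> \<bar>\<epsilon> * bil s S x x\<bar>" by (rule abs_ge_self)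
      also have "\<dots> = q x" by (simp add: abs_mult eps q_def)
      finally show ?thesis using scale[of x] by (simp add: T)
    qed
    show "bil s T u u = 0" by (simp add: T u1 eps)
  qed (auto simp: T_def sym)
  show thesis
  proof
    show "\<epsilon> * q u \<noteq> 0" using M_pos eps by simp
    show "(\<Sum>i<s. u i * u i) = 1" by (rule u1)
    fix i assume i: "i < s"
    define ei where "ei = (\<lambda>k::nat. if k = i then 1 else (0::real))"
    have "0 = bil s T u ei" by (simp add: rad)
    also have "\<dots> = q u * u i - \<epsilon> * bil s S ei u"
      using i bil_sym[of s S ei u, OF sym] by (simp add: T ei_def if_distrib cong: if_cong)
    also have "bil s S ei u = (\<Sum>j<s. S i j * u j)" using i by (simp add: ei_def bil_unit_left)
    finally have "\<epsilon> * (\<epsilon> * (\<Sum>j<s. S i j * u j)) = \<epsilon> * (q u * u i)" by simp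
    then show "(\<Sum>j<s. S i j * u j) = \<epsilon> * q u * u i" using eps by (simp flip: mult.assoc)
  qed
qed

text \<open>For a square matrix V, V V^T = 1 implies V^T V = 1.\<close>

lemma orthonormal_complete:
  fixes v :: "nat \<Rightarrow> nat \<Rightarrow> real"
  assumes "\<And>a b. a < s \<Longrightarrow> b < s \<Longrightarrow> (\<Sum>i<s. v a i * v b i) = (if a = b then 1 else 0)"
    and "i < s" "j < s"
  shows "(\<Sum>a<s. v a i * v a j) = (if i = j then 1 else 0)"
proof -
  define V where "V = mat s s (\<lambda>(a, i). v a i)"
  have V: "V \<in> carrier_mat s s" by (simp add: V_def)
  have "V * transpose_mat V = 1\<^sub>m s"
    by (rule eq_matI) (auto simp: V_def scalar_prod_def assms(1) atLeast0LessThan)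
  then have "transpose_mat V * V = 1\<^sub>m s" using V by (intro mat_mult_left_right_inverse[of V]) auto
  then have "(transpose_mat V * V) $$ (i, j) = (if i = j then 1 else 0)" using assms by simp
  then show ?thesis using assms by (simp add: V_def scalar_prod_def atLeast0LessThan)
qed

text \<open>Deflation. The vectors \<open>v\<close> are an orthonormal family already known to lie
  in the kernel, and \<open>t\<close> counts the dimensions left. Subtracting \<mu> u u^T moves
  \<open>u\<close> into the kernel; once \<open>k = s\<close> the kernel is everything and the
  matrix is 0.\<close>

lemma symmetric_decomposition_aux:
  fixes S v :: "nat \<Rightarrow> nat \<Rightarrow> real"
  assumes "k + t = s"
    and "\<And>i j. i < s \<Longrightarrow> j < s \<Longrightarrow> S i j = S j i"
    and "\<And>a b. a < k \<Longrightarrow> b < k \<Longrightarrow> (\<Sum>i<s. v a i * v b i) = (if a = b then 1 else (0::real))"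
    and "\<And>a i. a < k \<Longrightarrow> i < s \<Longrightarrow> (\<Sum>j<s. S i j * v a j) = 0"
  shows "\<exists>m \<mu> u. (\<forall>a<m. \<mu> a \<noteq> 0) \<and>
    (\<forall>a<m. \<forall>b<m. (\<Sum>i<s. u a i * u b i) = (if a = b then 1 else (0::real))) \<and>
    (\<forall>i<s. \<forall>j<s. S i j = (\<Sum>a<m::nat. \<mu> a * u a i * u a j))"
  using assms
proof (induction t arbitrary: k S v)
  case 0
  have "S i j = 0" if ij: "i < s" "j < s" for i j
  proof -
    have "S i j = (\<Sum>l<s. S i l * (if l = j then 1 else 0))" using ij by (simp add: if_distrib cong: if_cong)
    also have "\<dots> = (\<Sum>l<s. S i l * (\<Sum>a<s. v a l * v a j))"
      using 0 ij by (intro sum.cong refl arg_cong2[where f = "(*)"] orthonormal_complete[symmetric]) auto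
    also have "\<dots> = (\<Sum>a<s. (\<Sum>l<s. S i l * v a l) * v a j)"
      by (simp add: sum_distrib_left sum_distrib_right mult.assoc) (rule sum.swap)
    also have "\<dots> = 0"
    proof (intro sum.neutral ballI)
      fix a assume "a \<in> {..<s}"
      then show "(\<Sum>l<s. S i l * v a l) * v a j = 0" using "0.prems"(4)[of a i] "0.prems"(1) ij by simp
    qed
    finally show ?thesis .
  qed
  then show ?case by (intro exI[of _ "0::nat"]) auto
next
  case (Suc t)
  note sym = Suc.prems(2) and vo = Suc.prems(3) and Sv = Suc.prems(4)
  show ?case
  proof (cases "\<forall>i<s. \<forall>j<s. S i j = 0")
    case True
    then show ?thesis by (intro exI[of _ "0::nat"]) auto
  next
    case False
    then obtain i0 j0 where "i0 < s" "j0 < s" "S i0 j0 \<noteq> 0" by blast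
    from symmetric_form_max_eigenvector[OF sym this] obtain \<mu> u
      where u: "\<mu> \<noteq> 0" "(\<Sum>i<s. u i * u i) = 1" "\<And>i. i < s \<Longrightarrow> (\<Sum>j<s. S i j * u j) = \<mu> * u i" by blast
    \<comment> \<open>Eigenvectors of a nonzero eigenvalue are orthogonal to the kernel; this keeps
      the enlarged family orthonormal.\<close>
    have orth: "(\<Sum>i<s. u i * y i) = 0" if y: "\<And>i. i < s \<Longrightarrow> (\<Sum>j<s. S i j * y j) = 0" for y
    proof -
      have "\<mu> * (\<Sum>i<s. u i * y i) = (\<Sum>i<s. (\<Sum>j<s. S i j * u j) * y i)"
        using u by (simp add: sum_distrib_left mult.assoc)
      also have "\<dots> = (\<Sum>j<s. u j * (\<Sum>i<s. S j i * y i))"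
        by (simp add: sum_distrib_left sum_distrib_right, subst sum.swap) (auto intro!: sum.cong simp: sym)
      also have "\<dots> = 0" using y by simp
      finally show ?thesis using u(1) by simp
    qed
    define S' where "S' i j = S i j - \<mu> * u i * u j" for i j
    have S'_apply: "(\<Sum>j<s. S' i j * y j) = (\<Sum>j<s. S i j * y j) - \<mu> * u i * (\<Sum>j<s. u j * y j)" for i y
      by (simp add: S'_def left_diff_distrib sum_subtractf sum_distrib_left mult.assoc)
    define v' where "v' a = (if a = k then u else v a)" for a
    have S'v': "(\<Sum>j<s. S' i j * v' a j) = 0" if "a < Suc k" "i < s" for a i
      using that u orth[of "v a"] Sv by (cases "a = k") (auto simp: S'_apply v'_def)
    have "\<exists>m \<mu> u. (\<forall>a<m. \<mu> a \<noteq> 0) \<and>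
      (\<forall>a<m. \<forall>b<m. (\<Sum>i<s. u a i * u b i) = (if a = b then 1 else (0::real))) \<and>
      (\<forall>i<s. \<forall>j<s. S' i j = (\<Sum>a<m::nat. \<mu> a * u a i * u a j))"
    proof (rule Suc.IH)
      show "Suc k + t = s" using Suc.prems by simp
      show "S' i j = S' j i" if "i < s" "j < s" for i j using sym[OF that] by (simp add: S'_def)
      show "(\<Sum>i<s. v' a i * v' b i) = (if a = b then 1 else 0)" if "a < Suc k" "b < Suc k" for a b
        using that u orth[of "v a"] orth[of "v b"] Sv vo[of a b]
        by (cases "a = k"; cases "b = k") (auto simp: v'_def mult.commute)
    qed (use S'v' in auto)
    then obtain m \<mu>' u' where I: "\<forall>a<m. \<mu>' a \<noteq> 0"
      "\<And>a b. a < m \<Longrightarrow> b < m \<Longrightarrow> (\<Sum>i<s. u' a i * u' b i) = (if a = b then 1 else (0::real))"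
      "\<And>i j. i < s \<Longrightarrow> j < s \<Longrightarrow> S' i j = (\<Sum>a<m::nat. \<mu>' a * u' a i * u' a j)" by blast
    \<comment> \<open>Each \<open>u' b\<close> is an eigenvector of \<open>S'\<close> with nonzero
      eigenvalue, while \<open>u\<close> is in the kernel of \<open>S'\<close>. This is why nonzero
      eigenvalues are part of the induction.\<close>
    have orth': "(\<Sum>i<s. u i * u' b i) = 0" if b: "b < m" for b
    proof -
      have "(\<Sum>j<s. S' i j * u' b j) = \<mu>' b * u' b i" if i: "i < s" for i
      proof -
        have "(\<Sum>j<s. S' i j * u' b j) = (\<Sum>a<m. \<mu>' a * u' a i * (\<Sum>j<s. u' a j * u' b j))"
          using i by (simp add: I(3) sum_distrib_left sum_distrib_right mult.assoc) (rule sum.swap)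
        also have "\<dots> = (\<Sum>a<m. if a = b then \<mu>' a * u' a i else 0)"
          using b by (intro sum.cong) (auto simp: I(2))
        finally show ?thesis using b by simp
      qed
      then have "\<mu>' b * (\<Sum>i<s. u i * u' b i) = (\<Sum>i<s. u i * (\<Sum>j<s. S' i j * u' b j))"
        by (simp add: sum_distrib_left mult_ac)
      also have "\<dots> = (\<Sum>j<s. (\<Sum>i<s. S' j i * u i) * u' b j)"
        by (simp add: sum_distrib_left sum_distrib_right, subst sum.swap)
           (auto intro!: sum.cong simp: sym S'_def mult_ac)
      also have "\<dots> = 0" using S'v'[of k] by (simp add: v'_def)
      finally show ?thesis using I(1) b by simp
    qed
    define \<mu>'' where "\<mu>'' a = (if a = m then \<mu> else \<mu>' a)" for a
    define u'' where "u'' a = (if a = m then u else u' a)" for a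
    show ?thesis
    proof (intro exI conjI allI impI)
      show "\<mu>'' a \<noteq> 0" if "a < Suc m" for a using that u(1) I(1) by (auto simp: \<mu>''_def)
      show "(\<Sum>i<s. u'' a i * u'' b i) = (if a = b then 1 else 0)" if "a < Suc m" "b < Suc m" for a b
        using that u(2) I(2)[of a b] orth'[of a] orth'[of b]
        by (cases "a = m"; cases "b = m") (auto simp: u''_def mult.commute)
      show "S i j = (\<Sum>a<Suc m. \<mu>'' a * u'' a i * u'' a j)" if "i < s" "j < s" for i j
        using I(3)[OF that] by (simp add: \<mu>''_def u''_def S'_def)
    qed
  qed
qed

lemma symmetric_decomposition:
  fixes S :: "nat \<Rightarrow> nat \<Rightarrow> real"
  assumes "\<And>i j. i < s \<Longrightarrow> j < s \<Longrightarrow> S i j = S j i"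
  obtains m \<mu> u where "\<And>a. a < m \<Longrightarrow> \<mu> a \<noteq> 0"
    "\<And>a b. a < m \<Longrightarrow> b < m \<Longrightarrow> (\<Sum>i<s. u a i * u b i) = (if a = b then 1 else (0::real))"
    "\<And>i j. i < s \<Longrightarrow> j < s \<Longrightarrow> S i j = (\<Sum>a<m::nat. \<mu> a * u a i * u a j)"
proof -
  have "\<exists>m \<mu> u. (\<forall>a<m. \<mu> a \<noteq> 0) \<and>
    (\<forall>a<m. \<forall>b<m. (\<Sum>i<s. u a i * u b i) = (if a = b then 1 else (0::real))) \<and>
    (\<forall>i<s. \<forall>j<s. S i j = (\<Sum>a<m::nat. \<mu> a * u a i * u a j))"
    by (rule symmetric_decomposition_aux[of 0 s s S]) (use assms in auto)
  then show thesis using that by blast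
qed

section \<open>From characteristic polynomials to eigenvalues\<close>

lemma proots_prod_linear:
  fixes X :: "real multiset"
  shows "proots (\<Prod>x\<in>#X. [:- x, 1:]) = X"
proof (induction X)
  case (add x X)
  have "(\<Prod>x\<in>#X. [:- x, 1:]) \<noteq> (0 :: real poly)" by (auto simp: prod_mset_zero_iff)
  then have "proots ([:- x, 1:] * (\<Prod>x\<in>#X. [:- x, 1:])) = proots [:- x, 1:] + proots (\<Prod>x\<in>#X. [:- x, 1:])"
    by (intro proots_mult) simp_all
  then show ?case by (simp only: image_mset_add_mset prod_mset.add_mset proots_linear_factor add.IH) simp
qed simp

lemma char_poly_eval:
  fixes A :: "real mat"
  assumes "A \<in> carrier_mat n n"
  shows "poly (char_poly A) x = det (x \<cdot>\<^sub>m 1\<^sub>m n - A)"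
proof -
  have "- char_matrix A x = x \<cdot>\<^sub>m 1\<^sub>m n - A"
    using assms by (intro eq_matI) (auto simp: char_matrix_def)
  then show ?thesis using char_poly_matrix[OF assms, of x] by simp
qed

text \<open>Sylvester's identity is applied twice: X Y has the nonzero spectrum of Y X = P R, and P
  R that of R P, which is diagonal with entries \<open>\<nu>\<close>. The powers of x in that
  identity become the zeros padding both multisets.\<close>

lemma char_poly_eigenvalues:
  fixes T :: "real mat" and ev \<nu> :: "nat \<Rightarrow> real" and U :: "nat \<Rightarrow> nat \<Rightarrow> real"
  assumes T: "T = X * Y" and X: "X \<in> carrier_mat s s" and Y: "Y \<in> carrier_mat s s" and s: "s > 0"
    and YX: "\<And>i j. i < s \<Longrightarrow> j < s \<Longrightarrow> (Y * X) $$ (i, j) = (\<Sum>a<Suc m. \<nu> a * U a i * U a j)"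
    and U: "\<And>a b. a < Suc m \<Longrightarrow> b < Suc m \<Longrightarrow> (\<Sum>i<s. U a i * U b i) = (if a = b then 1 else 0)"
    and ev: "char_poly T = (\<Prod>i<s. [:- ev i, 1:])"
  shows "replicate_mset (Suc m) 0 + image_mset ev (mset_set {..<s}) =
    replicate_mset s 0 + image_mset \<nu> (mset_set {..<Suc m})"
proof -
  define P where "P = mat s (Suc m) (\<lambda>(i, a). \<nu> a * U a i)"
  define R where "R = mat (Suc m) s (\<lambda>(a, i). U a i)"
  have PR_c: "P \<in> carrier_mat s (Suc m)" "R \<in> carrier_mat (Suc m) s" by (auto simp: P_def R_def)
  have PR: "P * R = Y * X"
  proof (rule eq_matI)
    fix i j assume "i < dim_row (Y * X)" "j < dim_col (Y * X)"
    then have ij: "i < s" "j < s" using X Y by auto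
    then show "(P * R) $$ (i, j) = (Y * X) $$ (i, j)"
      unfolding YX[OF ij] by (simp add: P_def R_def scalar_prod_def atLeast0LessThan)
  qed (use X Y in \<open>auto simp: P_def R_def\<close>)
  have T_c: "T \<in> carrier_mat s s" using T X Y by auto
  have det_diag: "det (x \<cdot>\<^sub>m 1\<^sub>m (Suc m) - R * P) = (\<Prod>a<Suc m. x - \<nu> a)" for x
  proof -
    have RP: "(R * P) $$ (a, b) = (if a = b then \<nu> b else 0)" if "a < Suc m" "b < Suc m" for a b
    proof -
      have "(R * P) $$ (a, b) = (\<Sum>i<s. U a i * (\<nu> b * U b i))"
        using that by (simp add: P_def R_def scalar_prod_def atLeast0LessThan)
      also have "\<dots> = \<nu> b * (\<Sum>i<s. U a i * U b i)" by (simp add: sum_distrib_left mult_ac)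
      finally show ?thesis using U[OF that] by simp
    qed
    have c: "x \<cdot>\<^sub>m 1\<^sub>m (Suc m) - R * P \<in> carrier_mat (Suc m) (Suc m)" using PR_c by auto
    have dims: "dim_row R = Suc m" "dim_col P = Suc m" using PR_c by auto
    have "det (x \<cdot>\<^sub>m 1\<^sub>m (Suc m) - R * P) = prod_list (diag_mat (x \<cdot>\<^sub>m 1\<^sub>m (Suc m) - R * P))"
    proof (rule det_upper_triangular[OF _ c])
      show "upper_triangular (x \<cdot>\<^sub>m 1\<^sub>m (Suc m) - R * P)"
        unfolding upper_triangular_def using dims by (auto simp: RP simp del: index_mult_mat(1))
    qed
    also have "\<dots> = (\<Prod>a<Suc m. x - \<nu> a)"
      unfolding prod_list_diag_prod using dims
      by (auto simp: RP atLeast0LessThan simp del: index_mult_mat(1) prod.lessThan_Suc intro!: prod.cong)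
    finally show ?thesis .
  qed
  have eval: "x ^ Suc m * (\<Prod>i<s. x - ev i) = x ^ s * (\<Prod>a<Suc m. x - \<nu> a)" for x
  proof (cases "x = 0")
    \<comment> \<open>Both powers of x have positive exponent, so both sides vanish; the identity
      thus holds at every point.\<close>
    case True then show ?thesis using s by simp
  next
    case False
    have "(\<Prod>i<s. x - ev i) = poly (char_poly T) x" by (simp add: ev poly_prod)
    also have "\<dots> = det (x \<cdot>\<^sub>m 1\<^sub>m s - X * Y)" using char_poly_eval[OF T_c] by (simp add: T)
    also have "\<dots> = det (x \<cdot>\<^sub>m 1\<^sub>m s - P * R)" using det_sylvester[OF X Y False] False by (simp add: PR)
    finally show ?thesis using det_sylvester[OF PR_c False] det_diag[of x] by (simp del: prod.lessThan_Suc)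
  qed
  let ?X = "replicate_mset (Suc m) 0 + image_mset ev (mset_set {..<s})"
  let ?Y = "replicate_mset s 0 + image_mset \<nu> (mset_set {..<Suc m})"
  have e: "poly (\<Prod>x\<in>#replicate_mset k 0 + image_mset f (mset_set {..<l}). [:- x, 1:]) x = x ^ k * (\<Prod>i<l. x - f i)"
    for k l :: nat and f :: "nat \<Rightarrow> real" and x :: real
    by (simp add: prod_mset.union image_replicate_mset multiset.map_comp o_def poly_prod flip: prod_unfold_prod_mset)
  have "poly (\<Prod>x\<in>#?X. [:- x, 1:]) = poly (\<Prod>x\<in>#?Y. [:- x, 1:])"
    by (rule ext) (simp only: e eval)
  then have "(\<Prod>x\<in>#?X. [:- x, 1:]) = (\<Prod>x\<in>#?Y. [:- x, 1:])" by (simp only: poly_eq_poly_eq_iff)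
  then have "proots (\<Prod>x\<in>#?X. [:- x, 1:]) = proots (\<Prod>x\<in>#?Y. [:- x, 1:])" by (rule arg_cong)
  then show ?thesis by (simp only: proots_prod_linear)
qed

text \<open>T = X Y with X = diag(sqrt \<pi>) and Y = diag(sqrt \<pi>) M / d, and Y X is symmetric
  with the same spectrum. The vector sqrt \<pi> is its eigenvector for 1; the other eigenvectors,
  divided by sqrt \<pi>, become functions orthonormal in L^2(\<pi>) and centred. Only nonzero
  eigenvalues are produced, so the spectrum is compared through functions with
  \<open>g 0 = 1\<close>, of which \<open>psi\<close> gives an instance.\<close>

lemma sbm_spectrum:
  fixes \<pi> :: "nat pmf" and M T :: "real mat" and ev :: "nat \<Rightarrow> real"
  assumes pi: "set_pmf \<pi> \<subseteq> {..<s}"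
    and M_carrier: "M \<in> carrier_mat s s"
    and M_symmetric: "transpose_mat M = M"
    and d_pos: "d > 0"
    and d_eq: "\<And>i. i < s \<Longrightarrow> (\<Sum>j<s. M $$ (i, j) * pmf \<pi> j) = d"
    and T_eq: "T = (1 / d) \<cdot>\<^sub>m (mat_diag s (pmf \<pi>) * M)"
    and ev_char_poly: "char_poly T = (\<Prod>i<s. [:- ev i, 1:])"
    and ev_0: "ev 0 = 1" and s: "s > 0"
  obtains m \<mu> f where
    "\<And>a b. a < m \<Longrightarrow> b < m \<Longrightarrow> (\<Sum>i\<in>set_pmf \<pi>. pmf \<pi> i * f a i * f b i) = (if a = b then 1 else (0::real))"
    "\<And>a. a < m \<Longrightarrow> (\<Sum>i\<in>set_pmf \<pi>. pmf \<pi> i * f a i) = 0"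
    "\<And>i j. i \<in> set_pmf \<pi> \<Longrightarrow> j \<in> set_pmf \<pi> \<Longrightarrow> M $$ (i, j) - d = d * (\<Sum>a<m::nat. \<mu> a * f a i * f a j)"
    "\<And>g :: real \<Rightarrow> ennreal. g 0 = 1 \<Longrightarrow> (\<Prod>i\<in>{1..<s}. g (ev i)) = (\<Prod>a<m. g (\<mu> a))"
proof -
  define p where "p = pmf \<pi>"
  have p0: "p i \<ge> 0" for i by (simp add: p_def)
  have p1: "(\<Sum>i<s. p i) = 1" unfolding p_def by (rule sum_pmf_eq_1) (use pi in auto)
  define v where "v i = sqrt (p i)" for i
  have vv: "v i * v i = p i" for i using p0 by (simp add: v_def)
  have Msym: "M $$ (i, j) = M $$ (j, i)" if "i < s" "j < s" for i j
    using that M_carrier arg_cong[OF M_symmetric, of "\<lambda>N. N $$ (i, j)"] by auto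
  \<comment> \<open>The symmetrised matrix with the eigenpair (1, sqrt \<pi>) removed; subtracting
    \<open>d\<close> does exactly that, by constancy of the mean degree.\<close>
  define S where "S i j = v i * v j * (M $$ (i, j) - d) / d" for i j
  obtain m \<mu> u where \<mu>: "\<And>a. a < m \<Longrightarrow> \<mu> a \<noteq> 0"
    and u: "\<And>a b. a < m \<Longrightarrow> b < m \<Longrightarrow> (\<Sum>i<s. u a i * u b i) = (if a = b then 1 else (0::real))"
    and S: "\<And>i j. i < s \<Longrightarrow> j < s \<Longrightarrow> S i j = (\<Sum>a<m::nat. \<mu> a * u a i * u a j)"
    using symmetric_decomposition[of s S] Msym by (auto simp: S_def mult_ac)
  have Su: "(\<Sum>j<s. S i j * u b j) = \<mu> b * u b i" if "i < s" "b < m" for i b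
  proof -
    have "(\<Sum>j<s. S i j * u b j) = (\<Sum>a<m. \<mu> a * u a i * (\<Sum>j<s. u a j * u b j))"
      using that(1) by (simp add: S sum_distrib_left sum_distrib_right mult.assoc) (rule sum.swap)
    also have "\<dots> = (\<Sum>a<m. if a = b then \<mu> a * u a i else 0)"
      using that(2) by (intro sum.cong) (auto simp: u)
    finally show ?thesis using that(2) by simp
  qed
  have Sv: "(\<Sum>i<s. v i * S i j) = 0" if "j < s" for j
  proof -
    have "(\<Sum>i<s. v i * S i j) = (\<Sum>i<s. v j / d * (M $$ (j, i) * p i - d * p i))"
      using that by (intro sum.cong refl) (simp add: S_def Msym[of _ j] flip: vv, simp add: algebra_simps)
    also have "\<dots> = v j / d * ((\<Sum>i<s. M $$ (j, i) * p i) - d * (\<Sum>i<s. p i))"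
      by (simp add: sum_distrib_left sum_subtractf right_diff_distrib)
    also have "\<dots> = 0" using d_eq[OF that] p1 by (simp add: p_def)
    finally show ?thesis .
  qed
  have vu: "(\<Sum>i<s. v i * u b i) = 0" if b: "b < m" for b
  proof -
    have "\<mu> b * (\<Sum>i<s. v i * u b i) = (\<Sum>i<s. v i * (\<Sum>j<s. S i j * u b j))"
      using b by (simp add: Su sum_distrib_left mult_ac)
    also have "\<dots> = (\<Sum>j<s. (\<Sum>i<s. v i * S i j) * u b j)"
      by (simp add: sum_distrib_left sum_distrib_right mult.assoc) (rule sum.swap)
    also have "\<dots> = 0" by (simp add: Sv)
    finally show ?thesis using \<mu>[OF b] by simp
  qed
  \<comment> \<open>A label of weight 0 has a zero row in \<open>S\<close>, and the eigenvalue is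
    nonzero; so nothing is lost when \<open>u\<close> is divided by \<open>v\<close> on the support
    only.\<close>
  have u0: "u b i = 0" if "b < m" "i < s" "p i = 0" for b i
  proof -
    have "\<mu> b * u b i = 0" using Su[OF that(2,1)] that(3) by (simp add: S_def v_def flip: Su)
    then show ?thesis using \<mu>[OF that(1)] by simp
  qed
  define f where "f a i = u a i / v i" for a i
  have vpos: "v i > 0" if "i \<in> set_pmf \<pi>" for i using that by (simp add: v_def p_def pmf_positive)
  have supp: "(\<Sum>i\<in>set_pmf \<pi>. h i) = (\<Sum>i<s. h i)" if "\<And>i. i < s \<Longrightarrow> p i = 0 \<Longrightarrow> h i = 0" for h :: "nat \<Rightarrow> real"
    by (rule sum.mono_neutral_left) (use pi that in \<open>auto simp: p_def set_pmf_iff\<close>)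
  \<comment> \<open>Index \<open>m\<close> puts the removed eigenpair back.\<close>
  define \<nu> where "\<nu> a = (if a = m then 1 else \<mu> a)" for a
  define U where "U a = (if a = m then v else u a)" for a
  define X where "X = mat_diag s v"
  define Y where "Y = mat s s (\<lambda>(i, j). v i * M $$ (i, j) / d)"
  have XY: "X \<in> carrier_mat s s" "Y \<in> carrier_mat s s" by (auto simp: X_def Y_def)
  have mset: "replicate_mset (Suc m) 0 + image_mset ev (mset_set {..<s}) =
    replicate_mset s 0 + image_mset \<nu> (mset_set {..<Suc m})"
  proof (rule char_poly_eigenvalues[OF _ XY s _ _ ev_char_poly])
    show "T = X * Y"
      unfolding T_eq X_def using M_carrier
      by (intro eq_matI) (auto simp: mat_diag_mult_left[of _ s s] Y_def p_def[symmetric] simp flip: vv)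
    show "(Y * X) $$ (i, j) = (\<Sum>a<Suc m. \<nu> a * U a i * U a j)" if ij: "i < s" "j < s" for i j
    proof -
      have "(Y * X) $$ (i, j) = v i * M $$ (i, j) / d * v j"
        unfolding X_def using ij XY by (subst mat_diag_mult_right[of _ s s]) (auto simp: Y_def)
      also have "\<dots> = S i j + v i * v j" using d_pos by (simp add: S_def field_simps)
      also have "\<dots> = (\<Sum>a<Suc m. \<nu> a * U a i * U a j)"
        using S[OF ij] by (simp add: \<nu>_def U_def)
      finally show ?thesis .
    qed
    show "(\<Sum>i<s. U a i * U b i) = (if a = b then 1 else 0)" if "a < Suc m" "b < Suc m" for a b
      using that u[of a b] vu[of a] vu[of b] p1
      by (cases "a = m"; cases "b = m") (auto simp: U_def vv mult.commute)
  qed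
  have "{..<s} = insert 0 {1..<s}" using s by auto
  then have "image_mset ev (mset_set {..<s}) = add_mset 1 (image_mset ev (mset_set {1..<s}))"
    using ev_0 by simp
  moreover have "image_mset \<nu> (mset_set {..<Suc m}) = add_mset 1 (image_mset \<mu> (mset_set {..<m}))"
    by (auto simp: lessThan_Suc \<nu>_def intro!: image_mset_cong)
  \<comment> \<open>One copy of the eigenvalue 1 is cancelled on each side; further copies may
    remain among the \<open>\<mu>\<close>.\<close>
  ultimately have mset': "replicate_mset (Suc m) 0 + image_mset ev (mset_set {1..<s}) =
    replicate_mset s 0 + image_mset \<mu> (mset_set {..<m})" using mset by simp
  show thesis
  proof
    show "(\<Sum>i\<in>set_pmf \<pi>. pmf \<pi> i * f a i * f b i) = (if a = b then 1 else 0)" if "a < m" "b < m" for a b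
    proof -
      have "(\<Sum>i\<in>set_pmf \<pi>. pmf \<pi> i * f a i * f b i) = (\<Sum>i\<in>set_pmf \<pi>. u a i * u b i)"
      proof (rule sum.cong)
        fix i assume "i \<in> set_pmf \<pi>"
        then show "pmf \<pi> i * f a i * f b i = u a i * u b i"
          using vpos[of i] unfolding p_def[symmetric] vv[symmetric] f_def by simp
      qed simp
      also have "\<dots> = (\<Sum>i<s. u a i * u b i)" by (rule supp) (use u0 that in auto)
      finally show ?thesis using u[OF that] by simp
    qed
    show "(\<Sum>i\<in>set_pmf \<pi>. pmf \<pi> i * f a i) = 0" if "a < m" for a
    proof -
      have "(\<Sum>i\<in>set_pmf \<pi>. pmf \<pi> i * f a i) = (\<Sum>i\<in>set_pmf \<pi>. v i * u a i)"
      proof (rule sum.cong)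
        fix i assume "i \<in> set_pmf \<pi>"
        then show "pmf \<pi> i * f a i = v i * u a i"
          using vpos[of i] unfolding p_def[symmetric] vv[symmetric] f_def by simp
      qed simp
      also have "\<dots> = (\<Sum>i<s. v i * u a i)" by (rule supp) (use u0 that in auto)
      finally show ?thesis using vu[OF that] by simp
    qed
    show "M $$ (i, j) - d = d * (\<Sum>a<m. \<mu> a * f a i * f a j)" if ij: "i \<in> set_pmf \<pi>" "j \<in> set_pmf \<pi>" for i j
    proof -
      have "(\<Sum>a<m. \<mu> a * f a i * f a j) = S i j / (v i * v j)"
        using ij pi by (subst S) (auto simp: f_def sum_divide_distrib)
      then show ?thesis using vpos[OF ij(1)] vpos[OF ij(2)] d_pos by (simp add: S_def)
    qed
    show "(\<Prod>i\<in>{1..<s}. g (ev i)) = (\<Prod>a<m. g (\<mu> a))" if g: "g 0 = 1" for g :: "real \<Rightarrow> ennreal"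
    proof -
      have "(\<Prod>x\<in>#replicate_mset (Suc m) 0 + image_mset ev (mset_set {1..<s}). g x) =
        (\<Prod>x\<in>#replicate_mset s 0 + image_mset \<mu> (mset_set {..<m}). g x)" by (simp only: mset')
      then show ?thesis
        by (simp add: g image_replicate_mset multiset.map_comp o_def flip: prod_unfold_prod_mset)
    qed
  qed
qed

section \<open>Asymptotics of the likelihood ratio\<close>

context kernel_model
begin

text \<open>The form is quadratic in \<open>dev\<close>, but a linear bound suffices, and
  \<open>dev\<close> is at most 2. It controls the correction due to \<open>n - d\<close> in place
  of \<open>n\<close>.\<close>

lemma abs_quad_freq_le:
  obtains C where "C \<ge> 0" "\<And>n \<omega>. \<omega> \<in> assignments L n \<Longrightarrow> n > 0 \<Longrightarrow> \<bar>quad (freq n \<omega>)\<bar> \<le> C * dev n \<omega>"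
proof -
  obtain F where F: "F > 0" "\<And>c l. c \<in> J \<Longrightarrow> l \<in> L \<Longrightarrow> \<bar>\<phi> c l\<bar> \<le> F" using phi_bounded by blast
  show thesis
  proof
    show "(\<Sum>c\<in>J. \<bar>\<kappa> c\<bar>) * F\<^sup>2 \<ge> 0" by (simp add: sum_nonneg)
    fix n :: nat and \<omega> assume w: "\<omega> \<in> assignments L n" "n > 0"
    have "(\<Sum>l\<in>L. freq n \<omega> l * \<phi> c l)\<^sup>2 \<le> F\<^sup>2 * (2 * dev n \<omega>)" if c: "c \<in> J" for c
    proof -
      have "(\<Sum>l\<in>L. freq n \<omega> l * \<phi> c l)\<^sup>2 \<le> (F * dev n \<omega>)\<^sup>2"
        using sum_freq_phi_le[OF F(2) c, of n \<omega>] by (intro abs_le_square_iff[THEN iffD1]) auto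
      also have "\<dots> = F\<^sup>2 * (dev n \<omega> * dev n \<omega>)" by (simp add: power2_eq_square)
      also have "\<dots> \<le> F\<^sup>2 * (2 * dev n \<omega>)"
        using dev_le_2[OF w] dev_nonneg[of n \<omega>] by (intro mult_left_mono mult_right_mono) auto
      finally show ?thesis .
    qed
    then have "\<bar>\<kappa> c * (\<Sum>l\<in>L. freq n \<omega> l * \<phi> c l)\<^sup>2\<bar> \<le> \<bar>\<kappa> c\<bar> * (F\<^sup>2 * (2 * dev n \<omega>))" if "c \<in> J" for c
      using that by (auto simp: abs_mult intro!: mult_left_mono)
    then have "\<bar>\<Sum>c\<in>J. \<kappa> c * (\<Sum>l\<in>L. freq n \<omega> l * \<phi> c l)\<^sup>2\<bar> \<le> (\<Sum>c\<in>J. \<bar>\<kappa> c\<bar> * (F\<^sup>2 * (2 * dev n \<omega>)))"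
      by (intro sum_abs[THEN order_trans] sum_mono)
    then show "\<bar>quad (freq n \<omega>)\<bar> \<le> (\<Sum>c\<in>J. \<bar>\<kappa> c\<bar>) * F\<^sup>2 * dev n \<omega>"
      unfolding sum_distrib_right[symmetric] by (simp add: quad_def mult_ac)
  qed
qed

text \<open>The logarithm of each factor is expanded to second order. There are at most n^2 factors,
  each with argument of order 1/n, so the cubic remainders sum to O(1/n). The linear terms give n
  \<open>quad\<close> minus half a trace, the squares a quarter of a Hilbert-Schmidt norm; both are
  taken under the empirical law and moved to \<open>w\<close> at a cost of order
  \<open>dev\<close>.\<close>

lemma lr_bound_aux:
  assumes B: "B > 0" "\<And>l l'. l \<in> L \<Longrightarrow> l' \<in> L \<Longrightarrow> \<bar>K l l'\<bar> \<le> B"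
    and C: "C \<ge> 0" "\<bar>quad (freq n \<omega>)\<bar> \<le> C * dev n \<omega>"
    and w: "\<omega> \<in> assignments L n" and n: "real n \<ge> 2 * d" "real n \<ge> 4 * B" "n > 0"
  shows "lr n \<omega> > 0 \<and> \<bar>ln (lr n \<omega>) - (n * quad (freq n \<omega>) - c0)\<bar>
    \<le> (2 * d * C + B + B\<^sup>2) * dev n \<omega> + (2 * d * B + 2 * d * B\<^sup>2 + B\<^sup>2 + 16 * B ^ 3) * (1 / n)"
proof -
  define m where "m = real n - d"
  have m: "m > 0" "m \<ge> n / 2" using n d_pos by (auto simp: m_def)
  \<comment> \<open>The relative error of replacing n - d by n. It is of order 1/n, so it matters
    for the term of size n only through the bounded product \<open>n * \<delta>\<close>.\<close>
  define \<delta> where "\<delta> = d / m"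
  have nm: "n / m = 1 + \<delta>" using m by (simp add: \<delta>_def m_def field_simps)
  have "2 * m \<ge> n" using m by simp
  then have \<delta>: "\<delta> > 0" "\<delta> \<le> 1" "n * \<delta> \<le> 2 * d" "\<delta> \<le> 2 * d * (1 / n)"
    using m n d_pos by (auto simp: \<delta>_def m_def field_simps)
  define f where "f = freq n \<omega>"
  have f0: "f l \<ge> 0" for l by (simp add: f_def freq_nonneg)
  have f1: "(\<Sum>l\<in>L. f l) = 1" unfolding f_def by (rule sum_freq[OF finL w n(3)])
  have KK: "\<bar>K (\<omega> u) (\<omega> v)\<bar> \<le> B" if "(u, v) \<in> vertex_pairs n" for u v
    using that by (intro B(2) assignmentsD[OF w]) (auto simp: vertex_pairs_def)
  define x where "x u v = K (\<omega> u) (\<omega> v) / m" for u v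
  have xb: "\<bar>x u v\<bar> \<le> B / m" if "(u, v) \<in> vertex_pairs n" for u v
    using KK[OF that] m by (simp add: x_def divide_right_mono)
  have Bm: "B / m \<le> 2 * B / n" using m n B by (simp add: frac_le field_simps)
  \<comment> \<open>This is where \<open>n \<ge> 4 * B\<close> enters: all arguments stay in the
    range of the cubic logarithm estimate.\<close>
  have Bm2: "2 * B / n \<le> 1 / 2" using n by (simp add: field_simps)
  have xb2: "\<bar>x u v\<bar> \<le> 1 / 2" if "(u, v) \<in> vertex_pairs n" for u v
    using xb[OF that] Bm Bm2 by linarith
  have lr_eq: "lr n \<omega> = (\<Prod>p\<in>vertex_pairs n. 1 + x (fst p) (snd p))"
    unfolding lr_def x_def m_def by (simp add: case_prod_beta)
  have pos: "1 + x (fst p) (snd p) > 0" if "p \<in> vertex_pairs n" for p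
    using xb2[of "fst p" "snd p"] that by (simp add: abs_le_iff)
  have lr_pos: "lr n \<omega> > 0" unfolding lr_eq by (intro prod_pos) (use pos in auto)
  define E where "E = (\<Sum>(u,v)\<in>vertex_pairs n. ln (1 + x u v) - (x u v - (x u v)\<^sup>2 / 2))"
  have "ln (lr n \<omega>) = (\<Sum>(u,v)\<in>vertex_pairs n. ln (1 + x u v))"
    unfolding lr_eq by (subst ln_prod) (use pos in \<open>force simp: case_prod_beta\<close>)+
  then have ln1: "ln (lr n \<omega>) = E + (\<Sum>(u,v)\<in>vertex_pairs n. x u v) - (\<Sum>(u,v)\<in>vertex_pairs n. (x u v)\<^sup>2) / 2"
    unfolding E_def by (simp add: case_prod_beta sum_subtractf sum_divide_distrib)
  have E_le: "\<bar>E\<bar> \<le> 16 * B ^ 3 * (1 / n)"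
  proof -
    have "\<bar>E\<bar> \<le> (\<Sum>p\<in>vertex_pairs n. 2 * (2 * B / n) ^ 3)"
      unfolding E_def
    proof (rule sum_abs[THEN order_trans], intro sum_mono, clarify)
      fix u v assume uv: "(u, v) \<in> vertex_pairs n"
      have "\<bar>ln (1 + x u v) - (x u v - (x u v)\<^sup>2 / 2)\<bar> \<le> 2 * \<bar>x u v\<bar> ^ 3"
        by (rule abs_ln_one_plus_cubic[OF xb2[OF uv]])
      also have "\<dots> \<le> 2 * (2 * B / n) ^ 3"
        using xb[OF uv] Bm by (intro mult_left_mono power_mono) auto
      finally show "\<bar>ln (1 + x u v) - (x u v - (x u v)\<^sup>2 / 2)\<bar> \<le> 2 * (2 * B / n) ^ 3" .
    qed
    also have "\<dots> = real (card (vertex_pairs n)) * (2 * (2 * B / n) ^ 3)" by simp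
    also have "\<dots> \<le> real (n\<^sup>2) * (2 * (2 * B / n) ^ 3)"
      using B by (intro mult_right_mono of_nat_mono card_vertex_pairs_le) auto
    also have "\<dots> = 16 * B ^ 3 * (1 / n)" using n by (simp add: field_simps power2_eq_square power3_eq_cube)
    finally show ?thesis .
  qed
  define D1 where "D1 = (\<Sum>l\<in>L. f l * K l l)"
  define D2 where "D2 = (\<Sum>l\<in>L. \<Sum>l'\<in>L. f l * f l' * (K l l')\<^sup>2)"
  define D3 where "D3 = (\<Sum>l\<in>L. f l * (K l l)\<^sup>2)"
  have S1: "(\<Sum>(u,v)\<in>vertex_pairs n. x u v) = (n\<^sup>2 * (2 * quad f) - n * D1) / 2 / m"
    unfolding x_def case_prod_beta sum_divide_distrib[symmetric]
    using pair_sum_eq[OF w, of K, OF K_sym] m(1) by (simp add: D1_def f_def quad_eq case_prod_beta field_simps)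
  have S2: "(\<Sum>(u,v)\<in>vertex_pairs n. (x u v)\<^sup>2) = (n\<^sup>2 * D2 - n * D3) / 2 / m\<^sup>2"
    unfolding x_def case_prod_beta power_divide sum_divide_distrib[symmetric]
    using pair_sum_eq[OF w, of "\<lambda>l l'. (K l l')\<^sup>2"] K_sym m(1)
    by (simp add: D2_def D3_def f_def case_prod_beta field_simps)
  define E1 where "E1 = (\<Sum>l\<in>L. w l * K l l)"
  define E2 where "E2 = (\<Sum>l\<in>L. \<Sum>l'\<in>L. w l * w l' * (K l l')\<^sup>2)"
  have c0: "c0 = E1 / 2 + E2 / 4" by (simp add: c0_def E1_def E2_def sum_w_K_diag sum_w_K_sq)
  have ln2: "ln (lr n \<omega>) = E + (n * (n / m) * quad f - (n / m) * D1 / 2) - ((n / m)\<^sup>2 * D2 - n * D3 / m\<^sup>2) / 4"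
    unfolding ln1 S1 S2 using m by (simp add: field_simps power2_eq_square)
  \<comment> \<open>Five errors: the cubic remainder, the factor n / (n - d) in the leading term,
    the trace, the Hilbert-Schmidt norm, and the diagonal missing from the sum of squares.\<close>
  have eq: "ln (lr n \<omega>) - (n * quad f - c0) = E + (n * \<delta>) * quad f - ((1 + \<delta>) * D1 - E1) / 2
      - ((1 + \<delta>)\<^sup>2 * D2 - E2) / 4 + n * D3 / m\<^sup>2 / 4"
  proof -
    have "n * (n / m) * quad f = n * quad f + (n * \<delta>) * quad f" unfolding nm by (simp add: algebra_simps)
    then show ?thesis using ln2 unfolding c0 nm[symmetric] by (simp add: diff_divide_distrib)
  qed
  have dev_eq: "dev n \<omega> = (\<Sum>l\<in>L. \<bar>f l - w l\<bar>)" by (simp add: dev_def f_def)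
  have D1_le: "\<bar>D1\<bar> \<le> B"
  proof -
    have "\<bar>D1\<bar> \<le> (\<Sum>l\<in>L. f l * B)" unfolding D1_def
      by (rule sum_abs[THEN order_trans], intro sum_mono) (auto simp: abs_mult f0 intro!: mult_left_mono B)
    then show ?thesis by (simp add: f1 flip: sum_distrib_right)
  qed
  have D1_E1: "\<bar>D1 - E1\<bar> \<le> B * dev n \<omega>"
  proof -
    have "D1 - E1 = (\<Sum>l\<in>L. (f l - w l) * K l l)" by (simp add: D1_def E1_def left_diff_distrib sum_subtractf)
    also have "\<bar>\<dots>\<bar> \<le> (\<Sum>l\<in>L. \<bar>f l - w l\<bar> * B)"
      by (rule sum_abs[THEN order_trans], intro sum_mono) (auto simp: abs_mult intro!: mult_left_mono B)
    finally show ?thesis by (simp add: dev_eq sum_distrib_left mult.commute)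
  qed
  have K2: "(K l l')\<^sup>2 \<le> B\<^sup>2" if "l \<in> L" "l' \<in> L" for l l'
    using B(2)[OF that] B(1) by (intro abs_le_square_iff[THEN iffD1]) auto
  have D2_le: "\<bar>D2\<bar> \<le> B\<^sup>2"
  proof -
    have "D2 \<le> (\<Sum>l\<in>L. \<Sum>l'\<in>L. f l * f l' * B\<^sup>2)" unfolding D2_def
      by (intro sum_mono mult_left_mono K2) (auto simp: f0)
    also have "\<dots> = (\<Sum>l\<in>L. f l) * (\<Sum>l'\<in>L. f l') * B\<^sup>2"
      by (simp only: sum_product, simp only: sum_distrib_right)
    finally have "D2 \<le> B\<^sup>2" by (simp add: f1)
    moreover have "D2 \<ge> 0" unfolding D2_def by (intro sum_nonneg mult_nonneg_nonneg f0) auto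
    ultimately show ?thesis by simp
  qed
  have D3_le: "\<bar>D3\<bar> \<le> B\<^sup>2"
  proof -
    have "D3 \<le> (\<Sum>l\<in>L. f l * B\<^sup>2)" unfolding D3_def
      by (intro sum_mono mult_left_mono K2) (auto simp: f0)
    then have "D3 \<le> B\<^sup>2" by (simp add: f1 flip: sum_distrib_right)
    moreover have "D3 \<ge> 0" unfolding D3_def by (intro sum_nonneg mult_nonneg_nonneg f0) auto
    ultimately show ?thesis by simp
  qed
  have D2_E2: "\<bar>D2 - E2\<bar> \<le> 2 * B\<^sup>2 * dev n \<omega>"
  proof -
    have "D2 - E2 = (\<Sum>l\<in>L. \<Sum>l'\<in>L. (f l * f l' - w l * w l') * (K l l')\<^sup>2)"
      by (simp add: D2_def E2_def left_diff_distrib sum_subtractf)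
    also have "\<bar>\<dots>\<bar> \<le> (\<Sum>l\<in>L. \<Sum>l'\<in>L. (\<bar>f l - w l\<bar> * f l' + w l * \<bar>f l' - w l'\<bar>) * B\<^sup>2)"
    proof (rule sum_abs[THEN order_trans], rule sum_mono, rule sum_abs[THEN order_trans], rule sum_mono)
      fix l l' assume l: "l \<in> L" "l' \<in> L"
      have "f l * f l' - w l * w l' = (f l - w l) * f l' + w l * (f l' - w l')" by (simp add: algebra_simps)
      also have "\<bar>\<dots>\<bar> \<le> \<bar>f l - w l\<bar> * f l' + w l * \<bar>f l' - w l'\<bar>"
        using f0[of l'] w_nonneg[OF l(1)] by (intro order_trans[OF abs_triangle_ineq]) (simp add: abs_mult)
      finally have "\<bar>f l * f l' - w l * w l'\<bar> \<le> \<bar>f l - w l\<bar> * f l' + w l * \<bar>f l' - w l'\<bar>" .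
      then show "\<bar>(f l * f l' - w l * w l') * (K l l')\<^sup>2\<bar> \<le> (\<bar>f l - w l\<bar> * f l' + w l * \<bar>f l' - w l'\<bar>) * B\<^sup>2"
        unfolding abs_mult using K2[OF l] by (intro mult_mono) auto
    qed
    also have "\<dots> = ((\<Sum>l\<in>L. \<bar>f l - w l\<bar>) * (\<Sum>l\<in>L. f l) + (\<Sum>l\<in>L. w l) * (\<Sum>l\<in>L. \<bar>f l - w l\<bar>)) * B\<^sup>2"
      by (simp only: sum_product, simp only: sum_distrib_right sum.distrib distrib_right)
    finally show ?thesis by (simp add: f1 w_sum dev_eq mult.commute)
  qed
  have t1: "\<bar>(n * \<delta>) * quad f\<bar> \<le> 2 * d * C * dev n \<omega>"
  proof -
    have "\<bar>(n * \<delta>) * quad f\<bar> = (n * \<delta>) * \<bar>quad f\<bar>" using \<delta> by (simp add: abs_mult)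
    also have "\<dots> \<le> (2 * d) * (C * dev n \<omega>)"
      using mult_mono[OF \<delta>(3) C(2)] d_pos by (simp add: f_def)
    finally show ?thesis by (simp add: mult_ac)
  qed
  have t2: "\<bar>(1 + \<delta>) * D1 - E1\<bar> \<le> B * dev n \<omega> + 2 * d * B * (1 / n)"
  proof -
    have "\<bar>\<delta> * D1\<bar> \<le> 2 * d * (1 / n) * B" unfolding abs_mult
      using \<delta> D1_le d_pos by (intro mult_mono) auto
    moreover have "(1 + \<delta>) * D1 - E1 = (D1 - E1) + \<delta> * D1" by (simp add: algebra_simps)
    ultimately show ?thesis using D1_E1 by (simp add: mult_ac abs_le_iff)
  qed
  have t3: "\<bar>(1 + \<delta>)\<^sup>2 * D2 - E2\<bar> \<le> 2 * B\<^sup>2 * dev n \<omega> + 6 * d * B\<^sup>2 * (1 / n)"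
  proof -
    have "\<delta> * \<delta> \<le> \<delta>" using \<delta> by (simp add: mult_left_le)
    moreover define e where "e = d * (1 / n)"
    moreover have "\<delta> \<le> 2 * e" using \<delta>(4) by (simp add: e_def)
    ultimately have "2 * \<delta> + \<delta>\<^sup>2 \<le> 6 * e" by (simp add: power2_eq_square)
    then have "2 * \<delta> + \<delta>\<^sup>2 \<le> 6 * d * (1 / n)" by (simp add: e_def)
    then have "\<bar>(2 * \<delta> + \<delta>\<^sup>2) * D2\<bar> \<le> (6 * d * (1 / n)) * B\<^sup>2" unfolding abs_mult
      using \<delta>(1) D2_le d_pos by (intro mult_mono) auto
    moreover have "(1 + \<delta>)\<^sup>2 * D2 - E2 = (D2 - E2) + (2 * \<delta> + \<delta>\<^sup>2) * D2"
      by (simp add: algebra_simps power2_eq_square)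
    ultimately show ?thesis using D2_E2 by (simp add: mult_ac abs_le_iff)
  qed
  have t4: "\<bar>n * D3 / m\<^sup>2\<bar> \<le> 4 * B\<^sup>2 * (1 / n)"
  proof -
    have m2: "(n / 2)\<^sup>2 \<le> m\<^sup>2" using m by (intro power_mono) auto
    have "\<bar>n * D3 / m\<^sup>2\<bar> = n * \<bar>D3\<bar> / m\<^sup>2" by (simp add: abs_mult)
    also have "\<dots> \<le> n * B\<^sup>2 / (n / 2)\<^sup>2" using D3_le m2 n m by (intro frac_le mult_left_mono) auto
    also have "\<dots> = 4 * B\<^sup>2 * (1 / n)" using n by (simp add: field_simps power2_eq_square)
    finally show ?thesis .
  qed
  have "\<bar>ln (lr n \<omega>) - (n * quad f - c0)\<bar> \<le> 16 * B ^ 3 * (1 / n) + 2 * d * C * dev n \<omega>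
     + (B * dev n \<omega> + 2 * d * B * (1 / n)) / 2 + (2 * B\<^sup>2 * dev n \<omega> + 6 * d * B\<^sup>2 * (1 / n)) / 4
     + (4 * B\<^sup>2 * (1 / n)) / 4"
  proof -
    have "\<bar>e + x1 - x2 / 2 - x3 / 4 + x4 / 4\<bar> \<le> y0 + y1 + y2 / 2 + y3 / 4 + y4 / 4"
      if "\<bar>e\<bar> \<le> y0" "\<bar>x1\<bar> \<le> y1" "\<bar>x2\<bar> \<le> y2" "\<bar>x3\<bar> \<le> y3" "\<bar>x4\<bar> \<le> y4"
      for e x1 x2 x3 x4 y0 y1 y2 y3 y4 :: real using that by linarith
    from this[OF E_le t1 t2 t3 t4] show ?thesis unfolding eq .
  qed
  also have "\<dots> \<le> (2 * d * C + B + B\<^sup>2) * dev n \<omega>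
      + (2 * d * B + 2 * d * B\<^sup>2 + B\<^sup>2 + 16 * B ^ 3) * (1 / n)"
  proof -
    define p q r t where "p = B * dev n \<omega>" and "q = B\<^sup>2 * dev n \<omega>" and "r = d * B * (1 / n)"
      and "t = d * B\<^sup>2 * (1 / n)"
    have nonneg: "p \<ge> 0" "q \<ge> 0" "r \<ge> 0" "t \<ge> 0"
      using B d_pos dev_nonneg[of n \<omega>] by (simp_all add: p_def q_def r_def t_def)
    have eqs: "2 * d * B * (1 / n) = 2 * r" "6 * d * B\<^sup>2 * (1 / n) = 6 * t" "2 * B\<^sup>2 * dev n \<omega> = 2 * q"
      "4 * B\<^sup>2 * (1 / n) = 4 * (B\<^sup>2 * (1 / n))" "B * dev n \<omega> = p"
      "(2 * d * C + B + B\<^sup>2) * dev n \<omega> = 2 * d * C * dev n \<omega> + p + q"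
      "(2 * d * B + 2 * d * B\<^sup>2 + B\<^sup>2 + 16 * B ^ 3) * (1 / n)
        = 2 * r + 2 * t + B\<^sup>2 * (1 / n) + 16 * B ^ 3 * (1 / n)"
      by (simp_all add: p_def q_def r_def t_def algebra_simps add_divide_distrib)
    have "x + y + (p + 2 * r) / 2 + (2 * q + 6 * t) / 4 + 4 * z / 4 \<le> y + p + q + (2 * r + 2 * t + z + x)"
      for x y z :: real using nonneg by argo
    then show ?thesis unfolding eqs .
  qed
  finally show ?thesis using lr_pos by (simp add: f_def)
qed

lemma lr_bound:
  obtains C where "C > 0" "\<forall>\<^sub>F n in sequentially. n > 0 \<and> (\<forall>\<omega>\<in>assignments L n. lr n \<omega> > 0 \<and>
    \<bar>ln (lr n \<omega>) - (n * quad (freq n \<omega>) - c0)\<bar> \<le> C * (dev n \<omega> + 1 / n))"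
proof -
  obtain B where B: "B > 0" "\<And>l l'. l \<in> L \<Longrightarrow> l' \<in> L \<Longrightarrow> \<bar>K l l'\<bar> \<le> B" using K_bounded by blast
  obtain C where C: "C \<ge> 0" "\<And>n \<omega>. \<omega> \<in> assignments L n \<Longrightarrow> n > 0 \<Longrightarrow> \<bar>quad (freq n \<omega>)\<bar> \<le> C * dev n \<omega>"
    using abs_quad_freq_le by blast
  define C1 where "C1 = 2 * d * C + B + B\<^sup>2"
  define C2 where "C2 = 2 * d * B + 2 * d * B\<^sup>2 + B\<^sup>2 + 16 * B ^ 3"
  have "d * C \<ge> 0" "d * B > 0" "d * B\<^sup>2 > 0" "B\<^sup>2 > 0" "B ^ 3 > 0" using B C d_pos by simp_all
  then have C12: "C1 > 0" "C2 > 0" using B(1) unfolding C1_def C2_def mult.assoc by linarith+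
  show thesis
  proof
    show "C1 + C2 > 0" using C12 by simp
    have "\<forall>\<^sub>F n in sequentially. real n \<ge> 2 * d" "\<forall>\<^sub>F n in sequentially. real n \<ge> 4 * B"
      using filterlim_real_sequentially by (auto simp: filterlim_at_top)
    then show "\<forall>\<^sub>F n in sequentially. n > 0 \<and> (\<forall>\<omega>\<in>assignments L n. lr n \<omega> > 0 \<and>
      \<bar>ln (lr n \<omega>) - (n * quad (freq n \<omega>) - c0)\<bar> \<le> (C1 + C2) * (dev n \<omega> + 1 / n))"
      using eventually_gt_at_top[of 0]
    proof eventually_elim
      case (elim n)
      have "lr n \<omega> > 0 \<and> \<bar>ln (lr n \<omega>) - (n * quad (freq n \<omega>) - c0)\<bar> \<le> (C1 + C2) * (dev n \<omega> + 1 / n)"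
        if w: "\<omega> \<in> assignments L n" for \<omega>
      proof -
        have "C1 * dev n \<omega> + C2 * (1 / n) \<le> (C1 + C2) * dev n \<omega> + (C1 + C2) * (1 / n)"
          using C12 dev_nonneg[of n \<omega>] by (intro add_mono mult_right_mono) auto
        then show ?thesis
          using lr_bound_aux[OF B C(1) C(2)[OF w elim(3)] w elim] unfolding C1_def[symmetric] C2_def[symmetric]
          by (simp add: distrib_left)
      qed
      then show ?case using elim by blast
    qed
  qed
qed

end

section \<open>The Gaussian regime\<close>

text \<open>Scaled by sqrt n, each coordinate deviation y obeys |y| <= exp y + exp (-y), whose mean
  is bounded; the expectation thus decays like 1/sqrt n. It is stated for general \<open>v\<close>
  because the tilted laws may have zeros.\<close>

lemma expected_deviation_tendsto_0:
  assumes L: "finite L" and v: "\<And>l. l \<in> L \<Longrightarrow> v l \<ge> 0" "(\<Sum>l\<in>L. v l) = 1"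
  shows "(\<lambda>n. \<Sum>\<omega>\<in>assignments L n. weight v n \<omega> * (\<Sum>l\<in>L. \<bar>freq n \<omega> l - v l\<bar>)) \<longlonglongrightarrow> 0"
proof -
  have "\<exists>C. \<forall>n>0. (\<Sum>\<omega>\<in>assignments L n. weight v n \<omega> * \<bar>freq n \<omega> l - v l\<bar>) \<le> C / sqrt n" if l: "l \<in> L" for l
  proof -
    define g where "g l' = (if l' = l then 1 else 0) - v l" for l'
    have gsum: "(\<Sum>l'\<in>L. f l' * g l') = f l - (\<Sum>l'\<in>L. f l') * v l" for f
    proof -
      have "(\<Sum>l'\<in>L. f l' * g l') = (\<Sum>l'\<in>L. (if l' = l then f l' else 0) - f l' * v l)"
        by (intro sum.cong) (auto simp: g_def algebra_simps)
      then show ?thesis using L l by (simp add: sum_subtractf sum_distrib_right)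
    qed
    have g: "(\<Sum>l\<in>L. v l * g l) = 0" using v(2) by (simp add: gsum)
    obtain C1 where C1: "\<And>n. (\<Sum>\<omega>\<in>assignments L n. weight v n \<omega> * exp ((\<Sum>u<n. g (\<omega> u)) / sqrt n)) \<le> C1"
      using exp_moment_bounded[OF L v g] by blast
    have g': "(\<Sum>l\<in>L. v l * (- g l)) = 0" using g by (simp add: sum_negf)
    obtain C2 where C2: "\<And>n. (\<Sum>\<omega>\<in>assignments L n. weight v n \<omega> * exp ((\<Sum>u<n. - g (\<omega> u)) / sqrt n)) \<le> C2"
      using exp_moment_bounded[OF L v g'] by blast
    have "(\<Sum>\<omega>\<in>assignments L n. weight v n \<omega> * \<bar>freq n \<omega> l - v l\<bar>) \<le> (C1 + C2) / sqrt n" if n: "n > 0" for n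
    proof -
      have "(\<Sum>\<omega>\<in>assignments L n. weight v n \<omega> * \<bar>freq n \<omega> l - v l\<bar>) \<le>
        (\<Sum>\<omega>\<in>assignments L n. weight v n \<omega> * ((exp ((\<Sum>u<n. g (\<omega> u)) / sqrt n)
           + exp ((\<Sum>u<n. - g (\<omega> u)) / sqrt n)) / sqrt n))"
      proof (intro sum_mono mult_left_mono weight_nonneg[OF v(1)])
        fix \<omega> assume w: "\<omega> \<in> assignments L n"
        define y where "y = (\<Sum>u<n. g (\<omega> u)) / sqrt n"
        have "(\<Sum>u<n. g (\<omega> u)) = n * (freq n \<omega> l - v l)"
        proof -
          have "(\<Sum>u<n. g (\<omega> u)) = n * (\<Sum>l'\<in>L. freq n \<omega> l' * g l')"
            by (rule sum_assignment_eq_freq[OF L w])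
          also have "(\<Sum>l'\<in>L. freq n \<omega> l' * g l') = freq n \<omega> l - v l"
            using sum_freq[OF L w n] by (simp add: gsum)
          finally show ?thesis .
        qed
        then have "y = sqrt n * (freq n \<omega> l - v l)"
          using n real_sqrt_mult_self[of n] unfolding y_def by (simp add: field_simps)
        then have y: "\<bar>freq n \<omega> l - v l\<bar> = \<bar>y\<bar> / sqrt n" using n by (simp add: abs_mult)
        have "\<bar>y\<bar> \<le> exp \<bar>y\<bar>" using exp_ge_add_one_self[of "\<bar>y\<bar>"] by linarith
        also have "\<dots> \<le> exp y + exp (- y)" by (auto simp: abs_if)
        finally have "\<bar>y\<bar> / sqrt n \<le> (exp y + exp (- y)) / sqrt n" using n by (simp add: divide_right_mono)
        then show "\<bar>freq n \<omega> l - v l\<bar> \<le> (exp ((\<Sum>u<n. g (\<omega> u)) / sqrt n)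
           + exp ((\<Sum>u<n. - g (\<omega> u)) / sqrt n)) / sqrt n"
          unfolding y by (simp add: y_def sum_negf)
      qed auto
      also have "\<dots> \<le> (C1 + C2) / sqrt n"
        unfolding times_divide_eq_right sum_divide_distrib[symmetric] distrib_left sum.distrib
        using n by (intro divide_right_mono add_mono C1 C2) auto
      finally show ?thesis .
    qed
    then show ?thesis by blast
  qed
  then obtain C where C: "\<And>l n. l \<in> L \<Longrightarrow> n > 0 \<Longrightarrow>
      (\<Sum>\<omega>\<in>assignments L n. weight v n \<omega> * \<bar>freq n \<omega> l - v l\<bar>) \<le> C l / sqrt n"
    by metis
  have le: "(\<Sum>\<omega>\<in>assignments L n. weight v n \<omega> * (\<Sum>l\<in>L. \<bar>freq n \<omega> l - v l\<bar>)) \<le> (\<Sum>l\<in>L. C l) * (1 / sqrt n)"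
    if "n > 0" for n
  proof -
    have "(\<Sum>\<omega>\<in>assignments L n. weight v n \<omega> * (\<Sum>l\<in>L. \<bar>freq n \<omega> l - v l\<bar>)) =
      (\<Sum>l\<in>L. \<Sum>\<omega>\<in>assignments L n. weight v n \<omega> * \<bar>freq n \<omega> l - v l\<bar>)"
      unfolding sum_distrib_left by (rule sum.swap)
    also have "\<dots> \<le> (\<Sum>l\<in>L. C l / sqrt n)" using that by (intro sum_mono C)
    finally show ?thesis by (simp add: sum_divide_distrib)
  qed
  have "(\<lambda>n. (\<Sum>l\<in>L. C l) * (1 / sqrt (real n))) \<longlonglongrightarrow> (\<Sum>l\<in>L. C l) * 0"
    by (intro tendsto_mult tendsto_const)
       (simp add: divide_inverse, rule tendsto_inverse_0_at_top,
        rule filterlim_compose[OF sqrt_at_top filterlim_real_sequentially])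
  then have lim: "(\<lambda>n. (\<Sum>l\<in>L. C l) * (1 / sqrt (real n))) \<longlonglongrightarrow> 0" by simp
  show ?thesis
    by (rule tendsto_sandwich[OF _ eventually_mono[OF eventually_gt_at_top[of 0] le] tendsto_const lim])
       (intro always_eventually allI sum_nonneg mult_nonneg_nonneg weight_nonneg[OF v(1)], auto)
qed

section \<open>Gaussian integrals and linearisation of the exponent\<close>

text \<open>Completing the square turns the integrand into a multiple of the normal density with
  mean t.\<close>

lemma std_normal_mgf:
  fixes t :: real
  shows "has_bochner_integral std_normal_distribution (\<lambda>g. exp (t * g)) (exp (t\<^sup>2 / 2))"
proof -
  have eq: "std_normal_density g * exp (t * g) = exp (t\<^sup>2 / 2) * normal_density t 1 g" for g
    by (simp add: normal_density_def mult_exp_exp) (simp add: field_simps power2_eq_square)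
  have "has_bochner_integral lborel (\<lambda>g. exp (t\<^sup>2 / 2) * normal_density t 1 g) (exp (t\<^sup>2 / 2) * 1)"
    by (intro has_bochner_integral_mult_right) (simp add: has_bochner_integral_iff)
  then show ?thesis
    by (intro has_bochner_integral_density) (auto simp: eq)
qed

text \<open>The integrand is \<sigma> times the centred normal density of variance 1 / (1 - r). This
  produces the factor (1 - x)^(-1/2) of \<open>psi\<close>, for negative arguments as well.\<close>

lemma std_normal_exp_square:
  fixes r :: real
  assumes "r < 1"
  shows "has_bochner_integral std_normal_distribution (\<lambda>g. exp (r * g\<^sup>2 / 2)) ((1 - r) powr (- 1 / 2))"
proof -
  define \<sigma> where "\<sigma> = 1 / sqrt (1 - r)"
  have s: "\<sigma> > 0" "\<sigma>\<^sup>2 = 1 / (1 - r)" using assms by (auto simp: \<sigma>_def power_divide)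
  have s': "\<sigma> = (1 - r) powr (- 1 / 2)"
    using powr_minus_divide[of "1 - r" "1 / 2"] powr_half_sqrt[of "1 - r"] assms by (simp add: \<sigma>_def)
  have eq: "std_normal_density g * exp (r * g\<^sup>2 / 2) = \<sigma> * normal_density 0 \<sigma> g" for g
  proof -
    have "sqrt (2 * pi * \<sigma>\<^sup>2) = sqrt (2 * pi) * \<sigma>" using s(1) by (simp add: real_sqrt_mult)
    moreover have "g\<^sup>2 / (2 * \<sigma>\<^sup>2) = g\<^sup>2 / 2 - r * g\<^sup>2 / 2" using assms by (simp add: s(2) field_simps)
    moreover have "exp (- g\<^sup>2 / 2) * exp (r * g\<^sup>2 / 2) = exp (- (g\<^sup>2 / 2 - r * g\<^sup>2 / 2))"
      by (simp add: mult_exp_exp)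
    ultimately show ?thesis using s(1) by (simp add: normal_density_def)
  qed
  have "has_bochner_integral lborel (\<lambda>g. \<sigma> * normal_density 0 \<sigma> g) (\<sigma> * 1)"
    using s(1) by (intro has_bochner_integral_mult_right) (simp add: has_bochner_integral_iff)
  then show ?thesis
    unfolding s'[symmetric] by (intro has_bochner_integral_density) (auto simp: eq)
qed

text \<open>The Hubbard--Stratonovich linearisation; \<open>csqrt\<close> makes it work for both signs of \<open>k\<close>.\<close>

lemma std_normal_linearise:
  fixes k y :: real
  shows "has_bochner_integral std_normal_distribution (\<lambda>g. exp (csqrt (of_real k) * of_real (g * y)))
    (of_real (exp (k * y\<^sup>2 / 2)))"
proof (cases "k \<ge> 0")
  case True
  have "has_bochner_integral std_normal_distribution (\<lambda>g. of_real (exp (sqrt k * y * g)) :: complex)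
    (of_real (exp ((sqrt k * y)\<^sup>2 / 2)))"
    by (intro has_bochner_integral_of_real std_normal_mgf)
  then show ?thesis using True by (simp add: power_mult_distrib mult_ac flip: exp_of_real)
next
  case False
  interpret real_distribution std_normal_distribution by (rule real_dist_normal_dist)
  have z: "csqrt (of_real k) = \<i> * of_real (sqrt (- k))"
    using False by (subst csqrt_of_real_nonpos) auto
  have "(CLINT g|std_normal_distribution. iexp (sqrt (- k) * y * g)) = exp (- ((sqrt (- k) * y)\<^sup>2) / 2)"
    using fun_cong[OF char_std_normal_distribution, of "sqrt (- k) * y"] by (simp add: char_def)
  moreover have "integrable std_normal_distribution (\<lambda>g. iexp (sqrt (- k) * y * g))"
    by (rule integrable_iexp) auto
  ultimately show ?thesis unfolding has_bochner_integral_iff z using False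
    by (simp add: power_mult_distrib mult_ac)
qed

context kernel_model
begin

text \<open>Parseval's identity in bilinear form: the coefficients are squared without conjugation,
  as the complex square roots of the eigenvalues require.\<close>

lemma sum_w_phi_sq:
  fixes a :: "'c \<Rightarrow> 'b::{real_normed_field}"
  shows "(\<Sum>l\<in>L. of_real (w l) * (\<Sum>c\<in>J. a c * of_real (\<phi> c l))\<^sup>2) = (\<Sum>c\<in>J. (a c)\<^sup>2)"
proof -
  have "(\<Sum>l\<in>L. of_real (w l) * (\<Sum>c\<in>J. a c * of_real (\<phi> c l))\<^sup>2) =
    (\<Sum>l\<in>L. \<Sum>c\<in>J. \<Sum>c'\<in>J. a c * a c' * of_real (w l * \<phi> c l * \<phi> c' l))"
    unfolding power2_eq_square sum_product unfolding sum_distrib_left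
    by (intro sum.cong) (simp_all add: mult_ac)
  also have "\<dots> = (\<Sum>c\<in>J. \<Sum>l\<in>L. \<Sum>c'\<in>J. a c * a c' * of_real (w l * \<phi> c l * \<phi> c' l))"
    by (rule sum.swap)
  also have "\<dots> = (\<Sum>c\<in>J. \<Sum>c'\<in>J. \<Sum>l\<in>L. a c * a c' * of_real (w l * \<phi> c l * \<phi> c' l))"
    by (intro sum.cong refl sum.swap)
  also have "\<dots> = (\<Sum>c\<in>J. \<Sum>c'\<in>J. a c * a c' * of_real (\<Sum>l\<in>L. w l * \<phi> c l * \<phi> c' l))"
    by (simp add: sum_distrib_left)
  also have "\<dots> = (\<Sum>c\<in>J. \<Sum>c'\<in>J. if c = c' then (a c)\<^sup>2 else 0)"
    by (intro sum.cong) (auto simp: ortho power2_eq_square)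
  finally show ?thesis using finJ by simp
qed

lemma sum_w_phi_mean:
  fixes a :: "'c \<Rightarrow> 'b::{real_normed_field}"
  shows "(\<Sum>l\<in>L. of_real (w l) * (\<Sum>c\<in>J. a c * of_real (\<phi> c l))) = 0"
proof -
  have "(\<Sum>l\<in>L. of_real (w l) * (\<Sum>c\<in>J. a c * of_real (\<phi> c l))) =
      (\<Sum>c\<in>J. \<Sum>l\<in>L. a c * of_real (w l * \<phi> c l))"
    unfolding sum_distrib_left by (subst sum.swap) (simp add: mult_ac)
  also have "\<dots> = (\<Sum>c\<in>J. a c * of_real (\<Sum>l\<in>L. w l * \<phi> c l))" by (simp add: sum_distrib_left)
  also have "\<dots> = 0" by (intro sum.neutral) (simp add: mean)
  finally show ?thesis .
qed

lemma clt_exponential: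
  fixes a :: "'c \<Rightarrow> complex"
  shows "(\<lambda>n. \<Sum>\<omega>\<in>assignments L n. of_real (weight w n \<omega>) *
      exp (\<Sum>u<n. (\<Sum>c\<in>J. a c * of_real (\<phi> c (\<omega> u))) / of_real (sqrt n)))
    \<longlonglongrightarrow> exp ((\<Sum>c\<in>J. (a c)\<^sup>2) / 2)"
proof -
  define h where "h l = (\<Sum>c\<in>J. a c * of_real (\<phi> c l))" for l
  define S where "S = (\<Sum>c\<in>J. (a c)\<^sup>2)"
  have h1: "(\<Sum>l\<in>L. of_real (w l) * h l) = 0" unfolding h_def by (rule sum_w_phi_mean)
  have h2: "(\<Sum>l\<in>L. of_real (w l) * (h l)\<^sup>2) = S" unfolding h_def S_def by (rule sum_w_phi_sq)
  have w1: "(\<Sum>l\<in>L. complex_of_real (w l)) = 1" using w_sum by (simp flip: of_real_sum)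
  \<comment> \<open>The linear Taylor term, of order sqrt n after multiplication by n, is subtracted
    for each letter; it cancels only in the mean over \<open>w\<close>.\<close>
  have lim1: "(\<lambda>n. of_nat n * (exp (z / of_real (sqrt (real n))) - 1 - z / of_real (sqrt (real n)))) \<longlonglongrightarrow> z\<^sup>2 / 2"
    for z :: complex
  proof -
    have bd: "norm (of_nat n * (exp (z / of_real (sqrt n)) - 1 - z / of_real (sqrt n)) - z\<^sup>2 / 2)
        \<le> exp (norm z) * norm z ^ 3 * (1 / sqrt n)" if n: "n > 0" for n :: nat
    proof -
      define y where "y = z / of_real (sqrt n)"
      have ny: "norm y = norm z / sqrt n" by (simp add: y_def norm_divide)
      have "norm z * 1 \<le> norm z * sqrt n" using n by (intro mult_left_mono) auto
      then have ny1: "norm y \<le> norm z" using n by (simp add: ny divide_le_eq)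
      have sq: "complex_of_real (sqrt n) * complex_of_real (sqrt n) = of_nat n"
        by (simp flip: of_real_mult)
      have y2: "of_nat n * (y\<^sup>2 / 2) = z\<^sup>2 / 2"
        using n sq by (simp add: y_def power_divide power2_eq_square)
      have "norm (exp y - (\<Sum>i\<le>2. y ^ i / fact i)) \<le> exp \<bar>Re y\<bar> * norm y ^ Suc 2 / fact 2"
        using Taylor_exp[of y 2] by simp
      also have "(\<Sum>i\<le>2. y ^ i / fact i) = 1 + y + y\<^sup>2 / 2" by (simp add: numeral_2_eq_2)
      also have "exp \<bar>Re y\<bar> * norm y ^ Suc 2 / fact 2 \<le> exp (norm z) * norm y ^ 3"
      proof -
        have "exp \<bar>Re y\<bar> \<le> exp (norm z)" using abs_Re_le_cmod[of y] ny1 by simp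
        then have "exp \<bar>Re y\<bar> * norm y ^ 3 \<le> exp (norm z) * norm y ^ 3" by (intro mult_right_mono) auto
        moreover have "exp \<bar>Re y\<bar> * norm y ^ 3 \<ge> 0" by simp
        moreover have "exp \<bar>Re y\<bar> * norm y ^ Suc 2 / fact 2 = exp \<bar>Re y\<bar> * norm y ^ 3 / 2"
          by (simp add: eval_nat_numeral)
        ultimately show ?thesis by linarith
      qed
      finally have e: "norm (exp y - (1 + y + y\<^sup>2 / 2)) \<le> exp (norm z) * norm y ^ 3" .
      have "of_nat n * (exp y - 1 - y) - z\<^sup>2 / 2 = of_nat n * (exp y - (1 + y + y\<^sup>2 / 2))"
        unfolding y2[symmetric] by (simp add: algebra_simps)
      then have "norm (of_nat n * (exp y - 1 - y) - z\<^sup>2 / 2) = n * norm (exp y - (1 + y + y\<^sup>2 / 2))"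
        by (simp add: norm_mult)
      also have "\<dots> \<le> n * (exp (norm z) * norm y ^ 3)" using e by (intro mult_left_mono) auto
      also have "\<dots> = exp (norm z) * norm z ^ 3 * (1 / sqrt n)"
      proof -
        have "sqrt n ^ 3 = n * sqrt n" by (simp add: power3_eq_cube)
        then show ?thesis using n by (simp add: ny power_divide)
      qed
      finally show ?thesis unfolding y_def .
    qed
    have "(\<lambda>n. exp (norm z) * norm z ^ 3 * (1 / sqrt (real n))) \<longlonglongrightarrow> exp (norm z) * norm z ^ 3 * 0"
      by (intro tendsto_mult tendsto_const)
         (simp add: divide_inverse, rule tendsto_inverse_0_at_top,
          rule filterlim_compose[OF sqrt_at_top filterlim_real_sequentially])
    then have lim: "(\<lambda>n. exp (norm z) * norm z ^ 3 * (1 / sqrt (real n))) \<longlonglongrightarrow> 0" by simp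
    have "(\<lambda>n. of_nat n * (exp (z / of_real (sqrt (real n))) - 1 - z / of_real (sqrt (real n))) - z\<^sup>2 / 2) \<longlonglongrightarrow> 0"
      by (rule Lim_null_comparison[OF eventually_mono[OF eventually_gt_at_top[of 0] bd] lim])
    then show ?thesis by (simp add: LIM_zero_iff)
  qed
  define x where "x n = (\<Sum>l\<in>L. of_real (w l) * exp (h l / of_real (sqrt (real n))))" for n :: nat
  have "(\<lambda>n. \<Sum>l\<in>L. of_real (w l) * (of_nat n * (exp (h l / of_real (sqrt (real n))) - 1 - h l / of_real (sqrt (real n)))))
      \<longlonglongrightarrow> (\<Sum>l\<in>L. of_real (w l) * ((h l)\<^sup>2 / 2))"
    by (intro tendsto_sum tendsto_mult tendsto_const lim1)
  also have "(\<Sum>l\<in>L. of_real (w l) * ((h l)\<^sup>2 / 2)) = S / 2"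
    using h2 by (simp flip: sum_divide_distrib)
  also have "(\<lambda>n. \<Sum>l\<in>L. of_real (w l) * (of_nat n * (exp (h l / of_real (sqrt (real n))) - 1 - h l / of_real (sqrt (real n)))))
     = (\<lambda>n. of_nat n * (x n - 1))"
  proof
    fix n :: nat
    have "(\<Sum>l\<in>L. of_real (w l) * (of_nat n * (exp (h l / of_real (sqrt (real n))) - 1 - h l / of_real (sqrt (real n)))))
      = (\<Sum>l\<in>L. of_nat n * (of_real (w l) * exp (h l / of_real (sqrt (real n)))) - of_nat n * of_real (w l)
          - of_nat n * (of_real (w l) * h l) / of_real (sqrt (real n)))"
      by (intro sum.cong) (simp_all add: algebra_simps)
    also have "\<dots> = of_nat n * x n - of_nat n * 1 - of_nat n * 0 / of_real (sqrt (real n))"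
      unfolding sum_subtractf sum_divide_distrib[symmetric] sum_distrib_left[symmetric] h1 w1 x_def ..
    finally show "(\<Sum>l\<in>L. of_real (w l) * (of_nat n * (exp (h l / of_real (sqrt (real n))) - 1 - h l / of_real (sqrt (real n)))))
      = of_nat n * (x n - 1)" by (simp add: algebra_simps)
  qed
  finally have "(\<lambda>n. x n ^ n) \<longlonglongrightarrow> exp (S / 2)" by (rule power_tendsto_exp)
  moreover have "x n ^ n = (\<Sum>\<omega>\<in>assignments L n. of_real (weight w n \<omega>) *
      exp (\<Sum>u<n. h (\<omega> u) / of_real (sqrt n)))" for n
    unfolding x_def by (rule sum_weight_exp[OF finL, symmetric])
  ultimately show ?thesis by (simp add: h_def S_def)
qed

definition gauss :: "('c \<Rightarrow> real) measure" where
  "gauss = (\<Pi>\<^sub>M c\<in>J. std_normal_distribution)"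

lemma gauss_prod:
  fixes f :: "'c \<Rightarrow> real \<Rightarrow> 'b::{real_normed_field,banach,second_countable_topology}"
  assumes "\<And>c. c \<in> J \<Longrightarrow> has_bochner_integral std_normal_distribution (f c) (I c)"
  shows "has_bochner_integral gauss (\<lambda>g. \<Prod>c\<in>J. f c (g c)) (\<Prod>c\<in>J. I c)"
proof -
  interpret N: real_distribution std_normal_distribution by (rule real_dist_normal_dist)
  interpret product_sigma_finite "\<lambda>_::'c. std_normal_distribution" by unfold_locales
  have int: "integrable std_normal_distribution (f c)" "integral\<^sup>L std_normal_distribution (f c) = I c"
    if "c \<in> J" for c using assms[OF that] by (auto simp: has_bochner_integral_iff)
  show ?thesis unfolding has_bochner_integral_iff gauss_def
    using product_integrable_prod[OF finJ int(1)] product_integral_prod[OF finJ int(1)] int(2) by auto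
qed

lemma measurable_gauss_component [measurable]:
  "c \<in> J \<Longrightarrow> (\<lambda>g. g c) \<in> borel_measurable gauss"
  unfolding gauss_def using measurable_component_singleton[of c J "\<lambda>_. std_normal_distribution"]
  by (simp add: measurable_def)

lemma gauss_exp_square:
  assumes "\<And>c. c \<in> J \<Longrightarrow> r c < 1"
  shows "has_bochner_integral gauss (\<lambda>g. exp ((\<Sum>c\<in>J. r c * (g c)\<^sup>2) / 2)) (\<Prod>c\<in>J. (1 - r c) powr (- 1 / 2))"
  using gauss_prod[where f = "\<lambda>c g. exp (r c * g\<^sup>2 / 2)", OF std_normal_exp_square[OF assms]]
  by (simp add: exp_sum finJ sum_divide_distrib)

text \<open>One independent normal variable for each eigenvalue linearises one square. The resulting
  exponent is a sum over vertices, so for fixed \<open>g\<close> the mean over the labels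
  factorises.\<close>

lemma exp_n_quad_linearise:
  assumes "\<omega> \<in> assignments L n" "n > 0"
  shows "has_bochner_integral gauss
    (\<lambda>g. exp (\<Sum>u<n. (\<Sum>c\<in>J. csqrt (of_real (\<kappa> c)) * of_real (g c) * of_real (\<phi> c (\<omega> u))) / of_real (sqrt n)))
    (of_real (exp (n * quad (freq n \<omega>))))"
proof -
  define y where "y c = (\<Sum>u<n. \<phi> c (\<omega> u)) / sqrt n" for c
  have y: "(y c)\<^sup>2 = n * (\<Sum>l\<in>L. freq n \<omega> l * \<phi> c l)\<^sup>2" for c
    using assms(2) unfolding y_def sum_assignment_eq_freq[OF finL assms(1)]
    by (simp add: power_divide power2_eq_square)
  have "has_bochner_integral gauss (\<lambda>g. \<Prod>c\<in>J. exp (csqrt (of_real (\<kappa> c)) * of_real (g c * y c)))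
    (\<Prod>c\<in>J. of_real (exp (\<kappa> c * (y c)\<^sup>2 / 2)))"
    by (rule gauss_prod[OF std_normal_linearise])
  moreover have "(\<Prod>c\<in>J. complex_of_real (exp (\<kappa> c * (y c)\<^sup>2 / 2))) = of_real (exp (n * quad (freq n \<omega>)))"
    by (simp add: y quad_def exp_sum finJ sum_distrib_left mult_ac sum_divide_distrib flip: of_real_prod)
  moreover have "(\<Prod>c\<in>J. exp (csqrt (of_real (\<kappa> c)) * of_real (g c * y c))) =
     exp (\<Sum>u<n. (\<Sum>c\<in>J. csqrt (of_real (\<kappa> c)) * of_real (g c) * of_real (\<phi> c (\<omega> u))) / of_real (sqrt n))" for g
  proof -
    have "(\<Sum>u<n. (\<Sum>c\<in>J. csqrt (of_real (\<kappa> c)) * of_real (g c) * of_real (\<phi> c (\<omega> u))) / of_real (sqrt n))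
      = (\<Sum>c\<in>J. csqrt (of_real (\<kappa> c)) * of_real (g c * y c))"
      by (simp add: y_def sum_distrib_left sum_divide_distrib mult_ac, subst sum.swap) simp
    then show ?thesis by (simp only: exp_sum[OF finJ])
  qed
  ultimately show ?thesis by simp
qed

text \<open>Markov's inequality applied to the expected deviation.\<close>

lemma deviation_prob_tendsto_0:
  assumes "\<epsilon> > 0"
  shows "(\<lambda>n. \<Sum>\<omega>\<in>{\<omega>\<in>assignments L n. dev n \<omega> > \<epsilon>}. weight w n \<omega>) \<longlonglongrightarrow> 0"
proof -
  have lim: "(\<lambda>n. (\<Sum>\<omega>\<in>assignments L n. weight w n \<omega> * dev n \<omega>) / \<epsilon>) \<longlonglongrightarrow> 0 / \<epsilon>"
    using expected_deviation_tendsto_0[OF finL w_nonneg w_sum] assms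
    by (intro tendsto_divide tendsto_const) (auto simp: dev_def)
  show ?thesis
  proof (rule tendsto_sandwich[OF _ _ tendsto_const])
    show "(\<lambda>n. (\<Sum>\<omega>\<in>assignments L n. weight w n \<omega> * dev n \<omega>) / \<epsilon>) \<longlonglongrightarrow> 0" using lim by simp
    have "(\<Sum>\<omega>\<in>{\<omega>\<in>assignments L n. dev n \<omega> > \<epsilon>}. weight w n \<omega>) \<le>
      (\<Sum>\<omega>\<in>assignments L n. weight w n \<omega> * dev n \<omega> / \<epsilon>)" for n
    proof (rule order_trans[OF sum_mono sum_mono2])
      fix \<omega> assume "\<omega> \<in> {\<omega>\<in>assignments L n. dev n \<omega> > \<epsilon>}"
      then have "weight w n \<omega> * 1 \<le> weight w n \<omega> * (dev n \<omega> / \<epsilon>)"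
        using assms by (intro mult_left_mono weight_nonneg[OF w_nonneg]) auto
      then show "weight w n \<omega> \<le> weight w n \<omega> * dev n \<omega> / \<epsilon>" by simp
    qed (use assms finL in \<open>auto intro!: divide_nonneg_nonneg mult_nonneg_nonneg weight_nonneg[OF w_nonneg] dev_nonneg\<close>)
    then show "\<forall>\<^sub>F n in sequentially. (\<Sum>\<omega>\<in>{\<omega>\<in>assignments L n. dev n \<omega> > \<epsilon>}. weight w n \<omega>) \<le>
      (\<Sum>\<omega>\<in>assignments L n. weight w n \<omega> * dev n \<omega>) / \<epsilon>"
      by (intro always_eventually allI) (simp add: sum_divide_distrib)
    show "\<forall>\<^sub>F n in sequentially. 0 \<le> (\<Sum>\<omega>\<in>{\<omega>\<in>assignments L n. dev n \<omega> > \<epsilon>}. weight w n \<omega>)"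
      by (intro always_eventually allI sum_nonneg weight_nonneg[OF w_nonneg]) auto
  qed
qed

section \<open>Convergence near the product law\<close>

text \<open>What remains after the leading exponential is removed: bounded above and below on all
  assignments for large n, and close to \<open>exp (- c0)\<close> where \<open>dev\<close> is
  small.\<close>

definition lr_rest :: "nat \<Rightarrow> (nat \<Rightarrow> 'a) \<Rightarrow> real" where
  "lr_rest n \<omega> = lr n \<omega> / exp (n * quad (freq n \<omega>))"

text \<open>Because \<open>dev\<close> is at most 2, the error in the exponent is bounded on all
  assignments, not only near \<open>w\<close>; the last estimate then follows from the Lipschitz
  property of exp.\<close>

lemma lr_rest_bound:
  obtains C where "C > 0" "\<forall>\<^sub>F n in sequentially. n > 0 \<and> (\<forall>\<omega>\<in>assignments L n.
    lr_rest n \<omega> > 0 \<and> lr_rest n \<omega> \<le> C \<and> lr_rest n \<omega> \<ge> 1 / C \<and>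
    \<bar>lr_rest n \<omega> - exp (- c0)\<bar> \<le> C * (dev n \<omega> + 1 / n))"
proof -
  obtain C where C: "C > 0" "\<forall>\<^sub>F n in sequentially. n > 0 \<and> (\<forall>\<omega>\<in>assignments L n. lr n \<omega> > 0 \<and>
    \<bar>ln (lr n \<omega>) - (n * quad (freq n \<omega>) - c0)\<bar> \<le> C * (dev n \<omega> + 1 / n))"
    using lr_bound by blast
  \<comment> \<open>The 3 bounds \<open>dev + 1 / n\<close>, with \<open>dev\<close> at most 2 and
    \<open>1 / n\<close> at most 1.\<close>
  define b where "b = \<bar>c0\<bar> + 3 * C"
  show thesis
  proof
    have C': "exp b * (C + 1) \<ge> exp b * 1" using C(1) by (intro mult_left_mono) auto
    show "exp b * (C + 1) > 0" using C by (simp add: add_pos_pos)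
    show "\<forall>\<^sub>F n in sequentially. n > 0 \<and> (\<forall>\<omega>\<in>assignments L n.
      lr_rest n \<omega> > 0 \<and> lr_rest n \<omega> \<le> exp b * (C + 1) \<and> lr_rest n \<omega> \<ge> 1 / (exp b * (C + 1)) \<and>
      \<bar>lr_rest n \<omega> - exp (- c0)\<bar> \<le> exp b * (C + 1) * (dev n \<omega> + 1 / n))"
      using C(2)
    proof eventually_elim
      case (elim n)
      have "lr_rest n \<omega> > 0 \<and> lr_rest n \<omega> \<le> exp b * (C + 1) \<and> lr_rest n \<omega> \<ge> 1 / (exp b * (C + 1)) \<and>
        \<bar>lr_rest n \<omega> - exp (- c0)\<bar> \<le> exp b * (C + 1) * (dev n \<omega> + 1 / n)" if w: "\<omega> \<in> assignments L n" for \<omega>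
      proof -
        define x where "x = ln (lr n \<omega>) - n * quad (freq n \<omega>)"
        have pos: "lr n \<omega> > 0" using elim w by blast
        have R: "lr_rest n \<omega> = exp x" using pos by (simp add: lr_rest_def x_def exp_diff)
        have x: "\<bar>x - (- c0)\<bar> \<le> C * (dev n \<omega> + 1 / n)" using elim w by (auto simp: x_def algebra_simps)
        have "dev n \<omega> + 1 / n \<le> 3" using dev_le_2[OF w] elim by (simp add: add_mono[of _ 2 _ 1, simplified])
        then have "C * (dev n \<omega> + 1 / n) \<le> C * 3" using C(1) by (intro mult_left_mono) auto
        then have xb: "\<bar>x\<bar> \<le> b" using x unfolding b_def by linarith
        have cb: "- c0 \<le> b" using C(1) by (simp add: b_def)
        have e: "\<bar>exp y - exp z\<bar> \<le> exp b * \<bar>y - z\<bar>" if "y \<le> b" "z \<le> b" for y z :: real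
        proof -
          have *: "exp y - exp z \<le> exp b * (y - z)" if "z \<le> y" "y \<le> b" for y z :: real
          proof -
            have "1 + (z - y) \<le> exp (z - y)" by (rule exp_ge_add_one_self)
            then have "exp y * (1 - exp (z - y)) \<le> exp y * (y - z)" by (intro mult_left_mono) (linarith, simp)
            also have "\<dots> \<le> exp b * (y - z)" using that by (intro mult_right_mono) auto
            finally show ?thesis by (simp add: right_diff_distrib flip: exp_add)
          qed
          show ?thesis
          proof (cases "z \<le> y")
            case True then show ?thesis using *[of z y] that by (simp add: abs_if)
          next
            case False then show ?thesis using *[of y z] that by (simp add: abs_if)
          qed
        qed
        have "\<bar>exp x - exp (- c0)\<bar> \<le> exp b * \<bar>x - (- c0)\<bar>" using xb cb by (intro e) auto
        also have "\<dots> \<le> exp b * (C * (dev n \<omega> + 1 / n))" using x by (intro mult_left_mono) auto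
        also have "\<dots> \<le> exp b * ((C + 1) * (dev n \<omega> + 1 / n))"
          using dev_nonneg[of n \<omega>] by (intro mult_left_mono mult_right_mono) auto
        finally have 1: "\<bar>lr_rest n \<omega> - exp (- c0)\<bar> \<le> exp b * (C + 1) * (dev n \<omega> + 1 / n)"
          by (simp add: R mult.assoc)
        have "exp x \<le> exp b" using xb by simp
        then have 2: "lr_rest n \<omega> \<le> exp b * (C + 1)" using C' unfolding R by linarith
        have "1 / (exp b * (C + 1)) \<le> 1 / exp b" using C' by (intro divide_left_mono) (auto simp: C add_pos_pos)
        also have "\<dots> = exp (- b)" by (simp add: exp_minus divide_inverse)
        also have "\<dots> \<le> exp x" using xb by simp
        finally show ?thesis using 1 2 by (simp add: R)
      qed
      then show ?case using elim by blast
    qed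
  qed
qed

text \<open>For fixed \<open>a\<close>, restricting to \<Lambda> and to small \<open>dev\<close>,
  and replacing \<open>lr_rest\<close> by its limit, cost o(1) together: by Cauchy-Schwarz the error
  is a bounded exponential moment times the L^2 norm of the replacement error, which
  vanishes.\<close>

lemma near_pointwise:
  fixes a :: "'c \<Rightarrow> complex"
  assumes \<Lambda>: "\<And>n. \<Lambda> n \<subseteq> assignments L n"
    and \<Lambda>1: "(\<lambda>n. \<Sum>\<omega>\<in>\<Lambda> n. weight w n \<omega>) \<longlonglongrightarrow> 1" and \<epsilon>: "\<epsilon> > 0"
  shows "(\<lambda>n. \<Sum>\<omega>\<in>{\<omega>\<in>\<Lambda> n. dev n \<omega> \<le> \<epsilon>}. of_real (weight w n \<omega> * lr_rest n \<omega>) *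
      exp (\<Sum>u<n. (\<Sum>c\<in>J. a c * of_real (\<phi> c (\<omega> u))) / of_real (sqrt n)))
    \<longlonglongrightarrow> of_real (exp (- c0)) * exp ((\<Sum>c\<in>J. (a c)\<^sup>2) / 2)"
proof -
  obtain C where C: "C > 0" "\<forall>\<^sub>F n in sequentially. n > 0 \<and> (\<forall>\<omega>\<in>assignments L n.
    lr_rest n \<omega> > 0 \<and> lr_rest n \<omega> \<le> C \<and> lr_rest n \<omega> \<ge> 1 / C \<and>
    \<bar>lr_rest n \<omega> - exp (- c0)\<bar> \<le> C * (dev n \<omega> + 1 / n))" using lr_rest_bound by blast
  define E where "E n = {\<omega>\<in>\<Lambda> n. dev n \<omega> \<le> \<epsilon>}" for n
  have E_sub: "E n \<subseteq> assignments L n" for n using \<Lambda>[of n] by (auto simp: E_def)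
  have w0: "weight w n \<omega> \<ge> 0" if "\<omega> \<in> assignments L n" for n \<omega> by (rule weight_nonneg[OF w_nonneg that])
  define S where "S n \<omega> = (\<Sum>u<n. (\<Sum>c\<in>J. a c * of_real (\<phi> c (\<omega> u))) / complex_of_real (sqrt n))" for n :: nat and \<omega>
  \<comment> \<open>One error for both losses: the replacement of \<open>lr_rest\<close> on
    \<open>E n\<close>, and the complement of \<open>E n\<close>, where \<open>D\<close> equals
    \<open>- exp (- c0)\<close>.\<close>
  define D where "D n \<omega> = (if \<omega> \<in> E n then lr_rest n \<omega> else 0) - exp (- c0)" for n \<omega>
  have ReS: "Re (S n \<omega>) = (\<Sum>u<n. (\<Sum>c\<in>J. Re (a c) * \<phi> c (\<omega> u))) / sqrt n" for n \<omega>
    by (simp add: S_def sum_divide_distrib)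
  \<comment> \<open>The factor 2 is the square taken in Cauchy-Schwarz.\<close>
  obtain C1 where C1: "\<And>n. (\<Sum>\<omega>\<in>assignments L n. weight w n \<omega> *
      exp ((\<Sum>u<n. 2 * (\<Sum>c\<in>J. Re (a c) * \<phi> c (\<omega> u))) / sqrt n)) \<le> C1"
  proof -
    have "(\<Sum>l\<in>L. w l * (2 * (\<Sum>c\<in>J. Re (a c) * \<phi> c l))) = 0"
      using sum_w_phi_mean[of "\<lambda>c. Re (a c)"] by (simp add: mult.left_commute[of _ 2] flip: sum_distrib_left)
    from exp_moment_bounded[OF finL w_nonneg w_sum this] show thesis using that by blast
  qed
  have exp2: "(\<Sum>\<omega>\<in>assignments L n. weight w n \<omega> * (exp (Re (S n \<omega>)))\<^sup>2) \<le> C1" for n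
    using C1[of n] by (simp add: ReS power2_eq_square sum_distrib_left sum_divide_distrib flip: exp_add)
  have D2: "(\<lambda>n. \<Sum>\<omega>\<in>assignments L n. weight w n \<omega> * (D n \<omega>)\<^sup>2) \<longlonglongrightarrow> 0"
  proof -
    define p1 where "p1 n = (\<Sum>\<omega>\<in>assignments L n. weight w n \<omega> * dev n \<omega>)" for n
    define p2 where "p2 n = 1 - (\<Sum>\<omega>\<in>\<Lambda> n. weight w n \<omega>)" for n
    define p3 where "p3 n = (\<Sum>\<omega>\<in>{\<omega>\<in>assignments L n. dev n \<omega> > \<epsilon>}. weight w n \<omega>)" for n
    \<comment> \<open>On \<open>E n\<close> one factor of D^2 is at most
      \<open>C + exp (- c0)\<close> and the other at most C (dev + 1/n); off \<open>E n\<close> the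
      square is \<open>(exp (- c0))\<^sup>2\<close>. The sum covers both cases.\<close>
    define M where "M = (C + exp (- c0)) * C + (exp (- c0))\<^sup>2"
    have lim: "(\<lambda>n. M * (p1 n + 1 / n + p2 n + p3 n)) \<longlonglongrightarrow> M * (0 + 0 + (1 - 1) + 0)"
      unfolding p1_def p2_def p3_def dev_def[abs_def]
      by (intro tendsto_mult tendsto_add tendsto_diff tendsto_const \<Lambda>1 lim_const_over_n
          expected_deviation_tendsto_0[OF finL w_nonneg w_sum] deviation_prob_tendsto_0[OF \<epsilon>, unfolded dev_def])
    show ?thesis
    proof (rule tendsto_sandwich[OF _ _ tendsto_const])
      show "(\<lambda>n. M * (p1 n + 1 / n + p2 n + p3 n)) \<longlonglongrightarrow> 0" using lim by simp
      show "\<forall>\<^sub>F n in sequentially. 0 \<le> (\<Sum>\<omega>\<in>assignments L n. weight w n \<omega> * (D n \<omega>)\<^sup>2)"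
        by (intro always_eventually allI sum_nonneg mult_nonneg_nonneg w0) auto
      show "\<forall>\<^sub>F n in sequentially. (\<Sum>\<omega>\<in>assignments L n. weight w n \<omega> * (D n \<omega>)\<^sup>2) \<le> M * (p1 n + 1 / n + p2 n + p3 n)"
        using C(2)
      proof eventually_elim
        case (elim n)
        have "(\<Sum>\<omega>\<in>assignments L n. weight w n \<omega> * (D n \<omega>)\<^sup>2) \<le>
          (\<Sum>\<omega>\<in>assignments L n. weight w n \<omega> * (M * (dev n \<omega> + 1 / n)) +
             M * (weight w n \<omega> * (if \<omega> \<in> \<Lambda> n then 0 else 1)) + M * (weight w n \<omega> * (if dev n \<omega> > \<epsilon> then 1 else 0)))"
        proof (rule sum_mono)
          fix \<omega> assume w: "\<omega> \<in> assignments L n"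
          define b where "b = (if \<omega> \<in> \<Lambda> n then 0 else 1) + (if dev n \<omega> > \<epsilon> then 1 else (0::real))"
          have M0: "M \<ge> 0" "M \<ge> (exp (- c0))\<^sup>2" "M \<ge> (C + exp (- c0)) * C" using C(1) by (auto simp: M_def)
          have b0: "b \<ge> 0" by (simp add: b_def)
          have "(D n \<omega>)\<^sup>2 \<le> M * (dev n \<omega> + 1 / n) + M * b"
          proof (cases "\<omega> \<in> E n")
            case True
            have lrb: "lr_rest n \<omega> > 0" "lr_rest n \<omega> \<le> C" "\<bar>lr_rest n \<omega> - exp (- c0)\<bar> \<le> C * (dev n \<omega> + 1 / n)"
              using elim w by auto
            have "\<bar>D n \<omega>\<bar> \<le> C + exp (- c0)" using lrb True by (simp add: D_def abs_le_iff) (smt (verit) exp_gt_zero)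
            moreover have "\<bar>D n \<omega>\<bar> \<le> C * (dev n \<omega> + 1 / n)" using lrb True by (simp add: D_def)
            ultimately have "\<bar>D n \<omega>\<bar> * \<bar>D n \<omega>\<bar> \<le> (C + exp (- c0)) * (C * (dev n \<omega> + 1 / n))"
              using C(1) by (intro mult_mono) auto
            also have "\<dots> = ((C + exp (- c0)) * C) * (dev n \<omega> + 1 / n)" by simp
            also have "\<dots> \<le> M * (dev n \<omega> + 1 / n)" using M0 dev_nonneg[of n \<omega>] by (intro mult_right_mono) auto
            finally have "(D n \<omega>)\<^sup>2 \<le> M * (dev n \<omega> + 1 / n)" by (simp add: power2_eq_square)
            then show ?thesis using mult_nonneg_nonneg[OF M0(1) b0] by linarith
          next
            case False
            then have b1: "b \<ge> 1" using w by (auto simp: b_def E_def)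
            have "(D n \<omega>)\<^sup>2 \<le> M * 1" using False M0 by (simp add: D_def)
            also have "\<dots> \<le> M * b" using b1 M0 by (intro mult_left_mono) auto
            finally show ?thesis using M0 dev_nonneg[of n \<omega>] by (simp add: add_increasing)
          qed
          then have "weight w n \<omega> * (D n \<omega>)\<^sup>2 \<le> weight w n \<omega> * (M * (dev n \<omega> + 1 / n) + M * b)"
            by (intro mult_left_mono w0 w)
          then show "weight w n \<omega> * (D n \<omega>)\<^sup>2 \<le> weight w n \<omega> * (M * (dev n \<omega> + 1 / n)) +
             M * (weight w n \<omega> * (if \<omega> \<in> \<Lambda> n then 0 else 1)) + M * (weight w n \<omega> * (if dev n \<omega> > \<epsilon> then 1 else 0))"
            by (simp add: b_def distrib_left mult_ac)
        qed
        also have "\<dots> = M * (\<Sum>\<omega>\<in>assignments L n. weight w n \<omega> * dev n \<omega> + (1 / n) * weight w n \<omega>)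
            + M * (\<Sum>\<omega>\<in>assignments L n. weight w n \<omega> * (if \<omega> \<in> \<Lambda> n then 0 else 1))
            + M * (\<Sum>\<omega>\<in>assignments L n. weight w n \<omega> * (if dev n \<omega> > \<epsilon> then 1 else 0))"
          by (simp only: sum_distrib_left sum.distrib[symmetric])
             (intro sum.cong refl, simp add: algebra_simps)
        also have "(\<Sum>\<omega>\<in>assignments L n. weight w n \<omega> * dev n \<omega> + (1 / n) * weight w n \<omega>) = p1 n + 1 / n"
          unfolding sum.distrib sum_distrib_left[symmetric] sum_weight[OF finL w_sum] p1_def by simp
        also have "(\<Sum>\<omega>\<in>assignments L n. weight w n \<omega> * (if \<omega> \<in> \<Lambda> n then 0 else 1)) = p2 n"
        proof -
          have "(\<Sum>\<omega>\<in>assignments L n. weight w n \<omega> * (if \<omega> \<in> \<Lambda> n then 0 else 1)) =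
             (\<Sum>\<omega>\<in>assignments L n - \<Lambda> n. weight w n \<omega>)"
            using finL by (intro sum.mono_neutral_cong_right) auto
          also have "\<dots> = 1 - (\<Sum>\<omega>\<in>\<Lambda> n. weight w n \<omega>)"
            using finL \<Lambda>[of n] by (simp add: sum_diff sum_weight[OF finL w_sum])
          finally show ?thesis by (simp add: p2_def)
        qed
        also have "(\<Sum>\<omega>\<in>assignments L n. weight w n \<omega> * (if dev n \<omega> > \<epsilon> then 1 else 0)) = p3 n"
          unfolding p3_def using finL by (intro sum.mono_neutral_cong_right) auto
        finally show ?case by (simp add: algebra_simps)
      qed
    qed
  qed
  have err: "(\<lambda>n. \<Sum>\<omega>\<in>assignments L n. of_real (weight w n \<omega> * D n \<omega>) * exp (S n \<omega>)) \<longlonglongrightarrow> 0"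
  proof (rule Lim_null_comparison[OF always_eventually])
    have "(\<lambda>n. sqrt C1 * sqrt (\<Sum>\<omega>\<in>assignments L n. weight w n \<omega> * (D n \<omega>)\<^sup>2)) \<longlonglongrightarrow> sqrt C1 * sqrt 0"
      by (intro tendsto_mult tendsto_const tendsto_real_sqrt D2)
    then show "(\<lambda>n. sqrt C1 * sqrt (\<Sum>\<omega>\<in>assignments L n. weight w n \<omega> * (D n \<omega>)\<^sup>2)) \<longlonglongrightarrow> 0" by simp
    show "\<forall>n. norm (\<Sum>\<omega>\<in>assignments L n. of_real (weight w n \<omega> * D n \<omega>) * exp (S n \<omega>))
        \<le> sqrt C1 * sqrt (\<Sum>\<omega>\<in>assignments L n. weight w n \<omega> * (D n \<omega>)\<^sup>2)"
    proof
      fix n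
      have "norm (\<Sum>\<omega>\<in>assignments L n. of_real (weight w n \<omega> * D n \<omega>) * exp (S n \<omega>))
        \<le> (\<Sum>\<omega>\<in>assignments L n. (sqrt (weight w n \<omega>) * exp (Re (S n \<omega>))) * (sqrt (weight w n \<omega>) * \<bar>D n \<omega>\<bar>))"
      proof (rule sum_norm_le)
        fix \<omega> assume "\<omega> \<in> assignments L n"
        then obtain q where "weight w n \<omega> = q * q" "q \<ge> 0"
          using w0 by (metis real_sqrt_ge_zero real_sqrt_mult_self abs_of_nonneg)
        then show "norm (of_real (weight w n \<omega> * D n \<omega>) * exp (S n \<omega>)) \<le>
          (sqrt (weight w n \<omega>) * exp (Re (S n \<omega>))) * (sqrt (weight w n \<omega>) * \<bar>D n \<omega>\<bar>)"
          by (simp add: norm_mult abs_mult)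
      qed
      also have "\<dots> \<le> sqrt (\<Sum>\<omega>\<in>assignments L n. (sqrt (weight w n \<omega>) * exp (Re (S n \<omega>)))\<^sup>2) *
         sqrt (\<Sum>\<omega>\<in>assignments L n. (sqrt (weight w n \<omega>) * \<bar>D n \<omega>\<bar>)\<^sup>2)"
        unfolding real_sqrt_mult[symmetric] by (rule real_le_rsqrt[OF Cauchy_Schwarz_ineq_sum])
      also have "(\<Sum>\<omega>\<in>assignments L n. (sqrt (weight w n \<omega>) * exp (Re (S n \<omega>)))\<^sup>2) =
         (\<Sum>\<omega>\<in>assignments L n. weight w n \<omega> * (exp (Re (S n \<omega>)))\<^sup>2)"
        by (intro sum.cong) (simp_all add: power_mult_distrib w0)
      also have "(\<Sum>\<omega>\<in>assignments L n. (sqrt (weight w n \<omega>) * \<bar>D n \<omega>\<bar>)\<^sup>2) =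
         (\<Sum>\<omega>\<in>assignments L n. weight w n \<omega> * (D n \<omega>)\<^sup>2)"
        by (intro sum.cong) (simp_all add: power_mult_distrib w0)
      also have "sqrt (\<Sum>\<omega>\<in>assignments L n. weight w n \<omega> * (exp (Re (S n \<omega>)))\<^sup>2) *
          sqrt (\<Sum>\<omega>\<in>assignments L n. weight w n \<omega> * (D n \<omega>)\<^sup>2) \<le>
          sqrt C1 * sqrt (\<Sum>\<omega>\<in>assignments L n. weight w n \<omega> * (D n \<omega>)\<^sup>2)"
        using exp2[of n] by (intro mult_right_mono) (auto intro!: sum_nonneg mult_nonneg_nonneg w0)
      finally show "norm (\<Sum>\<omega>\<in>assignments L n. of_real (weight w n \<omega> * D n \<omega>) * exp (S n \<omega>))
        \<le> sqrt C1 * sqrt (\<Sum>\<omega>\<in>assignments L n. weight w n \<omega> * (D n \<omega>)\<^sup>2)" .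
    qed
  qed
  have main: "(\<lambda>n. of_real (exp (- c0)) * (\<Sum>\<omega>\<in>assignments L n. of_real (weight w n \<omega>) * exp (S n \<omega>)))
     \<longlonglongrightarrow> of_real (exp (- c0)) * exp ((\<Sum>c\<in>J. (a c)\<^sup>2) / 2)"
    unfolding S_def by (intro tendsto_mult tendsto_const clt_exponential)
  have "(\<Sum>\<omega>\<in>E n. of_real (weight w n \<omega> * lr_rest n \<omega>) * exp (S n \<omega>)) =
     (\<Sum>\<omega>\<in>assignments L n. of_real (weight w n \<omega> * D n \<omega>) * exp (S n \<omega>)) +
     of_real (exp (- c0)) * (\<Sum>\<omega>\<in>assignments L n. of_real (weight w n \<omega>) * exp (S n \<omega>))" for n
  proof -
    have "(\<Sum>\<omega>\<in>assignments L n. of_real (weight w n \<omega> * D n \<omega>) * exp (S n \<omega>)) +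
       of_real (exp (- c0)) * (\<Sum>\<omega>\<in>assignments L n. of_real (weight w n \<omega>) * exp (S n \<omega>)) =
       (\<Sum>\<omega>\<in>assignments L n. if \<omega> \<in> E n then of_real (weight w n \<omega> * lr_rest n \<omega>) * exp (S n \<omega>) else 0)"
      unfolding sum_distrib_left sum.distrib[symmetric] D_def by (intro sum.cong) (auto simp: algebra_simps)
    also have "\<dots> = (\<Sum>\<omega>\<in>E n. of_real (weight w n \<omega> * lr_rest n \<omega>) * exp (S n \<omega>))"
      using finL E_sub[of n] by (simp add: sum.If_cases Int_absorb1)
    finally show ?thesis by simp
  qed
  then show ?thesis using tendsto_add[OF err main] by (simp add: E_def S_def)
qed

text \<open>For \<open>g\<close> up to order \<open>\<surd>n\<close> the mean over \<open>\<omega>\<close> is an \<open>n\<close>-th power with a quadratic exponent; for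
  larger \<open>g\<close> the restriction to \<open>dev n \<omega> \<le> \<epsilon>\<close> makes the exponent at most \<open>\<surd>k g\<^sup>2 / 2\<close> outright.\<close>

lemma near_domination:
  assumes k: "0 < k" "k < 1" and t: "\<And>c. c \<in> J \<Longrightarrow> 0 \<le> t c \<and> (t c)\<^sup>2 \<le> k"
  obtains \<epsilon> where "\<epsilon> > 0" "\<And>n g. n > 0 \<Longrightarrow>
    (\<Sum>\<omega>\<in>{\<omega>\<in>assignments L n. dev n \<omega> \<le> \<epsilon>}. weight w n \<omega> *
      exp (\<Sum>u<n. (\<Sum>c\<in>J. t c * g c * \<phi> c (\<omega> u)) / sqrt n)) \<le> exp ((\<Sum>c\<in>J. sqrt k * (g c)\<^sup>2) / 2)"
proof -
  obtain F where F: "F > 0" "\<And>c l. c \<in> J \<Longrightarrow> l \<in> L \<Longrightarrow> \<bar>\<phi> c l\<bar> \<le> F" using phi_bounded by blast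
  \<comment> \<open>Chosen so that \<open>exp b * k = sqrt k\<close>: the slack between
    \<open>k\<close> and \<open>sqrt k\<close>, which is still below 1, pays for the factor
    \<open>exp b\<close> in the moment bound.\<close>
  define b where "b = ln (1 / sqrt k)"
  have sk: "sqrt k > 0" "sqrt k < 1" using k by auto
  have "exp b = 1 / sqrt k" unfolding b_def using sk by (intro exp_ln) auto
  then have b: "b > 0" "exp b * k = sqrt k" using k sk by (auto simp: b_def ln_div real_div_sqrt)
  \<comment> \<open>The \<open>+ 1\<close> keeps \<open>m\<close> positive when \<open>J\<close> is
    empty.\<close>
  define m where "m = real (card J) + 1"
  have m: "m > 0" "real (card J) \<le> m" by (auto simp: m_def)
  \<comment> \<open>Makes the one-letter exponent at most \<open>b\<close> in absolute value as long
    as |g| is at most \<open>\<eta> * sqrt n\<close>.\<close>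
  define \<eta> where "\<eta> = b / (m * F)"
  have \<eta>: "\<eta> > 0" "m * F * \<eta> = b" using b m F by (auto simp: \<eta>_def)
  \<comment> \<open>For larger |g|, the coordinates are at most \<open>F * \<epsilon>\<close>, and
    this choice bounds the exponent by sqrt k |g| \<eta> sqrt n / 2, hence by sqrt k |g|^2 /
    2.\<close>
  define \<epsilon> where "\<epsilon> = \<eta> / (2 * m * F)"
  have \<epsilon>: "\<epsilon> > 0" "m * F * \<epsilon> = \<eta> / 2" using \<eta> m F by (auto simp: \<epsilon>_def)
  have t1: "0 \<le> t c" "t c \<le> sqrt k" "t c \<le> 1" if "c \<in> J" for c
  proof -
    show "0 \<le> t c" using t[OF that] by simp
    show le: "t c \<le> sqrt k" using t[OF that] by (intro real_le_rsqrt) simp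
    show "t c \<le> 1" using le sk by linarith
  qed
  show thesis
  proof
    show "\<epsilon> > 0" by (rule \<epsilon>)
    fix n :: nat and g :: "'c \<Rightarrow> real"
    assume n: "n > 0"
    define G where "G = (\<Sum>c\<in>J. (g c)\<^sup>2)"
    have G0: "G \<ge> 0" by (simp add: G_def sum_nonneg)
    have gc: "\<bar>g c\<bar> \<le> sqrt G" if "c \<in> J" for c
    proof -
      have "(g c)\<^sup>2 \<le> G" unfolding G_def using finJ that by (intro member_le_sum) auto
      then show ?thesis by (simp add: real_le_rsqrt)
    qed
    have goal: "exp ((\<Sum>c\<in>J. sqrt k * (g c)\<^sup>2) / 2) = exp (sqrt k * G / 2)"
      by (simp add: G_def sum_distrib_left)
    let ?E = "{\<omega>\<in>assignments L n. dev n \<omega> \<le> \<epsilon>}"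
    show "(\<Sum>\<omega>\<in>?E. weight w n \<omega> * exp (\<Sum>u<n. (\<Sum>c\<in>J. t c * g c * \<phi> c (\<omega> u)) / sqrt n))
        \<le> exp ((\<Sum>c\<in>J. sqrt k * (g c)\<^sup>2) / 2)"
    proof (cases "sqrt G \<le> \<eta> * sqrt n")
      case True
      define h where "h l = (\<Sum>c\<in>J. t c * g c * \<phi> c l) / sqrt n" for l
      have "(\<Sum>\<omega>\<in>?E. weight w n \<omega> * exp (\<Sum>u<n. h (\<omega> u))) \<le>
          (\<Sum>\<omega>\<in>assignments L n. weight w n \<omega> * exp (\<Sum>u<n. h (\<omega> u)))"
        using finL by (intro sum_mono2) (auto intro!: mult_nonneg_nonneg weight_nonneg[OF w_nonneg])
      also have "\<dots> \<le> exp (n * (exp b / 2 * (\<Sum>l\<in>L. w l * (h l)\<^sup>2)))"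
      proof (rule exp_moment_le[OF finL w_nonneg w_sum])
        show "(\<Sum>l\<in>L. w l * h l) = 0"
          using sum_w_phi_mean[of "\<lambda>c. t c * g c"] by (simp add: h_def flip: sum_divide_distrib)
        fix l assume l: "l \<in> L"
        have "\<bar>\<Sum>c\<in>J. t c * g c * \<phi> c l\<bar> \<le> (\<Sum>c\<in>J. 1 * sqrt G * F)"
        proof (rule sum_abs[THEN order_trans], rule sum_mono)
          fix c assume c: "c \<in> J"
          show "\<bar>t c * g c * \<phi> c l\<bar> \<le> 1 * sqrt G * F"
            unfolding abs_mult using t1[OF c] gc[OF c] F(2)[OF c l] G0 by (intro mult_mono) auto
        qed
        also have "\<dots> = card J * (F * sqrt G)" by simp
        also have "\<dots> \<le> m * (F * (\<eta> * sqrt n))"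
          using m F G0 True by (intro mult_mono) auto
        also have "\<dots> = b * sqrt n" using \<eta> by simp
        finally show "\<bar>h l\<bar> \<le> b" using n by (simp add: h_def divide_le_eq)
      qed auto
      also have "n * (exp b / 2 * (\<Sum>l\<in>L. w l * (h l)\<^sup>2)) = exp b / 2 * (\<Sum>c\<in>J. (t c)\<^sup>2 * (g c)\<^sup>2)"
        using n sum_w_phi_sq[of "\<lambda>c. t c * g c"]
        by (simp add: h_def power_divide power_mult_distrib flip: sum_divide_distrib)
      also have "exp (exp b / 2 * (\<Sum>c\<in>J. (t c)\<^sup>2 * (g c)\<^sup>2)) \<le> exp (exp b / 2 * (k * G))"
        unfolding G_def sum_distrib_left[of k] using t
        by (auto intro!: mult_left_mono sum_mono mult_right_mono)
      also have "exp b / 2 * (k * G) = sqrt k * G / 2" using b(2) by simp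
      finally show ?thesis unfolding goal h_def .
    next
      case False
      have "(\<Sum>\<omega>\<in>?E. weight w n \<omega> * exp (\<Sum>u<n. (\<Sum>c\<in>J. t c * g c * \<phi> c (\<omega> u)) / sqrt n))
        \<le> (\<Sum>\<omega>\<in>?E. weight w n \<omega> * exp (sqrt k * G / 2))"
      proof (intro sum_mono mult_left_mono weight_nonneg[OF w_nonneg])
        fix \<omega> assume w: "\<omega> \<in> ?E"
        have "(\<Sum>u<n. (\<Sum>c\<in>J. t c * g c * \<phi> c (\<omega> u)) / sqrt n) =
           (\<Sum>c\<in>J. t c * g c * (\<Sum>u<n. \<phi> c (\<omega> u)) / sqrt n)"
          by (simp add: sum_distrib_left sum_divide_distrib) (rule sum.swap)
        also have "\<dots> = (\<Sum>c\<in>J. t c * g c * (sqrt n * (\<Sum>l\<in>L. freq n \<omega> l * \<phi> c l)))"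
        proof (rule sum.cong)
          fix c
          have "(\<Sum>u<n. \<phi> c (\<omega> u)) = (sqrt n * sqrt n) * (\<Sum>l\<in>L. freq n \<omega> l * \<phi> c l)"
            using w sum_assignment_eq_freq[OF finL, of \<omega> n "\<phi> c"] by simp
          then show "t c * g c * (\<Sum>u<n. \<phi> c (\<omega> u)) / sqrt n = t c * g c * (sqrt n * (\<Sum>l\<in>L. freq n \<omega> l * \<phi> c l))"
            using n by (simp del: real_sqrt_mult_self)
        qed simp
        also have "\<dots> \<le> (\<Sum>c\<in>J. sqrt k * sqrt G * (sqrt n * (F * \<epsilon>)))"
        proof (rule sum_mono)
          fix c assume c: "c \<in> J"
          have "\<bar>\<Sum>l\<in>L. freq n \<omega> l * \<phi> c l\<bar> \<le> F * dev n \<omega>" by (rule sum_freq_phi_le[OF F(2) c])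
          also have "\<dots> \<le> F * \<epsilon>" using w F by (intro mult_left_mono) auto
          finally have f: "\<bar>\<Sum>l\<in>L. freq n \<omega> l * \<phi> c l\<bar> \<le> F * \<epsilon>" .
          have "t c * g c * (sqrt n * (\<Sum>l\<in>L. freq n \<omega> l * \<phi> c l)) \<le>
            \<bar>t c * g c * (sqrt n * (\<Sum>l\<in>L. freq n \<omega> l * \<phi> c l))\<bar>" by (rule abs_ge_self)
          also have "\<dots> \<le> sqrt k * sqrt G * (sqrt n * (F * \<epsilon>))"
            unfolding abs_mult using t1[OF c] gc[OF c] f G0 sk by (intro mult_mono) auto
          finally show "t c * g c * (sqrt n * (\<Sum>l\<in>L. freq n \<omega> l * \<phi> c l)) \<le> sqrt k * sqrt G * (sqrt n * (F * \<epsilon>))" .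
        qed
        also have "\<dots> = card J * (sqrt k * sqrt G * (sqrt n * (F * \<epsilon>)))" by simp
        also have "\<dots> \<le> m * (sqrt k * sqrt G * (sqrt n * (F * \<epsilon>)))"
          using m sk G0 F \<epsilon> by (intro mult_right_mono) auto
        also have "\<dots> = sqrt k * sqrt G * (sqrt n * (m * F * \<epsilon>))" by simp
        also have "\<dots> = sqrt k * sqrt G * (\<eta> * sqrt n) / 2" unfolding \<epsilon>(2) by simp
        also have "\<dots> \<le> sqrt k * sqrt G * sqrt G / 2"
          using False sk G0 by (intro divide_right_mono mult_left_mono) auto
        also have "\<dots> = sqrt k * G / 2" using G0 by simp
        finally show "exp (\<Sum>u<n. (\<Sum>c\<in>J. t c * g c * \<phi> c (\<omega> u)) / sqrt n) \<le> exp (sqrt k * G / 2)" by simp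
      qed auto
      also have "\<dots> = (\<Sum>\<omega>\<in>?E. weight w n \<omega>) * exp (sqrt k * G / 2)" by (simp add: sum_distrib_right)
      also have "\<dots> \<le> 1 * exp (sqrt k * G / 2)"
      proof (intro mult_right_mono)
        have "(\<Sum>\<omega>\<in>?E. weight w n \<omega>) \<le> (\<Sum>\<omega>\<in>assignments L n. weight w n \<omega>)"
          using finL by (intro sum_mono2) (auto intro!: weight_nonneg[OF w_nonneg])
        then show "(\<Sum>\<omega>\<in>?E. weight w n \<omega>) \<le> 1" by (simp add: sum_weight[OF finL w_sum])
      qed auto
      finally show ?thesis unfolding goal by simp
    qed
  qed
qed

text \<open>Dominated convergence under the Gaussian measure. The dominating function is a multiple
  of exp (sqrt k |g|^2 / 2), integrable since sqrt k < 1, and the integral of the pointwise limit is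
  a product of one-dimensional Gaussian integrals.\<close>

lemma near_limit:
  assumes \<Lambda>: "\<And>n. \<Lambda> n \<subseteq> assignments L n"
    and \<Lambda>1: "(\<lambda>n. \<Sum>\<omega>\<in>\<Lambda> n. weight w n \<omega>) \<longlonglongrightarrow> 1"
    and k: "0 < k" "k < 1" and \<kappa>: "\<And>c. c \<in> J \<Longrightarrow> \<kappa> c \<le> k"
  obtains \<epsilon> where "\<epsilon> > 0" "(\<lambda>n. \<Sum>\<omega>\<in>{\<omega>\<in>\<Lambda> n. dev n \<omega> \<le> \<epsilon>}. weight w n \<omega> * lr n \<omega>)
    \<longlonglongrightarrow> exp (- c0) * (\<Prod>c\<in>J. (1 - \<kappa> c) powr (- 1 / 2))"
proof -
  define z where "z c = csqrt (of_real (\<kappa> c))" for c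
  have z2: "(z c)\<^sup>2 = of_real (\<kappa> c)" for c by (simp add: z_def)
  \<comment> \<open>Absolute values see only the real part of the square root. Negative eigenvalues
    contribute pure oscillation, so only the upper bound \<open>k\<close> on the eigenvalues
    enters.\<close>
  have t: "0 \<le> Re (z c) \<and> (Re (z c))\<^sup>2 \<le> k" if "c \<in> J" for c
  proof (cases "\<kappa> c \<ge> 0")
    case True
    then have "z c = of_real (sqrt (\<kappa> c))" by (simp add: z_def)
    then show ?thesis using True \<kappa>[OF that] by simp
  next
    case False
    then have "z c = \<i> * of_real (sqrt (- \<kappa> c))" unfolding z_def by (subst csqrt_of_real_nonpos) auto
    then show ?thesis using k by simp
  qed
  obtain \<epsilon> where \<epsilon>: "\<epsilon> > 0" and dom: "\<And>n g. n > 0 \<Longrightarrow>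
    (\<Sum>\<omega>\<in>{\<omega>\<in>assignments L n. dev n \<omega> \<le> \<epsilon>}. weight w n \<omega> *
      exp (\<Sum>u<n. (\<Sum>c\<in>J. Re (z c) * g c * \<phi> c (\<omega> u)) / sqrt n)) \<le> exp ((\<Sum>c\<in>J. sqrt k * (g c)\<^sup>2) / 2)"
    using near_domination[of k "\<lambda>c. Re (z c)", OF k t] by blast
  obtain C where C: "C > 0" "\<forall>\<^sub>F n in sequentially. n > 0 \<and> (\<forall>\<omega>\<in>assignments L n.
    lr_rest n \<omega> > 0 \<and> lr_rest n \<omega> \<le> C \<and> lr_rest n \<omega> \<ge> 1 / C \<and>
    \<bar>lr_rest n \<omega> - exp (- c0)\<bar> \<le> C * (dev n \<omega> + 1 / n))" using lr_rest_bound by blast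
  then obtain N where N: "\<And>n. n \<ge> N \<Longrightarrow> n > 0" "\<And>n \<omega>. n \<ge> N \<Longrightarrow> \<omega> \<in> assignments L n \<Longrightarrow> lr_rest n \<omega> > 0 \<and> lr_rest n \<omega> \<le> C"
    unfolding eventually_sequentially by blast
  define E where "E n = {\<omega>\<in>\<Lambda> n. dev n \<omega> \<le> \<epsilon>}" for n
  have E_sub: "E n \<subseteq> {\<omega>\<in>assignments L n. dev n \<omega> \<le> \<epsilon>}" "E n \<subseteq> assignments L n" for n
    using \<Lambda>[of n] by (auto simp: E_def)
  define S where "S n \<omega> g = (\<Sum>u<n. (\<Sum>c\<in>J. z c * of_real (g c) * of_real (\<phi> c (\<omega> u))) / complex_of_real (sqrt n))"
    for n :: nat and \<omega> and g :: "'c \<Rightarrow> real"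
  \<comment> \<open>Set to 0 below \<open>N\<close> because the bounds hold only eventually, whereas
    dominated convergence asks for all n.\<close>
  define f where "f n g = (if n \<ge> N then (\<Sum>\<omega>\<in>E n. of_real (weight w n \<omega> * lr_rest n \<omega>) * exp (S n \<omega> g)) else 0)"
    for n and g :: "'c \<Rightarrow> real"
  have S_meas: "(\<lambda>g. S n \<omega> g) \<in> borel_measurable gauss" for n \<omega>
    unfolding S_def by measurable
  have f_meas: "f n \<in> borel_measurable gauss" for n
    unfolding f_def[abs_def] using S_meas by measurable
  have lim: "(\<lambda>n. LINT g|gauss. f n g) \<longlonglongrightarrow> (LINT g|gauss. of_real (exp (- c0) * exp ((\<Sum>c\<in>J. \<kappa> c * (g c)\<^sup>2) / 2)))"
  proof (rule integral_dominated_convergence[where w = "\<lambda>g. C * exp ((\<Sum>c\<in>J. sqrt k * (g c)\<^sup>2) / 2)"])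
    show "(\<lambda>g. complex_of_real (exp (- c0) * exp ((\<Sum>c\<in>J. \<kappa> c * (g c)\<^sup>2) / 2))) \<in> borel_measurable gauss"
      by measurable
    show "f n \<in> borel_measurable gauss" for n by (rule f_meas)
    show "integrable gauss (\<lambda>g. C * exp ((\<Sum>c\<in>J. sqrt k * (g c)\<^sup>2) / 2))"
      using gauss_exp_square[of "\<lambda>_. sqrt k"] k by (intro integrable_mult_right) (auto simp: has_bochner_integral_iff)
    show "AE g in gauss. (\<lambda>n. f n g) \<longlonglongrightarrow> of_real (exp (- c0) * exp ((\<Sum>c\<in>J. \<kappa> c * (g c)\<^sup>2) / 2))"
    proof (intro AE_I2)
      fix g :: "'c \<Rightarrow> real"
      have "(\<lambda>n. \<Sum>\<omega>\<in>E n. of_real (weight w n \<omega> * lr_rest n \<omega>) * exp (S n \<omega> g))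
        \<longlonglongrightarrow> of_real (exp (- c0)) * exp ((\<Sum>c\<in>J. (z c * of_real (g c))\<^sup>2) / 2)"
        unfolding E_def S_def by (rule near_pointwise[OF \<Lambda> \<Lambda>1 \<epsilon>])
      also have "of_real (exp (- c0)) * exp ((\<Sum>c\<in>J. (z c * of_real (g c))\<^sup>2) / 2) =
        complex_of_real (exp (- c0) * exp ((\<Sum>c\<in>J. \<kappa> c * (g c)\<^sup>2) / 2))"
        by (simp add: power_mult_distrib z2 flip: exp_of_real)
      finally show "(\<lambda>n. f n g) \<longlonglongrightarrow> complex_of_real (exp (- c0) * exp ((\<Sum>c\<in>J. \<kappa> c * (g c)\<^sup>2) / 2))"
        by (rule Lim_transform_eventually)
           (use eventually_ge_at_top[of N] in \<open>eventually_elim, simp add: f_def\<close>)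
    qed
    fix n
    show "AE g in gauss. norm (f n g) \<le> C * exp ((\<Sum>c\<in>J. sqrt k * (g c)\<^sup>2) / 2)"
    proof (intro AE_I2)
      fix g :: "'c \<Rightarrow> real"
      show "norm (f n g) \<le> C * exp ((\<Sum>c\<in>J. sqrt k * (g c)\<^sup>2) / 2)"
      proof (cases "n \<ge> N")
        case True
        have ReS: "Re (S n \<omega> g) = (\<Sum>u<n. (\<Sum>c\<in>J. Re (z c) * g c * \<phi> c (\<omega> u)) / sqrt n)" for \<omega>
          by (simp add: S_def)
        have "norm (f n g) \<le> (\<Sum>\<omega>\<in>E n. C * (weight w n \<omega> * exp (Re (S n \<omega> g))))"
          unfolding f_def using True
        proof (simp, intro sum_norm_le)
          fix \<omega> assume "\<omega> \<in> E n"
          then have w: "\<omega> \<in> assignments L n" using E_sub(2) by blast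
          have "norm (complex_of_real (weight w n \<omega>) * of_real (lr_rest n \<omega>) * exp (S n \<omega> g)) =
            lr_rest n \<omega> * (weight w n \<omega> * exp (Re (S n \<omega> g)))"
            using weight_nonneg[OF w_nonneg w] N(2)[OF True w] by (simp add: norm_mult)
          also have "\<dots> \<le> C * (weight w n \<omega> * exp (Re (S n \<omega> g)))"
            using weight_nonneg[OF w_nonneg w] N(2)[OF True w] by (intro mult_right_mono) auto
          finally show "norm (complex_of_real (weight w n \<omega>) * of_real (lr_rest n \<omega>) * exp (S n \<omega> g)) \<le>
             C * (weight w n \<omega> * exp (Re (S n \<omega> g)))" .
        qed
        also have "\<dots> = C * (\<Sum>\<omega>\<in>E n. weight w n \<omega> * exp (Re (S n \<omega> g)))" by (simp add: sum_distrib_left)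
        also have "\<dots> \<le> C * (\<Sum>\<omega>\<in>{\<omega>\<in>assignments L n. dev n \<omega> \<le> \<epsilon>}. weight w n \<omega> * exp (Re (S n \<omega> g)))"
          using finL E_sub(1)[of n] C(1)
          by (intro mult_left_mono sum_mono2) (auto intro!: mult_nonneg_nonneg weight_nonneg[OF w_nonneg])
        also have "\<dots> \<le> C * exp ((\<Sum>c\<in>J. sqrt k * (g c)\<^sup>2) / 2)"
          unfolding ReS using C(1) dom[OF N(1)[OF True]] by (intro mult_left_mono) auto
        finally show ?thesis .
      qed (use C(1) in \<open>simp add: f_def\<close>)
    qed
  qed
  \<comment> \<open>The linearisation read backwards: integrating over \<open>g\<close> restores exp
    (n \<open>quad\<close>), which recombines with \<open>lr_rest\<close> to
    \<open>lr\<close>.\<close>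
  have int_f: "(LINT g|gauss. f n g) = of_real (\<Sum>\<omega>\<in>E n. weight w n \<omega> * lr n \<omega>)" if n: "n \<ge> N" for n
  proof -
    have "has_bochner_integral gauss (\<lambda>g. \<Sum>\<omega>\<in>E n. of_real (weight w n \<omega> * lr_rest n \<omega>) * exp (S n \<omega> g))
      (\<Sum>\<omega>\<in>E n. of_real (weight w n \<omega> * lr_rest n \<omega>) * of_real (exp (n * quad (freq n \<omega>))))"
      unfolding S_def z_def using E_sub(2)[of n] N(1)[OF n]
      by (intro has_bochner_integral_sum has_bochner_integral_mult_right exp_n_quad_linearise) auto
    also have "(\<Sum>\<omega>\<in>E n. of_real (weight w n \<omega> * lr_rest n \<omega>) * complex_of_real (exp (n * quad (freq n \<omega>)))) =
       of_real (\<Sum>\<omega>\<in>E n. weight w n \<omega> * lr n \<omega>)"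
      by (simp add: lr_rest_def)
    finally show ?thesis using n by (simp add: f_def[abs_def] has_bochner_integral_iff)
  qed
  have "has_bochner_integral gauss (\<lambda>g. exp (- c0) * exp ((\<Sum>c\<in>J. \<kappa> c * (g c)\<^sup>2) / 2))
     (exp (- c0) * (\<Prod>c\<in>J. (1 - \<kappa> c) powr (- 1 / 2)))"
    using \<kappa> k by (intro has_bochner_integral_mult_right gauss_exp_square) force
  then have "(LINT g|gauss. complex_of_real (exp (- c0) * exp ((\<Sum>c\<in>J. \<kappa> c * (g c)\<^sup>2) / 2))) =
     of_real (exp (- c0) * (\<Prod>c\<in>J. (1 - \<kappa> c) powr (- 1 / 2)))"
    unfolding integral_complex_of_real by (simp add: has_bochner_integral_iff)
  then have "(\<lambda>n. LINT g|gauss. f n g) \<longlonglongrightarrow> of_real (exp (- c0) * (\<Prod>c\<in>J. (1 - \<kappa> c) powr (- 1 / 2)))"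
    using lim by simp
  then have "(\<lambda>n. complex_of_real (\<Sum>\<omega>\<in>E n. weight w n \<omega> * lr n \<omega>)) \<longlonglongrightarrow>
     of_real (exp (- c0) * (\<Prod>c\<in>J. (1 - \<kappa> c) powr (- 1 / 2)))"
    by (rule Lim_transform_eventually)
       (use eventually_ge_at_top[of N] in \<open>eventually_elim, simp add: int_f\<close>)
  then have "(\<lambda>n. \<Sum>\<omega>\<in>E n. weight w n \<omega> * lr n \<omega>) \<longlonglongrightarrow> exp (- c0) * (\<Prod>c\<in>J. (1 - \<kappa> c) powr (- 1 / 2))"
    by (simp only: tendsto_of_real_iff)
  then show thesis using that \<epsilon> by (simp add: E_def)
qed

section \<open>Large deviations\<close>

definition KL :: "('a \<Rightarrow> real) \<Rightarrow> real" where
  "KL \<alpha> = (\<Sum>l\<in>L. \<alpha> l * ln (\<alpha> l / w l))"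

text \<open>The basic identity of the method of types: the log-ratio of the two product weights is
  an additive functional of \<open>\<omega>\<close>, hence n times its mean under the empirical law,
  which is the relative entropy.\<close>

lemma weight_eq_exp_KL:
  assumes w: "\<omega> \<in> assignments L n" and n: "n > 0"
  shows "weight w n \<omega> = exp (- n * KL (freq n \<omega>)) * weight (freq n \<omega>) n \<omega>"
proof -
  have pos: "freq n \<omega> (\<omega> u) > 0" if "u < n" for u
  proof -
    have "{v. v < n \<and> \<omega> v = \<omega> u} \<noteq> {}" using that by auto
    then have "card {v. v < n \<and> \<omega> v = \<omega> u} > 0" by (simp add: card_gt_0_iff)
    then show ?thesis using n by (simp add: freq_def)
  qed
  have wp: "w (\<omega> u) > 0" if "u < n" for u using w_pos assignmentsD[OF w that] by simp
  have "weight w n \<omega> = (\<Prod>u<n. exp (- ln (freq n \<omega> (\<omega> u) / w (\<omega> u))) * freq n \<omega> (\<omega> u))"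
    unfolding weight_def
  proof (rule prod.cong)
    fix u assume "u \<in> {..<n}"
    then have "u < n" by simp
    from pos[OF this] wp[OF this]
    show "w (\<omega> u) = exp (- ln (freq n \<omega> (\<omega> u) / w (\<omega> u))) * freq n \<omega> (\<omega> u)"
      by (simp add: exp_minus)
  qed simp
  also have "\<dots> = exp (- (\<Sum>u<n. ln (freq n \<omega> (\<omega> u) / w (\<omega> u)))) * weight (freq n \<omega>) n \<omega>"
    by (simp add: prod.distrib weight_def exp_sum flip: sum_negf)
  also have "(\<Sum>u<n. ln (freq n \<omega> (\<omega> u) / w (\<omega> u))) = n * KL (freq n \<omega>)"
    unfolding KL_def by (rule sum_assignment_eq_freq[OF finL w])
  finally show ?thesis by simp
qed

text \<open>Each summand is the probability of \<open>\<omega>\<close> under its own empirical law, and there are only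
  polynomially many such laws.\<close>

lemma sum_weight_freq_le:
  assumes n: "n > 0"
  shows "(\<Sum>\<omega>\<in>assignments L n. weight (freq n \<omega>) n \<omega>) \<le> (real n + 1) ^ card L"
proof -
  \<comment> \<open>The possible count vectors. The constraint on the sum makes \<open>N / n\<close>
    a probability law, so each type contributes total mass 1.\<close>
  define T where "T = {N \<in> PiE L (\<lambda>_. {..n}). (\<Sum>l\<in>L. N l) = n}"
  have finT: "finite T" unfolding T_def
    by (rule finite_subset[of _ "PiE L (\<lambda>_. {..n})"]) (auto intro: finite_PiE finL)
  have "(\<Sum>\<omega>\<in>assignments L n. weight (freq n \<omega>) n \<omega>) \<le>
    (\<Sum>\<omega>\<in>assignments L n. \<Sum>N\<in>T. weight (\<lambda>l. real (N l) / n) n \<omega>)"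
  proof (rule sum_mono)
    fix \<omega> assume w: "\<omega> \<in> assignments L n"
    define N where "N = restrict (\<lambda>l. card {u. u < n \<and> \<omega> u = l}) L"
    have "real (\<Sum>l\<in>L. N l) = real n * (\<Sum>l\<in>L. freq n \<omega> l)"
      using n by (simp add: N_def freq_def sum_distrib_left)
    then have "real (\<Sum>l\<in>L. N l) = real n" using sum_freq[OF finL w n] by (simp only: mult_1_right)
    then have "(\<Sum>l\<in>L. N l) = n" by (simp only: of_nat_eq_iff)
    moreover have "card {u. u < n \<and> \<omega> u = l} \<le> n" for l
      using card_mono[of "{..<n}" "{u. u < n \<and> \<omega> u = l}"] by auto
    ultimately have NT: "N \<in> T" by (auto simp: T_def N_def)
    have "weight (freq n \<omega>) n \<omega> = weight (\<lambda>l. real (N l) / n) n \<omega>"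
      unfolding weight_def by (intro prod.cong) (auto simp: N_def freq_def assignmentsD[OF w])
    also have "\<dots> \<le> (\<Sum>N\<in>T. weight (\<lambda>l. real (N l) / n) n \<omega>)"
      using NT finT by (intro member_le_sum[where f = "\<lambda>N. weight (\<lambda>l. real (N l) / n) n \<omega>"])
        (auto intro!: prod_nonneg simp: weight_def)
    finally show "weight (freq n \<omega>) n \<omega> \<le> (\<Sum>N\<in>T. weight (\<lambda>l. real (N l) / n) n \<omega>)" .
  qed
  also have "\<dots> = (\<Sum>N\<in>T. \<Sum>\<omega>\<in>assignments L n. weight (\<lambda>l. real (N l) / n) n \<omega>)" by (rule sum.swap)
  also have "\<dots> = (\<Sum>N\<in>T. 1)"
  proof (rule sum.cong)
    fix N assume "N \<in> T"
    then have "(\<Sum>l\<in>L. real (N l) / n) = 1"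
      using n by (simp add: T_def flip: sum_divide_distrib of_nat_sum)
    then show "(\<Sum>\<omega>\<in>assignments L n. weight (\<lambda>l. real (N l) / n) n \<omega>) = 1" by (rule sum_weight[OF finL])
  qed simp
  also have "\<dots> = real (card T)" by simp
  also have "card T \<le> card (PiE L (\<lambda>_. {..n}))"
    unfolding T_def by (intro card_mono finite_PiE finL) auto
  also have "card (PiE L (\<lambda>_. {..n})) = (n + 1) ^ card L" using finL by (simp add: card_PiE)
  finally show ?thesis by (simp add: add.commute)
qed

text \<open>Entropy beats the quadratic form by \<open>\<eta>\<close>, so each term is at most C exp
  (- \<eta> n) times the probability of \<open>\<omega>\<close> under its own empirical law; the sum
  of the latter grows only polynomially.\<close>

lemma far_limit:
  assumes \<Lambda>: "\<And>n. \<Lambda> n \<subseteq> assignments L n" and \<eta>: "\<eta> > 0"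
    and far: "\<forall>\<^sub>F n in sequentially. \<forall>\<omega>\<in>\<Lambda> n. dev n \<omega> > \<epsilon> \<longrightarrow> KL (freq n \<omega>) - quad (freq n \<omega>) \<ge> \<eta>"
  shows "(\<lambda>n. \<Sum>\<omega>\<in>{\<omega>\<in>\<Lambda> n. dev n \<omega> > \<epsilon>}. weight w n \<omega> * lr n \<omega>) \<longlonglongrightarrow> 0"
proof -
  obtain C where C: "C > 0" "\<forall>\<^sub>F n in sequentially. n > 0 \<and> (\<forall>\<omega>\<in>assignments L n.
    lr_rest n \<omega> > 0 \<and> lr_rest n \<omega> \<le> C \<and> lr_rest n \<omega> \<ge> 1 / C \<and>
    \<bar>lr_rest n \<omega> - exp (- c0)\<bar> \<le> C * (dev n \<omega> + 1 / n))" using lr_rest_bound by blast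
  define k where "k = card L"
  have bd: "\<forall>\<^sub>F n in sequentially. 0 \<le> (\<Sum>\<omega>\<in>{\<omega>\<in>\<Lambda> n. dev n \<omega> > \<epsilon>}. weight w n \<omega> * lr n \<omega>) \<and>
      (\<Sum>\<omega>\<in>{\<omega>\<in>\<Lambda> n. dev n \<omega> > \<epsilon>}. weight w n \<omega> * lr n \<omega>) \<le> C * (2 / \<eta>) ^ k * ((\<eta> * n) ^ k / exp (\<eta> * n))"
    using C(2) far
  proof eventually_elim
    case (elim n)
    let ?E = "{\<omega>\<in>\<Lambda> n. dev n \<omega> > \<epsilon>}"
    have n: "n > 0" using elim by blast
    have lr: "lr n \<omega> = lr_rest n \<omega> * exp (n * quad (freq n \<omega>))" for \<omega> by (simp add: lr_rest_def)
    have nonneg: "0 \<le> weight w n \<omega> * lr n \<omega>" if "\<omega> \<in> ?E" for \<omega>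
    proof -
      have w: "\<omega> \<in> assignments L n" using that \<Lambda> by blast
      then have "lr_rest n \<omega> \<ge> 0" using elim(1) by (simp add: less_imp_le)
      then show ?thesis using weight_nonneg[OF w_nonneg w] by (simp add: lr)
    qed
    have "(\<Sum>\<omega>\<in>?E. weight w n \<omega> * lr n \<omega>) \<le> (\<Sum>\<omega>\<in>?E. C * exp (- \<eta> * n) * weight (freq n \<omega>) n \<omega>)"
    proof (rule sum_mono)
      fix \<omega> assume E: "\<omega> \<in> ?E"
      then have w: "\<omega> \<in> assignments L n" using \<Lambda> by blast
      have F: "KL (freq n \<omega>) - quad (freq n \<omega>) \<ge> \<eta>" using elim E by blast
      have wt0: "weight (freq n \<omega>) n \<omega> \<ge> 0" by (simp add: weight_def prod_nonneg freq_nonneg)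
      have "weight w n \<omega> * lr n \<omega> = lr_rest n \<omega> * exp (- (n * (KL (freq n \<omega>) - quad (freq n \<omega>)))) * weight (freq n \<omega>) n \<omega>"
        unfolding weight_eq_exp_KL[OF w n] lr by (simp add: algebra_simps exp_diff exp_minus field_simps)
      also have "\<dots> \<le> C * exp (- \<eta> * n) * weight (freq n \<omega>) n \<omega>"
      proof (intro mult_right_mono mult_mono wt0)
        show "lr_rest n \<omega> \<le> C" using elim(1) w by blast
        have "real n * \<eta> \<le> n * (KL (freq n \<omega>) - quad (freq n \<omega>))" using F by (intro mult_left_mono) auto
        then show "exp (- (n * (KL (freq n \<omega>) - quad (freq n \<omega>)))) \<le> exp (- \<eta> * n)" by (simp add: mult.commute)
      qed (use C(1) in auto)
      finally show "weight w n \<omega> * lr n \<omega> \<le> C * exp (- \<eta> * n) * weight (freq n \<omega>) n \<omega>" .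
    qed
    also have "\<dots> \<le> (\<Sum>\<omega>\<in>assignments L n. C * exp (- \<eta> * n) * weight (freq n \<omega>) n \<omega>)"
      using finL \<Lambda>[of n] C(1)
      by (intro sum_mono2) (auto intro!: mult_nonneg_nonneg prod_nonneg simp: weight_def freq_nonneg)
    also have "\<dots> = C * exp (- \<eta> * n) * (\<Sum>\<omega>\<in>assignments L n. weight (freq n \<omega>) n \<omega>)"
      by (simp add: sum_distrib_left)
    also have "\<dots> \<le> C * exp (- \<eta> * n) * (real n + 1) ^ k"
      unfolding k_def using C(1) sum_weight_freq_le[OF n] by (intro mult_left_mono) auto
    \<comment> \<open>n + 1 <= 2 n, rewritten in terms of \<eta> n to meet the limit of x^k / exp
      x.\<close>
    also have "\<dots> \<le> C * exp (- \<eta> * n) * ((2 / \<eta>) * (\<eta> * n)) ^ k"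
      using n \<eta> C(1) by (intro mult_left_mono power_mono) auto
    also have "\<dots> = C * (2 / \<eta>) ^ k * ((\<eta> * n) ^ k / exp (\<eta> * n))"
      unfolding power_mult_distrib by (simp add: exp_minus field_simps)
    finally have "(\<Sum>\<omega>\<in>?E. weight w n \<omega> * lr n \<omega>) \<le> C * (2 / \<eta>) ^ k * ((\<eta> * n) ^ k / exp (\<eta> * n))" .
    moreover have "0 \<le> (\<Sum>\<omega>\<in>?E. weight w n \<omega> * lr n \<omega>)" by (rule sum_nonneg) (rule nonneg)
    ultimately show ?case by (rule conjI[rotated])
  qed
  have "filterlim (\<lambda>n. \<eta> * real n) at_top sequentially"
    using \<eta> by (intro filterlim_tendsto_pos_mult_at_top[OF tendsto_const _ filterlim_real_sequentially]) auto
  then have "(\<lambda>n. (\<eta> * real n) ^ k / exp (\<eta> * real n)) \<longlonglongrightarrow> 0"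
    by (rule filterlim_compose[OF tendsto_power_div_exp_0])
  then have "(\<lambda>n. C * (2 / \<eta>) ^ k * ((\<eta> * real n) ^ k / exp (\<eta> * real n))) \<longlonglongrightarrow> C * (2 / \<eta>) ^ k * 0"
    by (intro tendsto_mult tendsto_const)
  then have lim: "(\<lambda>n. C * (2 / \<eta>) ^ k * ((\<eta> * real n) ^ k / exp (\<eta> * real n))) \<longlonglongrightarrow> 0" by simp
  show ?thesis
    by (rule tendsto_sandwich[OF _ _ tendsto_const lim]) (use bd in \<open>auto elim: eventually_mono\<close>)
qed

text \<open>A change of measure from \<open>w\<close> to \<open>\<alpha>\<close>. Assignments with
  empirical law near \<open>\<alpha>\<close> carry almost all the \<open>\<alpha>\<close>-weight;
  there passing to \<open>w\<close> costs about exp (- n KL \<alpha>) while \<open>lr\<close> gains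
  about exp (n quad \<alpha>).\<close>

lemma tilted_divergence:
  assumes \<alpha>: "\<And>l. l \<in> L \<Longrightarrow> \<alpha> l \<ge> 0" "(\<Sum>l\<in>L. \<alpha> l) = 1" and gt: "KL \<alpha> < quad \<alpha>"
    and \<Lambda>: "\<And>n. \<Lambda> n \<subseteq> assignments L n"
    and \<Lambda>1: "(\<lambda>n. \<Sum>\<omega>\<in>\<Lambda> n. weight \<alpha> n \<omega>) \<longlonglongrightarrow> 1"
  shows "filterlim (\<lambda>n. \<Sum>\<omega>\<in>\<Lambda> n. weight w n \<omega> * lr n \<omega>) at_top sequentially"
proof -
  obtain C where C: "C > 0" "\<forall>\<^sub>F n in sequentially. n > 0 \<and> (\<forall>\<omega>\<in>assignments L n.
    lr_rest n \<omega> > 0 \<and> lr_rest n \<omega> \<le> C \<and> lr_rest n \<omega> \<ge> 1 / C \<and>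
    \<bar>lr_rest n \<omega> - exp (- c0)\<bar> \<le> C * (dev n \<omega> + 1 / n))" using lr_rest_bound by blast
  obtain F where F: "F > 0" "\<And>c l. c \<in> J \<Longrightarrow> l \<in> L \<Longrightarrow> \<bar>\<phi> c l\<bar> \<le> F" using phi_bounded by blast
  define \<beta> where "\<beta> l = ln (\<alpha> l / w l)" for l
  define B where "B = (\<Sum>l\<in>L. \<bar>\<beta> l\<bar>)"
  have B: "B \<ge> 0" "\<And>l. l \<in> L \<Longrightarrow> \<bar>\<beta> l\<bar> \<le> B"
    unfolding B_def using finL by (auto intro!: sum_nonneg member_le_sum[of _ L "\<lambda>l. \<bar>\<beta> l\<bar>"])
  define \<delta> where "\<delta> n \<omega> = (\<Sum>l\<in>L. \<bar>freq n \<omega> l - \<alpha> l\<bar>)" for n \<omega>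
  have \<delta>0: "\<delta> n \<omega> \<ge> 0" for n \<omega> by (simp add: \<delta>_def sum_nonneg)
  define r where "r = quad \<alpha> - KL \<alpha>"
  have r: "r > 0" using gt by (simp add: r_def)
  \<comment> \<open>A Lipschitz constant for the net exponent as a function of the empirical law,
    with 1 added for positivity; \<open>\<epsilon>\<close> then preserves half of the gap
    \<open>r\<close>.\<close>
  define M where "M = (\<Sum>c\<in>J. \<bar>\<kappa> c\<bar> * (F * F)) + B + 1"
  have M: "M > 0" using B by (simp add: M_def add_nonneg_pos sum_nonneg)
  define \<epsilon> where "\<epsilon> = r / (2 * M)"
  have \<epsilon>: "\<epsilon> > 0" "M * \<epsilon> = r / 2" using r M by (auto simp: \<epsilon>_def)
  have lin: "\<bar>\<Sum>l\<in>L. (freq n \<omega> l - \<alpha> l) * h l\<bar> \<le> \<delta> n \<omega> * H" if "\<And>l. l \<in> L \<Longrightarrow> \<bar>h l\<bar> \<le> H" for n \<omega> h H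
  proof -
    have "\<bar>\<Sum>l\<in>L. (freq n \<omega> l - \<alpha> l) * h l\<bar> \<le> (\<Sum>l\<in>L. \<bar>freq n \<omega> l - \<alpha> l\<bar> * H)"
      by (rule sum_abs[THEN order_trans], intro sum_mono) (auto simp: abs_mult intro!: mult_left_mono that)
    then show ?thesis by (simp add: \<delta>_def sum_distrib_right)
  qed
  have lower: "quad (freq n \<omega>) - (\<Sum>l\<in>L. freq n \<omega> l * \<beta> l) \<ge> r - M * \<delta> n \<omega>"
    if w: "\<omega> \<in> assignments L n" and n: "n > 0" for n \<omega>
  proof -
    define f where "f = freq n \<omega>"
    have f1: "(\<Sum>l\<in>L. f l) = 1" unfolding f_def by (rule sum_freq[OF finL w n])
    have "\<bar>quad f - quad \<alpha>\<bar> \<le> (\<Sum>c\<in>J. \<bar>\<kappa> c\<bar> * (F * F)) * \<delta> n \<omega>"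
    proof -
      have "quad f - quad \<alpha> = (\<Sum>c\<in>J. \<kappa> c * ((\<Sum>l\<in>L. f l * \<phi> c l)\<^sup>2 - (\<Sum>l\<in>L. \<alpha> l * \<phi> c l)\<^sup>2) / 2)"
        by (simp add: quad_def right_diff_distrib sum_subtractf diff_divide_distrib sum_divide_distrib)
      also have "\<bar>\<dots>\<bar> \<le> (\<Sum>c\<in>J. \<bar>\<kappa> c\<bar> * (F * F) * \<delta> n \<omega>)"
      proof (rule sum_abs[THEN order_trans], rule sum_mono)
        fix c assume c: "c \<in> J"
        have e: "(\<Sum>l\<in>L. f l * \<phi> c l)\<^sup>2 - (\<Sum>l\<in>L. \<alpha> l * \<phi> c l)\<^sup>2 =
          (\<Sum>l\<in>L. (f l - \<alpha> l) * \<phi> c l) * ((\<Sum>l\<in>L. f l * \<phi> c l) + (\<Sum>l\<in>L. \<alpha> l * \<phi> c l))"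
          by (simp add: left_diff_distrib sum_subtractf power2_eq_square algebra_simps)
        have 1: "\<bar>\<Sum>l\<in>L. (f l - \<alpha> l) * \<phi> c l\<bar> \<le> \<delta> n \<omega> * F" unfolding f_def by (rule lin[OF F(2)[OF c]])
        have av: "\<bar>\<Sum>l\<in>L. p l * \<phi> c l\<bar> \<le> F" if "\<And>l. l \<in> L \<Longrightarrow> p l \<ge> 0" "(\<Sum>l\<in>L. p l) = 1" for p
        proof -
          have "\<bar>\<Sum>l\<in>L. p l * \<phi> c l\<bar> \<le> (\<Sum>l\<in>L. p l * F)"
            by (rule sum_abs[THEN order_trans], intro sum_mono)
               (auto simp: abs_mult that(1) intro!: mult_left_mono F c)
          then show ?thesis by (simp add: that(2) flip: sum_distrib_right)
        qed
        have 2: "\<bar>(\<Sum>l\<in>L. f l * \<phi> c l) + (\<Sum>l\<in>L. \<alpha> l * \<phi> c l)\<bar> \<le> 2 * F"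
          using av[of f] av[of \<alpha>] f1 \<alpha> by (simp add: f_def freq_nonneg abs_le_iff)
        have "\<bar>(\<Sum>l\<in>L. f l * \<phi> c l)\<^sup>2 - (\<Sum>l\<in>L. \<alpha> l * \<phi> c l)\<^sup>2\<bar> \<le> (\<delta> n \<omega> * F) * (2 * F)"
          unfolding e abs_mult using 1 2 F \<delta>0[of n \<omega>] by (intro mult_mono) auto
        then have "\<bar>\<kappa> c\<bar> * \<bar>(\<Sum>l\<in>L. f l * \<phi> c l)\<^sup>2 - (\<Sum>l\<in>L. \<alpha> l * \<phi> c l)\<^sup>2\<bar> \<le> \<bar>\<kappa> c\<bar> * ((\<delta> n \<omega> * F) * (2 * F))"
          by (intro mult_left_mono) auto
        then show "\<bar>\<kappa> c * ((\<Sum>l\<in>L. f l * \<phi> c l)\<^sup>2 - (\<Sum>l\<in>L. \<alpha> l * \<phi> c l)\<^sup>2) / 2\<bar> \<le> \<bar>\<kappa> c\<bar> * (F * F) * \<delta> n \<omega>"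
          by (simp add: abs_mult mult_ac)
      qed
      finally show ?thesis by (simp add: sum_distrib_right)
    qed
    moreover have "\<bar>(\<Sum>l\<in>L. f l * \<beta> l) - KL \<alpha>\<bar> \<le> B * \<delta> n \<omega>"
    proof -
      have "(\<Sum>l\<in>L. f l * \<beta> l) - KL \<alpha> = (\<Sum>l\<in>L. (f l - \<alpha> l) * \<beta> l)"
        by (simp add: KL_def \<beta>_def left_diff_distrib sum_subtractf)
      then show ?thesis using lin[where h = \<beta> and H = B and n = n and \<omega> = \<omega>, OF B(2)]
        by (simp add: f_def mult.commute)
    qed
    moreover have "M * \<delta> n \<omega> = (\<Sum>c\<in>J. \<bar>\<kappa> c\<bar> * (F * F)) * \<delta> n \<omega> + B * \<delta> n \<omega> + \<delta> n \<omega>"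
      by (simp add: M_def distrib_right)
    ultimately show ?thesis using \<delta>0[of n \<omega>] unfolding f_def[symmetric] r_def by linarith
  qed
  \<comment> \<open>Only an inequality: \<open>\<alpha>\<close> may vanish where \<open>w\<close>
    does not, and there the left factor is 0.\<close>
  have wt: "weight w n \<omega> \<ge> weight \<alpha> n \<omega> * exp (- (n * (\<Sum>l\<in>L. freq n \<omega> l * \<beta> l)))"
    if w: "\<omega> \<in> assignments L n" for n \<omega>
  proof -
    have "weight \<alpha> n \<omega> * exp (- (\<Sum>u<n. \<beta> (\<omega> u))) = (\<Prod>u<n. \<alpha> (\<omega> u) * exp (- \<beta> (\<omega> u)))"
      by (simp add: weight_def prod.distrib exp_sum flip: sum_negf)
    also have "\<dots> \<le> (\<Prod>u<n. w (\<omega> u))"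
    proof (rule prod_mono)
      fix u assume "u \<in> {..<n}"
      then have l: "\<omega> u \<in> L" using assignmentsD[OF w] by simp
      show "0 \<le> \<alpha> (\<omega> u) * exp (- \<beta> (\<omega> u)) \<and> \<alpha> (\<omega> u) * exp (- \<beta> (\<omega> u)) \<le> w (\<omega> u)"
        using \<alpha>(1)[OF l] w_pos[OF l] by (cases "\<alpha> (\<omega> u) = 0") (auto simp: \<beta>_def exp_minus)
    qed
    finally show ?thesis unfolding sum_assignment_eq_freq[OF finL w] by (simp add: weight_def)
  qed
  have ED: "(\<lambda>n. (\<Sum>\<omega>\<in>assignments L n. weight \<alpha> n \<omega> * \<delta> n \<omega>)) \<longlonglongrightarrow> 0"
    unfolding \<delta>_def by (rule expected_deviation_tendsto_0[OF finL \<alpha>])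
  \<comment> \<open>Markov's inequality for \<open>\<delta>\<close> under the tilted law, together
    with the typicality of \<Lambda>.\<close>
  have near: "\<forall>\<^sub>F n in sequentially. (\<Sum>\<omega>\<in>{\<omega>\<in>\<Lambda> n. \<delta> n \<omega> \<le> \<epsilon>}. weight \<alpha> n \<omega>) \<ge> 1 / 2"
  proof -
    have "(\<lambda>n. (\<Sum>\<omega>\<in>\<Lambda> n. weight \<alpha> n \<omega>) - (\<Sum>\<omega>\<in>assignments L n. weight \<alpha> n \<omega> * \<delta> n \<omega>) / \<epsilon>) \<longlonglongrightarrow> 1 - 0 / \<epsilon>"
      using \<epsilon>(1) by (intro tendsto_diff tendsto_divide tendsto_const \<Lambda>1 ED) auto
    then have "\<forall>\<^sub>F n in sequentially. 1 / 2 < (\<Sum>\<omega>\<in>\<Lambda> n. weight \<alpha> n \<omega>) - (\<Sum>\<omega>\<in>assignments L n. weight \<alpha> n \<omega> * \<delta> n \<omega>) / \<epsilon>"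
      by (rule order_tendstoD) simp
    then show ?thesis
    proof eventually_elim
      case (elim n)
      have fin: "finite (\<Lambda> n)" using finite_subset[OF \<Lambda>] finL by simp
      have w0: "weight \<alpha> n \<omega> \<ge> 0" if "\<omega> \<in> assignments L n" for \<omega> by (rule weight_nonneg[OF \<alpha>(1) that])
      have "(\<Sum>\<omega>\<in>\<Lambda> n. weight \<alpha> n \<omega>) = (\<Sum>\<omega>\<in>{\<omega>\<in>\<Lambda> n. \<delta> n \<omega> \<le> \<epsilon>}. weight \<alpha> n \<omega>) + (\<Sum>\<omega>\<in>{\<omega>\<in>\<Lambda> n. \<not> \<delta> n \<omega> \<le> \<epsilon>}. weight \<alpha> n \<omega>)"
        using fin by (subst sum.union_disjoint[symmetric]) (auto intro!: sum.cong)
      moreover have "(\<Sum>\<omega>\<in>{\<omega>\<in>\<Lambda> n. \<not> \<delta> n \<omega> \<le> \<epsilon>}. weight \<alpha> n \<omega>) \<le> (\<Sum>\<omega>\<in>assignments L n. weight \<alpha> n \<omega> * \<delta> n \<omega> / \<epsilon>)"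
      proof (rule order_trans[OF sum_mono sum_mono2])
        fix \<omega> assume E: "\<omega> \<in> {\<omega>\<in>\<Lambda> n. \<not> \<delta> n \<omega> \<le> \<epsilon>}"
        then have "weight \<alpha> n \<omega> * 1 \<le> weight \<alpha> n \<omega> * (\<delta> n \<omega> / \<epsilon>)"
          using \<epsilon>(1) \<Lambda>[of n] by (intro mult_left_mono w0) auto
        then show "weight \<alpha> n \<omega> \<le> weight \<alpha> n \<omega> * \<delta> n \<omega> / \<epsilon>" by simp
      qed (use \<epsilon> finL \<Lambda>[of n] w0 \<delta>0 in auto)
      ultimately show ?case using elim by (simp add: sum_divide_distrib)
    qed
  qed
  have bd: "\<forall>\<^sub>F n in sequentially. exp (r / 2 * n) * (1 / (2 * C)) \<le> (\<Sum>\<omega>\<in>\<Lambda> n. weight w n \<omega> * lr n \<omega>)"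
    using C(2) near
  proof eventually_elim
    case (elim n)
    have n: "n > 0" using elim by blast
    let ?E = "{\<omega>\<in>\<Lambda> n. \<delta> n \<omega> \<le> \<epsilon>}"
    have lr: "lr n \<omega> = lr_rest n \<omega> * exp (n * quad (freq n \<omega>))" for \<omega> by (simp add: lr_rest_def)
    have "exp (r / 2 * n) * (1 / C) * (1 / 2) \<le> exp (r / 2 * n) * (1 / C) * (\<Sum>\<omega>\<in>?E. weight \<alpha> n \<omega>)"
      using elim(2) C(1) by (intro mult_left_mono) auto
    also have "\<dots> = (\<Sum>\<omega>\<in>?E. weight \<alpha> n \<omega> * exp (r / 2 * n) * (1 / C))"
      by (simp add: sum_distrib_left mult_ac)
    also have "\<dots> \<le> (\<Sum>\<omega>\<in>?E. weight w n \<omega> * lr n \<omega>)"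
    proof (rule sum_mono)
      fix \<omega> assume E: "\<omega> \<in> ?E"
      then have w: "\<omega> \<in> assignments L n" using \<Lambda> by blast
      define x where "x = (\<Sum>l\<in>L. freq n \<omega> l * \<beta> l)"
      have "M * \<delta> n \<omega> \<le> M * \<epsilon>" using E M by (intro mult_left_mono) auto
      then have "quad (freq n \<omega>) - x \<ge> r / 2" using lower[OF w n] \<epsilon>(2) unfolding x_def by linarith
      then have "real n * (r / 2) \<le> n * (quad (freq n \<omega>) - x)" by (intro mult_left_mono) auto
      then have "exp (r / 2 * n) \<le> exp (- (n * x)) * exp (n * quad (freq n \<omega>))"
        unfolding mult_exp_exp by (simp add: algebra_simps)
      then have "weight \<alpha> n \<omega> * exp (r / 2 * n) * (1 / C) \<le>
        weight \<alpha> n \<omega> * (exp (- (n * x)) * exp (n * quad (freq n \<omega>))) * lr_rest n \<omega>"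
        using elim(1) w C(1) weight_nonneg[OF \<alpha>(1) w] by (intro mult_mono mult_nonneg_nonneg) auto
      also have "\<dots> = weight \<alpha> n \<omega> * exp (- (n * x)) * lr n \<omega>" by (simp add: lr)
      also have "\<dots> \<le> weight w n \<omega> * lr n \<omega>"
        using wt[OF w] elim(1) w by (intro mult_right_mono) (auto simp: lr x_def less_imp_le)
      finally show "weight \<alpha> n \<omega> * exp (r / 2 * n) * (1 / C) \<le> weight w n \<omega> * lr n \<omega>" .
    qed
    also have "\<dots> \<le> (\<Sum>\<omega>\<in>\<Lambda> n. weight w n \<omega> * lr n \<omega>)"
    proof (rule sum_mono2)
      show "finite (\<Lambda> n)" using finite_subset[OF \<Lambda>] finL by simp
      fix \<omega> assume "\<omega> \<in> \<Lambda> n - ?E"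
      then have w: "\<omega> \<in> assignments L n" using \<Lambda> by blast
      then show "0 \<le> weight w n \<omega> * lr n \<omega>"
        using elim(1) weight_nonneg[OF w_nonneg w] by (simp add: lr less_imp_le)
    qed auto
    finally show ?case by simp
  qed
  have "filterlim (\<lambda>n. r / 2 * real n) at_top sequentially"
    using r by (intro filterlim_tendsto_pos_mult_at_top[OF tendsto_const _ filterlim_real_sequentially]) auto
  then have "filterlim (\<lambda>n. exp (r / 2 * real n)) at_top sequentially"
    by (rule filterlim_compose[OF exp_at_top])
  then have "filterlim (\<lambda>n. exp (r / 2 * real n) * (1 / (2 * C))) at_top sequentially"
    using C(1) by (intro filterlim_at_top_mult_tendsto_pos[OF tendsto_const]) auto
  then show ?thesis by (rule filterlim_at_top_mono[OF _ bd])
qed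

end

section \<open>Relative entropy: continuity, positivity and second order\<close>

lemma continuous_on_xlnx: "continuous_on {0..} (\<lambda>x::real. x * ln x)"
  unfolding continuous_on_eq_continuous_within
proof
  fix x :: real assume x: "x \<in> {0..}"
  show "continuous (at x within {0..}) (\<lambda>x. x * ln x)"
  proof (cases "x = 0")
    case False
    then have "isCont (\<lambda>x. x * ln x) x" using x by (intro continuous_intros) auto
    then show ?thesis by (rule continuous_at_imp_continuous_at_within)
  next
    case True
    \<comment> \<open>Near 0 this rests on ln (1 / sqrt y) <= 1 / sqrt y; the term y^2 covers large
      y.\<close>
    have bd: "\<bar>y * ln y\<bar> \<le> 2 * sqrt y + y\<^sup>2" if "y \<ge> 0" for y :: real
    proof (cases "y = 0")
      case False
      then have y: "y > 0" using that by simp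
      have "ln y \<le> y" using ln_le_minus_one[OF y] by linarith
      then have 1: "y * ln y \<le> y\<^sup>2" using y by (simp add: power2_eq_square)
      have "ln (1 / sqrt y) \<le> 1 / sqrt y" using ln_le_minus_one[of "1 / sqrt y"] y by simp
      then have "- ln y \<le> 2 / sqrt y" using y by (simp add: ln_div ln_sqrt)
      then have "y * (- ln y) \<le> y * (2 / sqrt y)" using y by (intro mult_left_mono) auto
      also have "\<dots> = 2 * (y / sqrt y)" by simp
      also have "y / sqrt y = sqrt y" using y by (intro real_div_sqrt) simp
      finally have 2: "- (y * ln y) \<le> 2 * sqrt y" by simp
      have "sqrt y \<ge> 0" "y\<^sup>2 \<ge> 0" using y by auto
      then show ?thesis using 1 2 by linarith
    qed simp
    have "((\<lambda>y. 2 * sqrt y + y\<^sup>2) \<longlongrightarrow> 2 * sqrt 0 + 0\<^sup>2) (at 0 within {0..})"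
      by (intro tendsto_intros)
    then have lim: "((\<lambda>y. 2 * sqrt y + y\<^sup>2) \<longlongrightarrow> 0) (at 0 within {0::real..})" by simp
    have "((\<lambda>y. y * ln y) \<longlongrightarrow> 0) (at 0 within {0::real..})"
      by (rule Lim_null_comparison[OF _ lim])
         (auto simp: eventually_at_filter bd intro!: always_eventually)
    then show ?thesis using True by (simp add: continuous_within)
  qed
qed

context kernel_model
begin

text \<open>Gibbs' inequality term by term: \<alpha> ln (\<alpha> / w) >= \<alpha> - w, strictly
  unless \<alpha> = w, and the right-hand sides sum to 0.\<close>

lemma KL_pos:
  assumes \<alpha>: "\<And>l. l \<in> L \<Longrightarrow> \<alpha> l \<ge> 0" "(\<Sum>l\<in>L. \<alpha> l) = 1" and ne: "\<exists>l\<in>L. \<alpha> l \<noteq> w l"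
  shows "KL \<alpha> > 0"
proof -
  have tm: "\<alpha> l * ln (\<alpha> l / w l) \<ge> \<alpha> l - w l \<and> (\<alpha> l \<noteq> w l \<longrightarrow> \<alpha> l * ln (\<alpha> l / w l) > \<alpha> l - w l)"
    if l: "l \<in> L" for l
  proof (cases "\<alpha> l = 0")
    case True then show ?thesis using w_pos[OF l] by simp
  next
    case False
    then have a: "\<alpha> l > 0" using \<alpha>(1)[OF l] by simp
    define x where "x = w l / \<alpha> l"
    have x: "x > 0" using a w_pos[OF l] by (simp add: x_def)
    have lnx: "ln (\<alpha> l / w l) = - ln x" using a w_pos[OF l] by (simp add: x_def ln_div)
    have ax: "\<alpha> l * (1 - x) = \<alpha> l - w l" using a by (simp add: x_def algebra_simps)
    have "\<alpha> l * (1 - x) \<le> \<alpha> l * (- ln x)" using a ln_le_minus_one[OF x] by (intro mult_left_mono) auto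
    moreover have "\<alpha> l * (1 - x) < \<alpha> l * (- ln x)" if "\<alpha> l \<noteq> w l"
    proof -
      have "x \<noteq> 1" using that a by (auto simp: x_def)
      then have "ln x \<noteq> x - 1" using ln_eq_minus_one[OF x] by auto
      then show ?thesis using a ln_le_minus_one[OF x] by (intro mult_strict_left_mono) auto
    qed
    ultimately show ?thesis by (simp add: lnx ax)
  qed
  have "(\<Sum>l\<in>L. \<alpha> l - w l) < KL \<alpha>"
    unfolding KL_def using ne tm by (intro sum_strict_mono_ex1[OF finL]) auto
  then show ?thesis using \<alpha>(2) w_sum by (simp add: sum_subtractf)
qed

lemma KL_w: "KL w = 0" and quad_w: "quad w = 0"
proof -
  show "KL w = 0" unfolding KL_def using w_pos by (intro sum.neutral ballI) (force simp: less_imp_neq[symmetric])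
  show "quad w = 0" unfolding quad_def by (simp add: mean)
qed

text \<open>Along \<open>w * (1 + t * \<phi> c)\<close> the quadratic form is exactly \<kappa> t^2 /
  2 and the entropy at most t^2 / 2 + O(t^3). Dividing by t^2 and letting t decrease to 0 gives the
  bound.\<close>

lemma kappa_le:
  assumes c: "c \<in> J" and r: "r \<ge> 0"
    and le: "\<And>t. (\<And>l. l \<in> L \<Longrightarrow> \<bar>t * \<phi> c l\<bar> \<le> 1 / 2) \<Longrightarrow> quad (\<lambda>l. w l * (1 + t * \<phi> c l)) \<le> r * KL (\<lambda>l. w l * (1 + t * \<phi> c l))"
  shows "\<kappa> c \<le> r"
proof -
  obtain F where F: "F > 0" "\<And>c l. c \<in> J \<Longrightarrow> l \<in> L \<Longrightarrow> \<bar>\<phi> c l\<bar> \<le> F" using phi_bounded by blast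
  have main: "\<kappa> c \<le> r + 8 * r * F ^ 3 * t" if t: "t > 0" "t * F \<le> 1 / 2" for t
  proof -
    define x where "x l = t * \<phi> c l" for l
    have xb: "\<bar>x l\<bar> \<le> t * F" if "l \<in> L" for l
      using t F(2)[OF c that] by (simp add: x_def abs_mult)
    then have xb2: "\<bar>x l\<bar> \<le> 1 / 2" if "l \<in> L" for l using t that by fastforce
    have sx: "(\<Sum>l\<in>L. w l * x l) = 0"
      using mean[OF c] by (simp add: x_def mult.left_commute[of _ t] flip: sum_distrib_left)
    have sx2: "(\<Sum>l\<in>L. w l * (x l)\<^sup>2) = t\<^sup>2"
    proof -
      have "(\<Sum>l\<in>L. w l * (x l)\<^sup>2) = t\<^sup>2 * (\<Sum>l\<in>L. w l * \<phi> c l * \<phi> c l)"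
        by (simp add: x_def power2_eq_square sum_distrib_left mult_ac)
      then show ?thesis by (simp add: ortho[OF c c])
    qed
    have q: "quad (\<lambda>l. w l * (1 + t * \<phi> c l)) = \<kappa> c * t\<^sup>2 / 2"
    proof -
      have "(\<Sum>l\<in>L. w l * (1 + t * \<phi> c l) * \<phi> c' l) = (if c' = c then t else 0)" if c': "c' \<in> J" for c'
      proof -
        have "(\<Sum>l\<in>L. w l * (1 + t * \<phi> c l) * \<phi> c' l) = (\<Sum>l\<in>L. w l * \<phi> c' l) + t * (\<Sum>l\<in>L. w l * \<phi> c l * \<phi> c' l)"
          by (simp add: sum_distrib_left algebra_simps sum.distrib)
        then show ?thesis using c c' by (simp add: mean ortho)
      qed
      then have "quad (\<lambda>l. w l * (1 + t * \<phi> c l)) = (\<Sum>c'\<in>J. \<kappa> c' * (if c' = c then t else 0)\<^sup>2) / 2"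
        unfolding quad_def by (intro arg_cong2[where f = "(/)"] sum.cong) auto
      also have "(\<Sum>c'\<in>J. \<kappa> c' * (if c' = c then t else 0)\<^sup>2) = (\<Sum>c'\<in>J. if c' = c then \<kappa> c' * t\<^sup>2 else 0)"
        by (intro sum.cong) auto
      finally show ?thesis using c finJ by simp
    qed
    \<comment> \<open>The coefficient 1/2 of the square must be sharp, since it is compared with
      \<kappa> / 2; the cubic constant is crude.\<close>
    have tm: "(1 + y) * ln (1 + y) \<le> y + y\<^sup>2 / 2 + 4 * \<bar>y\<bar> ^ 3" if y: "\<bar>y\<bar> \<le> 1 / 2" for y :: real
    proof -
      have "ln (1 + y) \<le> y - y\<^sup>2 / 2 + 2 * \<bar>y\<bar> ^ 3" using abs_ln_one_plus_cubic[OF y] by linarith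
      then have "(1 + y) * ln (1 + y) \<le> (1 + y) * (y - y\<^sup>2 / 2 + 2 * \<bar>y\<bar> ^ 3)"
        using y by (intro mult_left_mono) auto
      also have "\<dots> = y + y\<^sup>2 / 2 - y ^ 3 / 2 + 2 * \<bar>y\<bar> ^ 3 * (1 + y)"
        by (simp add: field_simps power2_eq_square power3_eq_cube)
      also have "\<dots> \<le> y + y\<^sup>2 / 2 + \<bar>y\<bar> ^ 3 / 2 + 2 * \<bar>y\<bar> ^ 3 * (3 / 2)"
      proof -
        have "2 * \<bar>y\<bar> ^ 3 * (1 + y) \<le> 2 * \<bar>y\<bar> ^ 3 * (3 / 2)" using y by (intro mult_left_mono) auto
        moreover have "- (y ^ 3) \<le> \<bar>y\<bar> ^ 3" by (metis abs_ge_minus_self power_abs)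
        ultimately show ?thesis by linarith
      qed
      finally have "(1 + y) * ln (1 + y) \<le> y + y\<^sup>2 / 2 + \<bar>y\<bar> ^ 3 / 2 + 2 * \<bar>y\<bar> ^ 3 * (3 / 2)" .
      moreover have "\<bar>y\<bar> ^ 3 \<ge> 0" by simp
      ultimately show ?thesis by linarith
    qed
    have K: "KL (\<lambda>l. w l * (1 + t * \<phi> c l)) \<le> t\<^sup>2 / 2 + 4 * (t * F) ^ 3"
    proof -
      have "KL (\<lambda>l. w l * (1 + t * \<phi> c l)) = (\<Sum>l\<in>L. w l * ((1 + x l) * ln (1 + x l)))"
        unfolding KL_def x_def using w_pos by (intro sum.cong) (force simp: less_imp_neq[symmetric])+
      also have "\<dots> \<le> (\<Sum>l\<in>L. w l * (x l + (x l)\<^sup>2 / 2 + 4 * (t * F) ^ 3))"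
      proof (intro sum_mono mult_left_mono w_nonneg)
        fix l assume l: "l \<in> L"
        have "\<bar>x l\<bar> ^ 3 \<le> (t * F) ^ 3" by (intro power_mono xb l) auto
        then show "(1 + x l) * ln (1 + x l) \<le> x l + (x l)\<^sup>2 / 2 + 4 * (t * F) ^ 3"
          using tm[OF xb2[OF l]] by linarith
      qed
      also have "\<dots> = (\<Sum>l\<in>L. w l * x l) + (\<Sum>l\<in>L. w l * (x l)\<^sup>2) / 2 + (\<Sum>l\<in>L. w l) * (4 * (t * F) ^ 3)"
        by (simp add: distrib_left sum.distrib sum_distrib_right sum_divide_distrib)
      finally show ?thesis by (simp add: sx sx2 w_sum)
    qed
    have "quad (\<lambda>l. w l * (1 + t * \<phi> c l)) \<le> r * KL (\<lambda>l. w l * (1 + t * \<phi> c l))"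
      by (rule le) (use xb2 in \<open>simp add: x_def\<close>)
    also have "\<dots> \<le> r * (t\<^sup>2 / 2 + 4 * (t * F) ^ 3)" using K r by (intro mult_left_mono)
    also have "\<dots> = (r + 8 * r * F ^ 3 * t) * t\<^sup>2 / 2"
      by (simp add: field_simps power2_eq_square power3_eq_cube)
    finally show ?thesis using t(1) by (simp add: q)
  qed
  have ev: "\<forall>\<^sub>F t in at_right 0. \<kappa> c \<le> r + 8 * r * F ^ 3 * t"
    unfolding eventually_at_right_field
  proof (intro exI[of _ "1 / (2 * F)"] conjI allI impI)
    show "0 < 1 / (2 * F)" using F(1) by simp
    fix t assume t: "0 < t" "t < 1 / (2 * F)"
    then have "t * F \<le> 1 / 2" using F(1) by (simp add: field_simps)
    then show "\<kappa> c \<le> r + 8 * r * F ^ 3 * t" by (intro main t(1))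
  qed
  have "((\<lambda>t. r + 8 * r * F ^ 3 * t) \<longlongrightarrow> r + 8 * r * F ^ 3 * 0) (at_right 0)"
    by (intro tendsto_intros)
  from tendsto_lowerbound[OF this ev] show ?thesis by simp
qed

text \<open>The function \<open>g\<close> measures how far the marginals are from \<open>\<pi>\<close>. The positive minimum of
  \<open>max g (KL - quad)\<close> on the compact set of laws away from \<open>w\<close> is the required gap.\<close>

lemma coupling_gap:
  assumes g_cont: "continuous_on UNIV g" and \<epsilon>: "\<epsilon> > 0" and r: "r < 1"
    and le: "\<And>\<alpha>. (\<And>l. l \<in> L \<Longrightarrow> \<alpha> l \<ge> 0) \<Longrightarrow> (\<Sum>l\<in>L. \<alpha> l) = 1 \<Longrightarrow> g \<alpha> \<le> 0 \<Longrightarrow> quad \<alpha> \<le> r * KL \<alpha>"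
  obtains \<eta> where "\<eta> > 0" "\<And>n \<omega>. \<omega> \<in> assignments L n \<Longrightarrow> n > 0 \<Longrightarrow> dev n \<omega> > \<epsilon> \<Longrightarrow>
    g (freq n \<omega>) < \<eta> \<Longrightarrow> KL (freq n \<omega>) - quad (freq n \<omega>) \<ge> \<eta>"
proof -
  define Y where "Y = {f :: 'a \<Rightarrow> real. (\<forall>i\<in>L. f i \<in> {0..1}) \<and> (\<forall>i. i \<notin> L \<longrightarrow> f i = 0)}
    \<inter> ({f. (\<Sum>l\<in>L. f l) = 1} \<inter> {f. \<epsilon> \<le> (\<Sum>l\<in>L. \<bar>f l - w l\<bar>)})"
  define G where "G f = max (g f) (KL f - quad f)" for f
  have cont: "continuous_on UNIV (\<lambda>f :: 'a \<Rightarrow> real. f i)" for i by simp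
  have Y: "compact Y" unfolding Y_def
    by (intro compact_Int_closed compact_box closed_Int closed_Collect_eq closed_Collect_le continuous_intros cont)
  have KL_cont: "continuous_on Y KL"
  proof -
    \<comment> \<open>Positivity of \<open>w\<close> reduces the entropy to x ln x, which is
      continuous up to the boundary of the simplex.\<close>
    have "continuous_on Y (\<lambda>f. \<Sum>l\<in>L. w l * (f l / w l * ln (f l / w l)))"
    proof (intro continuous_on_sum continuous_on_mult_left)
      fix l assume l: "l \<in> L"
      have "continuous_on Y (\<lambda>f. f l / w l)"
        using w_pos[OF l] by (intro continuous_intros continuous_on_subset[OF cont]) auto
      moreover have "(\<lambda>f. f l / w l) ` Y \<subseteq> {0..}"
        using l w_pos[OF l] by (auto simp: Y_def)
      ultimately show "continuous_on Y (\<lambda>f. f l / w l * ln (f l / w l))"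
        by (rule continuous_on_compose2[OF continuous_on_xlnx])
    qed
    moreover have "(\<Sum>l\<in>L. w l * (f l / w l * ln (f l / w l))) = KL f" for f
      unfolding KL_def using w_pos by (intro sum.cong) (force simp: less_imp_neq[symmetric])+
    ultimately show ?thesis by simp
  qed
  have G_cont: "continuous_on Y G" unfolding G_def quad_def
    by (intro continuous_intros KL_cont continuous_on_subset[OF g_cont] continuous_on_subset[OF cont]) auto
  have G_pos: "G f > 0" if f: "f \<in> Y" for f
  proof (cases "g f \<le> 0")
    case True
    have f': "\<And>l. l \<in> L \<Longrightarrow> f l \<ge> 0" "(\<Sum>l\<in>L. f l) = 1" using f by (auto simp: Y_def)
    have "\<exists>l\<in>L. f l \<noteq> w l"
    proof (rule ccontr)
      assume "\<not> (\<exists>l\<in>L. f l \<noteq> w l)"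
      then have "(\<Sum>l\<in>L. \<bar>f l - w l\<bar>) = 0" by (intro sum.neutral) auto
      then show False using f \<epsilon> by (simp add: Y_def)
    qed
    from KL_pos[OF f' this] have "KL f > 0" .
    then have "r * KL f < 1 * KL f" using r by (intro mult_strict_right_mono)
    then have "quad f < KL f" using le[OF f' True] by simp
    then show ?thesis by (simp add: G_def less_max_iff_disj)
  qed (simp add: G_def less_max_iff_disj)
  have in_Y: "freq n \<omega> \<in> Y" if w: "\<omega> \<in> assignments L n" and n: "n > 0" and dev: "dev n \<omega> > \<epsilon>" for n \<omega>
  proof -
    have s: "(\<Sum>l\<in>L. freq n \<omega> l) = 1" by (rule sum_freq[OF finL w n])
    have "freq n \<omega> l \<le> 1" if "l \<in> L" for l
      using s member_le_sum[of l L "freq n \<omega>"] that finL by (simp add: freq_nonneg)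
    moreover have "freq n \<omega> l = 0" if "l \<notin> L" for l
    proof -
      have "{u. u < n \<and> \<omega> u = l} = {}" using assignmentsD[OF w] that by auto
      then show ?thesis by (simp add: freq_def)
    qed
    ultimately show ?thesis using s dev by (auto simp: Y_def freq_nonneg dev_def)
  qed
  show thesis
  proof (cases "Y = {}")
    case True
    \<comment> \<open>No empirical law lies that far from \<open>w\<close>, so any positive constant
      serves.\<close>
    then show thesis using in_Y that[of 1] by auto
  next
    case False
    then obtain f0 where f0: "f0 \<in> Y" "\<And>f. f \<in> Y \<Longrightarrow> G f0 \<le> G f"
      using continuous_attains_inf[OF Y _ G_cont] by blast
    show thesis
    proof (rule that)
      show "G f0 > 0" by (rule G_pos[OF f0(1)])
      fix n \<omega> assume "\<omega> \<in> assignments L n" "n > 0" "dev n \<omega> > \<epsilon>" "g (freq n \<omega>) < G f0"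
      then show "KL (freq n \<omega>) - quad (freq n \<omega>) \<ge> G f0"
        using f0(2)[OF in_Y] by (fastforce simp: G_def le_max_iff_disj)
    qed
  qed
qed

end

section \<open>The second moment as a sum over pairs of labellings\<close>

text \<open>Identifies the Radon-Nikodym derivative as a ratio of mass functions; the inclusion of
  supports excludes mass of \<open>P\<close> where the denominator is 0.\<close>

lemma density_pmf_ratio:
  assumes "set_pmf P \<subseteq> set_pmf Q"
  shows "density (measure_pmf Q) (\<lambda>x. ennreal (pmf P x / pmf Q x)) = measure_pmf P"
proof (rule measure_eqI)
  fix A assume "A \<in> sets (density (measure_pmf Q) (\<lambda>x. ennreal (pmf P x / pmf Q x)))"
  have *: "ennreal (pmf Q x) * (ennreal (pmf P x / pmf Q x) * indicator A x) = ennreal (pmf P x) * indicator A x" for x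
  proof (cases "x \<in> set_pmf Q")
    case True
    then have "pmf Q x > 0" by (simp add: pmf_positive)
    then show ?thesis by (simp add: mult.assoc[symmetric] flip: ennreal_mult)
  next
    case False
    then have "pmf P x = 0" using assms by (auto simp: set_pmf_iff)
    then show ?thesis by simp
  qed
  have "emeasure (density (measure_pmf Q) (\<lambda>x. ennreal (pmf P x / pmf Q x))) A
      = (\<integral>\<^sup>+x. ennreal (pmf P x / pmf Q x) * indicator A x \<partial>measure_pmf Q)"
    by (simp add: emeasure_density)
  also have "\<dots> = (\<integral>\<^sup>+x. indicator A x \<partial>measure_pmf P)"
    by (simp add: nn_integral_measure_pmf *)
  finally show "emeasure (density (measure_pmf Q) (\<lambda>x. ennreal (pmf P x / pmf Q x))) A = emeasure (measure_pmf P) A"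
    by simp
qed simp

lemma second_moment_finite:
  assumes sub: "set_pmf P \<subseteq> set_pmf Q" and fin: "finite (set_pmf Q)"
  shows "second_moment P Q = ennreal (\<Sum>x\<in>set_pmf Q. (pmf P x)\<^sup>2 / pmf Q x)"
proof -
  have "AE x in measure_pmf Q. ennreal (pmf P x / pmf Q x) = RN_deriv (measure_pmf Q) (measure_pmf P) x"
    by (rule sigma_finite_measure.RN_deriv_unique)
       (auto simp: density_pmf_ratio[OF sub] intro: prob_space_imp_sigma_finite measure_pmf.prob_space_axioms)
  then have "second_moment P Q = (\<integral>\<^sup>+x. (ennreal (pmf P x / pmf Q x))\<^sup>2 \<partial>measure_pmf Q)"
    unfolding second_moment_def by (intro nn_integral_cong_AE) (auto elim: eventually_mono)
  also have "\<dots> = (\<Sum>x\<in>set_pmf Q. (ennreal (pmf P x / pmf Q x))\<^sup>2 * ennreal (pmf Q x))"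
    by (simp add: nn_integral_measure_pmf_finite[OF fin])
  also have "\<dots> = (\<Sum>x\<in>set_pmf Q. ennreal ((pmf P x)\<^sup>2 / pmf Q x))"
  proof (rule sum.cong)
    fix x assume "x \<in> set_pmf Q"
    then have "pmf Q x > 0" by (simp add: pmf_positive)
    then show "(ennreal (pmf P x / pmf Q x))\<^sup>2 * ennreal (pmf Q x) = ennreal ((pmf P x)\<^sup>2 / pmf Q x)"
      by (simp add: ennreal_power flip: ennreal_mult) (simp add: power2_eq_square)
  qed simp
  also have "\<dots> = ennreal (\<Sum>x\<in>set_pmf Q. (pmf P x)\<^sup>2 / pmf Q x)"
    by (simp add: sum_ennreal)
  finally show ?thesis .
qed

text \<open>Product mass functions live on functions with a default value outside the index set;
  reindexing to extensional functions gives the usual distributive law.\<close>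

lemma sum_prod_PiE_dflt:
  fixes f :: "'a \<Rightarrow> 'b \<Rightarrow> 'c::comm_semiring_1"
  assumes V: "finite V" and B: "finite B"
  shows "(\<Sum>G\<in>PiE_dflt V dflt (\<lambda>_. B). \<Prod>e\<in>V. f e (G e)) = (\<Prod>e\<in>V. \<Sum>b\<in>B. f e b)"
proof -
  have "(\<Prod>e\<in>V. \<Sum>b\<in>B. f e b) = (\<Sum>G\<in>PiE V (\<lambda>_. B). \<Prod>e\<in>V. f e (G e))"
    by (rule prod_sum_PiE) (use V B in auto)
  also have "\<dots> = (\<Sum>G\<in>PiE_dflt V dflt (\<lambda>_. B). \<Prod>e\<in>V. f e (G e))"
    by (rule sum.reindex_bij_witness[of _ "\<lambda>h. restrict h V" "\<lambda>h x. if x \<in> V then h x else dflt"])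
       (auto simp: PiE_dflt_def PiE_def extensional_def fun_eq_iff intro!: prod.cong)
  finally show ?thesis by simp
qed

section \<open>Reduction of the block model to pairs of labellings\<close>

definition balanced_labels :: "nat \<Rightarrow> nat pmf \<Rightarrow> nat \<Rightarrow> real \<Rightarrow> (nat \<Rightarrow> nat) \<Rightarrow> bool" where
  "balanced_labels s \<pi> n a \<sigma> \<longleftrightarrow> (\<forall>i<s. \<bar>real (card {u. u < n \<and> \<sigma> u = i}) - real n * pmf \<pi> i\<bar> \<le> a)"

lemma balanced_labels_cong:
  "(\<And>u. u < n \<Longrightarrow> \<sigma> u = \<tau> u) \<Longrightarrow> balanced_labels s \<pi> n a \<sigma> = balanced_labels s \<pi> n a \<tau>"
proof -
  assume "\<And>u. u < n \<Longrightarrow> \<sigma> u = \<tau> u"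
  then have "{u. u < n \<and> \<sigma> u = i} = {u. u < n \<and> \<tau> u = i}" for i by auto
  then show ?thesis by (simp add: balanced_labels_def)
qed

text \<open>Two conditioned labellings are packed into one assignment with labels in the square of
  the support, so that the kernel model applies.\<close>

definition balanced_pairs :: "nat \<Rightarrow> nat pmf \<Rightarrow> nat \<Rightarrow> real \<Rightarrow> (nat \<Rightarrow> nat \<times> nat) set" where
  "balanced_pairs s \<pi> n a = {\<omega> \<in> assignments (set_pmf \<pi> \<times> set_pmf \<pi>) n.
     balanced_labels s \<pi> n a (\<lambda>u. fst (\<omega> u)) \<and> balanced_labels s \<pi> n a (\<lambda>u. snd (\<omega> u))}"

text \<open>The contribution of one edge: under the reference law each likelihood ratio has mean 1,
  so only the product of the two centred parts survives.\<close>

lemma sum_bernoulli_ratio: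
  assumes "0 < q" "q < 1" "0 \<le> p" "p \<le> 1" "0 \<le> p'" "p' \<le> 1"
  shows "(\<Sum>b\<in>UNIV. pmf (bernoulli_pmf p) b * pmf (bernoulli_pmf p') b / pmf (bernoulli_pmf q) b) =
    1 + (p - q) * (p' - q) / (q * (1 - q))"
proof -
  have "(\<Sum>b\<in>UNIV. pmf (bernoulli_pmf p) b * pmf (bernoulli_pmf p') b / pmf (bernoulli_pmf q) b) =
    p * p' / q + (1 - p) * (1 - p') / (1 - q)"
    using assms by (simp add: UNIV_bool)
  also have "\<dots> = 1 + (p - q) * (p' - q) / (q * (1 - q))"
    using assms by (simp add: field_simps)
  finally show ?thesis .
qed

text \<open>The square of a mixture over labellings is a mixture over pairs of them. For a fixed
  pair the sum over graphs factors over the edges, and the conditioning contributes the square of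
  its probability in the denominator. The bounds by \<open>n\<close> exclude truncated Bernoulli
  parameters.\<close>

lemma second_moment_sbm:
  fixes M :: "real mat"
  assumes pi: "set_pmf \<pi> \<subseteq> {..<s}"
    and M_nonneg: "\<And>i j. i < s \<Longrightarrow> j < s \<Longrightarrow> M $$ (i, j) \<ge> 0"
    and M_le: "\<And>i j. i < s \<Longrightarrow> j < s \<Longrightarrow> M $$ (i, j) \<le> n"
    and d: "d > 0" "d < real n"
    and pos: "(\<Sum>\<omega>\<in>balanced_pairs s \<pi> n a. weight (\<lambda>(i, j). pmf \<pi> i * pmf \<pi> j) n \<omega>) > 0"
  shows "second_moment (sbm_cond s M \<pi> n a) (erdos_renyi n (d / real n)) = ennreal (
    (\<Sum>\<omega>\<in>balanced_pairs s \<pi> n a. weight (\<lambda>(i, j). pmf \<pi> i * pmf \<pi> j) n \<omega> *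
      (\<Prod>(u, v)\<in>vertex_pairs n. 1 + (M $$ (fst (\<omega> u), fst (\<omega> v)) - d) * (M $$ (snd (\<omega> u), snd (\<omega> v)) - d) / d / (n - d)))
    / (\<Sum>\<omega>\<in>balanced_pairs s \<pi> n a. weight (\<lambda>(i, j). pmf \<pi> i * pmf \<pi> j) n \<omega>))"
proof -
  define S where "S = set_pmf \<pi>"
  define V where "V = vertex_pairs n"
  define q where "q = d / real n"
  have q: "0 < q" "q < 1" using d by (auto simp: q_def)
  have finS: "finite S" unfolding S_def using pi finite_subset by blast
  have finV: "finite V" by (simp add: V_def)
  define Lab where "Lab = PiE_dflt {..<n} 0 (\<lambda>_. S)"
  define X where "X = {\<sigma>\<in>Lab. balanced_labels s \<pi> n a \<sigma>}"
  have finLab: "finite Lab" unfolding Lab_def using finS by (intro finite_PiE_dflt) auto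
  then have finX: "finite X" by (simp add: X_def)
  define Gr where "Gr = PiE_dflt V False (\<lambda>_. UNIV :: bool set)"
  have finGr: "finite Gr" unfolding Gr_def using finV by (intro finite_PiE_dflt) auto
  define p where "p = Pi_pmf {..<n} 0 (\<lambda>_. \<pi>)"
  define W where "W \<sigma> = Pi_pmf V False (\<lambda>(u, v). bernoulli_pmf (M $$ (\<sigma> u, \<sigma> v) / real n))" for \<sigma> :: "nat \<Rightarrow> nat"
  define R where "R = erdos_renyi n q"
  have set_p: "set_pmf p = Lab" unfolding p_def Lab_def S_def by (subst set_Pi_pmf) auto
  have set_R: "set_pmf R = Gr"
    unfolding R_def erdos_renyi_def Gr_def V_def using q by (subst set_Pi_pmf) (auto simp: set_pmf_bernoulli)
  have set_W: "set_pmf (W \<sigma>) \<subseteq> Gr" for \<sigma>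
    unfolding W_def Gr_def using finV by (subst set_Pi_pmf) (auto simp: PiE_dflt_def)
  have sbm: "sbm n M \<pi> = bind_pmf p (\<lambda>\<sigma>. map_pmf (\<lambda>G. (G, \<sigma>)) (W \<sigma>))"
    by (simp add: sbm_def p_def W_def V_def)
  have pmf_sbm: "pmf (sbm n M \<pi>) (G, \<sigma>) = pmf p \<sigma> * pmf (W \<sigma>) G" for G \<sigma>
  proof -
    have "pmf (map_pmf (\<lambda>G. (G, \<sigma>')) (W \<sigma>')) (G, \<sigma>) = indicator {\<sigma>} \<sigma>' * pmf (W \<sigma>) G" for \<sigma>'
    proof (cases "\<sigma>' = \<sigma>")
      case True
      have "pmf (map_pmf (\<lambda>G. (G, \<sigma>)) (W \<sigma>)) (G, \<sigma>) = pmf (W \<sigma>) G"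
        by (rule pmf_map_inj') (auto simp: inj_def)
      then show ?thesis using True by simp
    next
      case False
      then show ?thesis by (auto simp: pmf_eq_0_set_pmf)
    qed
    then show ?thesis by (simp add: sbm pmf_bind measure_pmf_single)
  qed
  have bal: "balanced s \<pi> n a = snd -` {\<sigma>. balanced_labels s \<pi> n a \<sigma>}"
    by (auto simp: balanced_def balanced_labels_def)
  have snd_sbm: "map_pmf snd (sbm n M \<pi>) = p"
    unfolding sbm map_bind_pmf pmf.map_comp by (simp add: o_def bind_return_pmf')
  define Z where "Z = (\<Sum>\<sigma>\<in>X. pmf p \<sigma>)"
  have Z: "measure (sbm n M \<pi>) (balanced s \<pi> n a) = Z"
  proof -
    have "measure (sbm n M \<pi>) (balanced s \<pi> n a) = measure p {\<sigma>. balanced_labels s \<pi> n a \<sigma>}"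
      unfolding bal snd_sbm[symmetric] by simp
    also have "\<dots> = measure p X"
    proof -
      have "measure p {\<sigma>. balanced_labels s \<pi> n a \<sigma>} = measure p ({\<sigma>. balanced_labels s \<pi> n a \<sigma>} \<inter> set_pmf p)"
        by (simp add: measure_Int_set_pmf)
      also have "{\<sigma>. balanced_labels s \<pi> n a \<sigma>} \<inter> set_pmf p = X" by (auto simp: X_def set_p)
      finally show ?thesis .
    qed
    also have "\<dots> = Z" unfolding Z_def by (rule measure_measure_pmf_finite[OF finX])
    finally show ?thesis .
  qed
  let ?wt = "\<lambda>\<omega>. weight (\<lambda>(i, j). pmf \<pi> i * pmf \<pi> j) n \<omega>"
  have pmf_p: "pmf p \<sigma> = (\<Prod>u<n. pmf \<pi> (\<sigma> u))" if "\<sigma> \<in> Lab" for \<sigma>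
    unfolding p_def by (rule pmf_Pi') (use that in \<open>auto simp: Lab_def PiE_dflt_def\<close>)
  \<comment> \<open>Translates between two functions with default 0 and one extensional function
    into pairs; hence \<open>F\<close> may depend only on values below \<open>n\<close>.\<close>
  have reindex: "(\<Sum>(\<sigma>, \<tau>)\<in>X \<times> X. pmf p \<sigma> * pmf p \<tau> * F (\<lambda>u. (\<sigma> u, \<tau> u))) =
     (\<Sum>\<omega>\<in>balanced_pairs s \<pi> n a. ?wt \<omega> * F \<omega>)"
    if F: "\<And>\<omega> \<omega>'. (\<And>u. u < n \<Longrightarrow> \<omega> u = \<omega>' u) \<Longrightarrow> F \<omega> = F \<omega>'" for F :: "(nat \<Rightarrow> nat \<times> nat) \<Rightarrow> real"
  proof (rule sum.reindex_bij_witness[of _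
      "\<lambda>\<omega>. (\<lambda>u. if u < n then fst (\<omega> u) else 0, \<lambda>u. if u < n then snd (\<omega> u) else 0)"
      "\<lambda>(\<sigma>, \<tau>). restrict (\<lambda>u. (\<sigma> u, \<tau> u)) {..<n}"], goal_cases)
    case (1 x)
    then show ?case by (auto simp: X_def Lab_def PiE_dflt_def fun_eq_iff)
  next
    case (2 x)
    obtain \<sigma> \<tau> where x: "x = (\<sigma>, \<tau>)" by force
    have "\<sigma> \<in> Lab" "\<tau> \<in> Lab" using 2 by (auto simp: x X_def)
    moreover have "balanced_labels s \<pi> n a (\<lambda>u. fst (restrict (\<lambda>u. (\<sigma> u, \<tau> u)) {..<n} u)) = balanced_labels s \<pi> n a \<sigma>"
      "balanced_labels s \<pi> n a (\<lambda>u. snd (restrict (\<lambda>u. (\<sigma> u, \<tau> u)) {..<n} u)) = balanced_labels s \<pi> n a \<tau>"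
      by (rule balanced_labels_cong, simp)+
    ultimately show ?case using 2
      by (auto simp: x X_def balanced_pairs_def assignments_def Lab_def PiE_dflt_def S_def)
  next
    case (3 \<omega>)
    then have w: "\<omega> \<in> assignments (S \<times> S) n" by (simp add: balanced_pairs_def S_def)
    show ?case
    proof
      fix u
      show "(case (\<lambda>u. if u < n then fst (\<omega> u) else 0, \<lambda>u. if u < n then snd (\<omega> u) else 0) of
          (\<sigma>, \<tau>) \<Rightarrow> restrict (\<lambda>u. (\<sigma> u, \<tau> u)) {..<n}) u = \<omega> u"
        using w by (auto simp: assignments_def PiE_def extensional_def)
    qed
  next
    case (4 \<omega>)
    then have w: "\<omega> \<in> assignments (S \<times> S) n" by (simp add: balanced_pairs_def S_def)
    have "balanced_labels s \<pi> n a (\<lambda>u. if u < n then fst (\<omega> u) else 0) = balanced_labels s \<pi> n a (\<lambda>u. fst (\<omega> u))"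
      "balanced_labels s \<pi> n a (\<lambda>u. if u < n then snd (\<omega> u) else 0) = balanced_labels s \<pi> n a (\<lambda>u. snd (\<omega> u))"
      by (rule balanced_labels_cong, simp)+
    then show ?case using 4 assignmentsD[OF w]
      by (auto simp: X_def Lab_def PiE_dflt_def balanced_pairs_def mem_Times_iff)
  next
    case (5 x)
    obtain \<sigma> \<tau> where x: "x = (\<sigma>, \<tau>)" by force
    have L: "\<sigma> \<in> Lab" "\<tau> \<in> Lab" using 5 by (auto simp: x X_def)
    have "F (restrict (\<lambda>u. (\<sigma> u, \<tau> u)) {..<n}) = F (\<lambda>u. (\<sigma> u, \<tau> u))" by (rule F) simp
    moreover have "?wt (restrict (\<lambda>u. (\<sigma> u, \<tau> u)) {..<n}) = pmf p \<sigma> * pmf p \<tau>"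
      by (simp add: weight_def pmf_p L prod.distrib)
    ultimately show ?case by (simp add: x)
  qed
  \<comment> \<open>The normalising constant is the same sum with the trivial factor 1.\<close>
  have Z2: "Z\<^sup>2 = (\<Sum>\<omega>\<in>balanced_pairs s \<pi> n a. ?wt \<omega>)"
    using reindex[of "\<lambda>_. 1"]
    by (simp add: Z_def power2_eq_square sum_product sum.cartesian_product)
  then have Z0: "Z > 0" using pos sum_nonneg[of X "pmf p"] by (auto simp: Z_def order.strict_iff_order)
  have ne: "set_pmf (sbm n M \<pi>) \<inter> balanced s \<pi> n a \<noteq> {}"
    using Z Z0 measure_pmf_zero_iff[of "sbm n M \<pi>" "balanced s \<pi> n a"] by auto
  have pmf_P: "pmf (sbm_cond s M \<pi> n a) G = (\<Sum>\<sigma>\<in>X. pmf p \<sigma> * pmf (W \<sigma>) G) / Z" for G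
  proof -
    let ?c = "cond_pmf (sbm n M \<pi>) (balanced s \<pi> n a)"
    have pc: "pmf ?c (G, \<sigma>) = (if balanced_labels s \<pi> n a \<sigma> then pmf p \<sigma> * pmf (W \<sigma>) G / Z else 0)" for \<sigma>
      unfolding pmf_cond[OF ne] Z pmf_sbm by (simp add: bal)
    have "pmf (sbm_cond s M \<pi> n a) G = measure ?c (fst -` {G})" by (simp add: sbm_cond_def pmf_map)
    also have "\<dots> = measure ?c (Pair G ` X)"
    proof (rule measure_eq_AE)
      show "AE x in ?c. (x \<in> fst -` {G}) = (x \<in> Pair G ` X)"
      proof (rule AE_pmfI)
        fix x assume x: "x \<in> set_pmf ?c"
        then have x': "x \<in> set_pmf (sbm n M \<pi>)" "x \<in> balanced s \<pi> n a" by (auto simp: set_cond_pmf[OF ne])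
        have "snd x \<in> set_pmf p" using x'(1) unfolding snd_sbm[symmetric] by auto
        moreover have "balanced_labels s \<pi> n a (snd x)"
          using x'(2) unfolding bal by simp
        ultimately have "snd x \<in> X" by (simp add: X_def set_p)
        then show "(x \<in> fst -` {G}) = (x \<in> Pair G ` X)" by (cases x) auto
      qed
    qed auto
    also have "\<dots> = (\<Sum>x\<in>Pair G ` X. pmf ?c x)" by (rule measure_measure_pmf_finite) (use finX in simp)
    also have "\<dots> = (\<Sum>\<sigma>\<in>X. pmf ?c (G, \<sigma>))" by (subst sum.reindex) (auto simp: inj_on_def)
    also have "\<dots> = (\<Sum>\<sigma>\<in>X. pmf p \<sigma> * pmf (W \<sigma>) G / Z)" by (intro sum.cong) (auto simp: pc X_def)
    finally show ?thesis by (simp add: sum_divide_distrib)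
  qed
  have sub: "set_pmf (sbm_cond s M \<pi> n a) \<subseteq> set_pmf R"
  proof
    fix G assume G: "G \<in> set_pmf (sbm_cond s M \<pi> n a)"
    show "G \<in> set_pmf R"
    proof (rule ccontr)
      assume "G \<notin> set_pmf R"
      then have "pmf (W \<sigma>) G = 0" for \<sigma> using set_W[of \<sigma>] set_R by (auto simp: set_pmf_iff)
      then have "pmf (sbm_cond s M \<pi> n a) G = 0" by (simp add: pmf_P)
      then show False using G by (simp add: set_pmf_iff)
    qed
  qed
  have pairs_lt: "u < n \<and> v < n" if "(u, v) \<in> V" for u v using that by (auto simp: V_def vertex_pairs_def)
  have inner: "(\<Sum>G\<in>Gr. pmf (W \<sigma>) G * pmf (W \<tau>) G / pmf R G) =
      (\<Prod>(u, v)\<in>V. 1 + (M $$ (\<sigma> u, \<sigma> v) - d) * (M $$ (\<tau> u, \<tau> v) - d) / d / (n - d))"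
    if \<sigma>: "\<sigma> \<in> X" and \<tau>: "\<tau> \<in> X" for \<sigma> \<tau>
  proof -
    have lt: "\<sigma> u < s" "\<tau> u < s" if "u < n" for u
      using that \<sigma> \<tau> pi by (auto simp: X_def Lab_def PiE_dflt_def S_def)
    let ?b = "\<lambda>\<sigma> e. bernoulli_pmf (M $$ (\<sigma> (fst e), \<sigma> (snd e)) / real n)"
    have pW: "pmf (W \<sigma>) G = (\<Prod>e\<in>V. pmf (?b \<sigma> e) (G e))" if "G \<in> Gr" for G and \<sigma> :: "nat \<Rightarrow> nat"
      unfolding W_def using that finV by (subst pmf_Pi') (auto simp: Gr_def PiE_dflt_def case_prod_beta)
    have pR: "pmf R G = (\<Prod>e\<in>V. pmf (bernoulli_pmf q) (G e))" if "G \<in> Gr" for G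
      unfolding R_def erdos_renyi_def V_def[symmetric] using that finV
      by (subst pmf_Pi') (auto simp: Gr_def PiE_dflt_def)
    have "(\<Sum>G\<in>Gr. pmf (W \<sigma>) G * pmf (W \<tau>) G / pmf R G) =
      (\<Sum>G\<in>Gr. \<Prod>e\<in>V. pmf (?b \<sigma> e) (G e) * pmf (?b \<tau> e) (G e) / pmf (bernoulli_pmf q) (G e))"
      by (intro sum.cong) (simp_all add: pW pR prod.distrib prod_dividef)
    also have "\<dots> = (\<Prod>e\<in>V. \<Sum>b\<in>UNIV. pmf (?b \<sigma> e) b * pmf (?b \<tau> e) b / pmf (bernoulli_pmf q) b)"
      unfolding Gr_def by (rule sum_prod_PiE_dflt[OF finV, where f = "\<lambda>e b. pmf (?b \<sigma> e) b * pmf (?b \<tau> e) b / pmf (bernoulli_pmf q) b"]) simp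
    also have "\<dots> = (\<Prod>(u, v)\<in>V. 1 + (M $$ (\<sigma> u, \<sigma> v) - d) * (M $$ (\<tau> u, \<tau> v) - d) / d / (n - d))"
    proof (rule prod.cong)
      fix e assume e: "e \<in> V"
      obtain u v where uv: "e = (u, v)" by force
      have n: "u < n" "v < n" using pairs_lt e uv by auto
      have n0: "real n > 0" using d by linarith
      have m: "0 \<le> M $$ (\<sigma> u, \<sigma> v) / n" "M $$ (\<sigma> u, \<sigma> v) / n \<le> 1"
        "0 \<le> M $$ (\<tau> u, \<tau> v) / n" "M $$ (\<tau> u, \<tau> v) / n \<le> 1"
        using M_nonneg M_le lt n n0 by (auto simp: divide_le_eq)
      have "(\<Sum>b\<in>UNIV. pmf (?b \<sigma> e) b * pmf (?b \<tau> e) b / pmf (bernoulli_pmf q) b) =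
        1 + (M $$ (\<sigma> u, \<sigma> v) / n - q) * (M $$ (\<tau> u, \<tau> v) / n - q) / (q * (1 - q))"
        unfolding uv fst_conv snd_conv by (rule sum_bernoulli_ratio[OF q m])
      also have "(M $$ (\<sigma> u, \<sigma> v) / n - q) * (M $$ (\<tau> u, \<tau> v) / n - q) / (q * (1 - q)) =
         (M $$ (\<sigma> u, \<sigma> v) - d) * (M $$ (\<tau> u, \<tau> v) - d) / d / (n - d)"
      proof -
        have "M $$ (\<sigma> u, \<sigma> v) / n - q = (M $$ (\<sigma> u, \<sigma> v) - d) / n" "M $$ (\<tau> u, \<tau> v) / n - q = (M $$ (\<tau> u, \<tau> v) - d) / n"
          "1 - q = (n - d) / n"
          using n0 by (auto simp: q_def diff_divide_distrib)
        then show ?thesis using n0 d by (simp add: q_def)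
      qed
      finally show "(\<Sum>b\<in>UNIV. pmf (?b \<sigma> e) b * pmf (?b \<tau> e) b / pmf (bernoulli_pmf q) b) =
         (case e of (u, v) \<Rightarrow> 1 + (M $$ (\<sigma> u, \<sigma> v) - d) * (M $$ (\<tau> u, \<tau> v) - d) / d / (n - d))"
        by (simp add: uv)
    qed simp
    finally show ?thesis .
  qed
  define F where "F \<omega> = (\<Prod>(u, v)\<in>V. 1 + (M $$ (fst (\<omega> u), fst (\<omega> v)) - d) * (M $$ (snd (\<omega> u), snd (\<omega> v)) - d) / d / (n - d))"
    for \<omega> :: "nat \<Rightarrow> nat \<times> nat"
  have "second_moment (sbm_cond s M \<pi> n a) R = ennreal (\<Sum>G\<in>Gr. (pmf (sbm_cond s M \<pi> n a) G)\<^sup>2 / pmf R G)"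
    using second_moment_finite[OF sub] finGr by (simp add: set_R)
  also have "(\<Sum>G\<in>Gr. (pmf (sbm_cond s M \<pi> n a) G)\<^sup>2 / pmf R G) =
     (\<Sum>G\<in>Gr. \<Sum>(\<sigma>, \<tau>)\<in>X \<times> X. pmf p \<sigma> * pmf p \<tau> * (pmf (W \<sigma>) G * pmf (W \<tau>) G / pmf R G) / Z\<^sup>2)"
    unfolding pmf_P power_divide power2_eq_square[of "sum _ X"] sum_product sum.cartesian_product sum_divide_distrib
    by (intro sum.cong) (auto simp: mult_ac power2_eq_square)
  also have "\<dots> = (\<Sum>(\<sigma>, \<tau>)\<in>X \<times> X. pmf p \<sigma> * pmf p \<tau> * (\<Sum>G\<in>Gr. pmf (W \<sigma>) G * pmf (W \<tau>) G / pmf R G)) / Z\<^sup>2"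
    by (subst sum.swap) (simp add: case_prod_beta sum_distrib_left sum_divide_distrib)
  also have "(\<Sum>(\<sigma>, \<tau>)\<in>X \<times> X. pmf p \<sigma> * pmf p \<tau> * (\<Sum>G\<in>Gr. pmf (W \<sigma>) G * pmf (W \<tau>) G / pmf R G)) =
     (\<Sum>(\<sigma>, \<tau>)\<in>X \<times> X. pmf p \<sigma> * pmf p \<tau> * F (\<lambda>u. (\<sigma> u, \<tau> u)))"
    by (intro sum.cong) (auto simp: inner F_def)
  also have "\<dots> = (\<Sum>\<omega>\<in>balanced_pairs s \<pi> n a. ?wt \<omega> * F \<omega>)"
    by (rule reindex) (auto simp: F_def dest!: pairs_lt intro!: prod.cong)
  finally show ?thesis by (simp add: Z2 F_def V_def R_def q_def)
qed

section \<open>The block model\<close>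

lemma sum_times_prod:
  fixes g :: "'a \<Rightarrow> real" and h :: "'b \<Rightarrow> real"
  shows "(\<Sum>(i, j)\<in>A \<times> B. g i * h j) = (\<Sum>i\<in>A. g i) * (\<Sum>j\<in>B. h j)"
  by (simp add: sum_product sum.cartesian_product)

lemma sum_indicator_eq_card:
  fixes n :: nat
  shows "(\<Sum>u<n. if P u then 1 else 0) = real (card {u. u < n \<and> P u})"
proof -
  have "(\<Sum>u<n. if P u then 1 else (0::real)) = (\<Sum>u\<in>{u \<in> {..<n}. P u}. 1)"
    by (rule sum.inter_filter[symmetric]) simp
  then show ?thesis by simp
qed

lemma sum_UN_le:
  fixes g :: "'b \<Rightarrow> real"
  assumes "finite I" "\<And>i. finite (B i)" "\<And>i x. i \<in> I \<Longrightarrow> x \<in> B i \<Longrightarrow> 0 \<le> g x"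
  shows "(\<Sum>x\<in>(\<Union>i\<in>I. B i). g x) \<le> (\<Sum>i\<in>I. \<Sum>x\<in>B i. g x)"
  using assms
proof (induction I rule: finite_induct)
  case (insert i I)
  have "(\<Sum>x\<in>B i \<inter> (\<Union>i\<in>I. B i). g x) \<ge> 0" using insert.prems by (intro sum_nonneg) auto
  then have "(\<Sum>x\<in>B i \<union> (\<Union>i\<in>I. B i). g x) \<le> (\<Sum>x\<in>B i. g x) + (\<Sum>x\<in>(\<Union>i\<in>I. B i). g x)"
    using insert by (subst sum_Un) auto
  moreover have "(\<Sum>x\<in>(\<Union>i\<in>I. B i). g x) \<le> (\<Sum>i\<in>I. \<Sum>x\<in>B i. g x)"
    using insert.prems by (intro insert.IH) auto
  ultimately show ?case using insert.hyps by simp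
qed simp

text \<open>The matrix is described by eigendata on the support of \<open>\<pi>\<close> only, the
  set where labels take their values.\<close>

locale sbm_spectral =
  fixes s :: nat and \<pi> :: "nat pmf" and M :: "real mat" and d :: real
    and m :: nat and \<mu> :: "nat \<Rightarrow> real" and f :: "nat \<Rightarrow> nat \<Rightarrow> real"
  assumes pi: "set_pmf \<pi> \<subseteq> {..<s}"
    and M_carrier: "M \<in> carrier_mat s s"
    and M_nonneg: "\<And>i j. i < s \<Longrightarrow> j < s \<Longrightarrow> M $$ (i, j) \<ge> 0"
    and d: "d > 0"
    and f_ortho: "\<And>a b. a < m \<Longrightarrow> b < m \<Longrightarrow>
      (\<Sum>i\<in>set_pmf \<pi>. pmf \<pi> i * f a i * f b i) = (if a = b then 1 else 0)"
    and f_mean: "\<And>a. a < m \<Longrightarrow> (\<Sum>i\<in>set_pmf \<pi>. pmf \<pi> i * f a i) = 0"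
    and M_eq: "\<And>i j. i \<in> set_pmf \<pi> \<Longrightarrow> j \<in> set_pmf \<pi> \<Longrightarrow>
      M $$ (i, j) - d = d * (\<Sum>a<m. \<mu> a * f a i * f a j)"
begin

abbreviation S :: "nat set" where "S \<equiv> set_pmf \<pi>"

lemma S_less: "i \<in> S \<Longrightarrow> i < s"
  using pi by auto

lemma finS: "finite S"
  using pi finite_subset by blast

lemma sum_pi: "(\<Sum>i\<in>S. pmf \<pi> i) = 1"
  by (rule sum_pmf_eq_1) (use finS in auto)

text \<open>Since A = d \<Sum> \<mu> f f on the support, the kernel A \<otimes> A / d has
  eigenfunctions f a \<otimes> f b with eigenvalues d \<mu> a \<mu> b. Means and inner products
  factor over the two coordinates.\<close>

sublocale kernel_model "S \<times> S" "\<lambda>(i, j). pmf \<pi> i * pmf \<pi> j" "{..<m} \<times> {..<m}"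
  "\<lambda>(a, b). d * \<mu> a * \<mu> b" "\<lambda>(a, b) (i, j). f a i * f b j" d
proof
  show "finite (S \<times> S)" using finS by simp
  show "(case l of (i, j) \<Rightarrow> pmf \<pi> i * pmf \<pi> j) > 0" if "l \<in> S \<times> S" for l
    using that by (auto simp: pmf_positive)
  show "(\<Sum>l\<in>S \<times> S. case l of (i, j) \<Rightarrow> pmf \<pi> i * pmf \<pi> j) = 1"
    by (simp add: sum_times_prod sum_pi)
  show "(\<Sum>l\<in>S \<times> S. (case l of (i, j) \<Rightarrow> pmf \<pi> i * pmf \<pi> j) * (case c of (a, b) \<Rightarrow> \<lambda>(i, j). f a i * f b j) l) = 0"
    if c_in: "c \<in> {..<m} \<times> {..<m}" for c
  proof -
    obtain a b where c: "c = (a, b)" "a < m" "b < m" using c_in by blast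
    have "(\<Sum>l\<in>S \<times> S. (case l of (i, j) \<Rightarrow> pmf \<pi> i * pmf \<pi> j) * (case c of (a, b) \<Rightarrow> \<lambda>(i, j). f a i * f b j) l) =
      (\<Sum>(i, j)\<in>S \<times> S. (pmf \<pi> i * f a i) * (pmf \<pi> j * f b j))"
      by (intro sum.cong) (auto simp: c mult_ac)
    then show ?thesis using f_mean c by (simp add: sum_times_prod)
  qed
  show "(\<Sum>l\<in>S \<times> S. (case l of (i, j) \<Rightarrow> pmf \<pi> i * pmf \<pi> j) * (case c of (a, b) \<Rightarrow> \<lambda>(i, j). f a i * f b j) l *
      (case c' of (a, b) \<Rightarrow> \<lambda>(i, j). f a i * f b j) l) = (if c = c' then 1 else 0)"
    if c_in: "c \<in> {..<m} \<times> {..<m}" "c' \<in> {..<m} \<times> {..<m}" for c c'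
  proof -
    obtain a b where c: "c = (a, b)" "a < m" "b < m" using c_in by blast
    obtain a' b' where c': "c' = (a', b')" "a' < m" "b' < m" using c_in by blast
    have "(\<Sum>l\<in>S \<times> S. (case l of (i, j) \<Rightarrow> pmf \<pi> i * pmf \<pi> j) * (case c of (a, b) \<Rightarrow> \<lambda>(i, j). f a i * f b j) l *
        (case c' of (a, b) \<Rightarrow> \<lambda>(i, j). f a i * f b j) l) =
      (\<Sum>(i, j)\<in>S \<times> S. (pmf \<pi> i * f a i * f a' i) * (pmf \<pi> j * f b j * f b' j))"
      by (intro sum.cong) (auto simp: c c' mult_ac)
    then show ?thesis using c c' by (simp add: sum_times_prod f_ortho)
  qed
qed (use d in auto)

abbreviation w :: "nat \<times> nat \<Rightarrow> real" where "w \<equiv> \<lambda>(i, j). pmf \<pi> i * pmf \<pi> j"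

lemma K_eq:
  assumes "i \<in> S" "j \<in> S" "k \<in> S" "l \<in> S"
  shows "K (i, j) (k, l) = (M $$ (i, k) - d) * (M $$ (j, l) - d) / d"
proof -
  have "K (i, j) (k, l) = (\<Sum>(a, b)\<in>{..<m} \<times> {..<m}. (d * (\<mu> a * f a i * f a k)) * (\<mu> b * f b j * f b l))"
    unfolding K_def by (intro sum.cong) (auto simp: mult_ac)
  also have "\<dots> = (d * (\<Sum>a<m. \<mu> a * f a i * f a k)) * (\<Sum>b<m. \<mu> b * f b j * f b l)"
    by (simp add: sum_times_prod sum_distrib_left)
  also have "\<dots> = (M $$ (i, k) - d) * (M $$ (j, l) - d) / d" using M_eq assms d by simp
  finally show ?thesis .
qed

lemma lr_eq:
  assumes "\<omega> \<in> assignments (S \<times> S) n"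
  shows "lr n \<omega> = (\<Prod>(u, v)\<in>vertex_pairs n. 1 + (M $$ (fst (\<omega> u), fst (\<omega> v)) - d) *
    (M $$ (snd (\<omega> u), snd (\<omega> v)) - d) / d / (n - d))"
  unfolding lr_def
proof (rule prod.cong)
  fix e assume "e \<in> vertex_pairs n"
  then obtain u v where e: "e = (u, v)" "u < n" "v < n" by (auto simp: vertex_pairs_def)
  have "\<omega> u \<in> S \<times> S" "\<omega> v \<in> S \<times> S" using assms e by (auto intro: assignmentsD)
  then have "K (\<omega> u) (\<omega> v) = (M $$ (fst (\<omega> u), fst (\<omega> v)) - d) * (M $$ (snd (\<omega> u), snd (\<omega> v)) - d) / d"
    using K_eq[of "fst (\<omega> u)" "snd (\<omega> u)" "fst (\<omega> v)" "snd (\<omega> v)"] by (auto simp: mem_Times_iff)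
  then show "(case e of (u, v) \<Rightarrow> 1 + K (\<omega> u) (\<omega> v) / (real n - d)) =
    (case e of (u, v) \<Rightarrow> 1 + (M $$ (fst (\<omega> u), fst (\<omega> v)) - d) * (M $$ (snd (\<omega> u), snd (\<omega> v)) - d) / d / (n - d))"
    by (simp add: e)
qed simp

section \<open>Couplings and the supremum Q\<close>

text \<open>The functional counterpart of \<open>couplings\<close>, imposed on the support only; the
  values elsewhere are free.\<close>

definition coupling :: "(nat \<times> nat \<Rightarrow> real) \<Rightarrow> bool" where
  "coupling \<alpha> \<longleftrightarrow> (\<forall>l\<in>S \<times> S. \<alpha> l \<ge> 0) \<and> (\<forall>i\<in>S. (\<Sum>j\<in>S. \<alpha> (i, j)) = pmf \<pi> i) \<and>
     (\<forall>j\<in>S. (\<Sum>i\<in>S. \<alpha> (i, j)) = pmf \<pi> j)"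

lemma coupling_sum:
  assumes "coupling \<alpha>"
  shows "(\<Sum>l\<in>S \<times> S. \<alpha> l) = 1"
proof -
  have "(\<Sum>l\<in>S \<times> S. \<alpha> l) = (\<Sum>i\<in>S. \<Sum>j\<in>S. \<alpha> (i, j))" by (simp add: sum.cartesian_product)
  also have "\<dots> = (\<Sum>i\<in>S. pmf \<pi> i)" using assms by (intro sum.cong) (auto simp: coupling_def)
  finally show ?thesis by (simp add: sum_pi)
qed

lemma coupling_w: "coupling w"
  unfolding coupling_def using sum_pi
  by (auto simp: simp flip: sum_distrib_left sum_distrib_right)

lemma sum_pairs_restrict:
  assumes "\<And>i j. i < s \<Longrightarrow> j < s \<Longrightarrow> (i, j) \<notin> S \<times> S \<Longrightarrow> h (i, j) = (0::real)"
  shows "(\<Sum>i<s. \<Sum>j<s. h (i, j)) = (\<Sum>l\<in>S \<times> S. h l)"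
proof -
  have "(\<Sum>i<s. \<Sum>j<s. h (i, j)) = (\<Sum>l\<in>{..<s} \<times> {..<s}. h l)" by (simp add: sum.cartesian_product)
  also have "\<dots> = (\<Sum>l\<in>S \<times> S. h l)"
    by (rule sum.mono_neutral_right) (use pi assms in auto)
  finally show ?thesis .
qed

lemma sum_restrict:
  assumes "\<And>i. i < s \<Longrightarrow> i \<notin> S \<Longrightarrow> h i = (0::real)"
  shows "(\<Sum>i<s. h i) = (\<Sum>i\<in>S. h i)"
  by (rule sum.mono_neutral_right) (use pi assms in auto)

text \<open>A non-negative entry is bounded by both of its marginals, and outside the support one of
  them is 0.\<close>

lemma couplings_zero:
  assumes "\<alpha> \<in> couplings s \<pi>" "i < s" "j < s" "(i, j) \<notin> S \<times> S"
  shows "\<alpha> $$ (i, j) = 0"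
proof -
  have nn: "\<alpha> $$ (i', j') \<ge> 0" if "i' < s" "j' < s" for i' j' using assms(1) that by (simp add: couplings_def)
  have "\<alpha> $$ (i, j) \<le> (\<Sum>j<s. \<alpha> $$ (i, j))" "\<alpha> $$ (i, j) \<le> (\<Sum>i<s. \<alpha> $$ (i, j))"
    using assms nn by (auto intro!: member_le_sum[of j "{..<s}" "\<lambda>j. \<alpha> $$ (i, j)"]
        member_le_sum[of i "{..<s}" "\<lambda>i. \<alpha> $$ (i, j)"])
  moreover have "(\<Sum>j<s. \<alpha> $$ (i, j)) = pmf \<pi> i" "(\<Sum>i<s. \<alpha> $$ (i, j)) = pmf \<pi> j"
    using assms by (auto simp: couplings_def)
  moreover have "pmf \<pi> i = 0 \<or> pmf \<pi> j = 0" using assms(4) by (auto simp: set_pmf_iff)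
  ultimately show ?thesis using nn[OF assms(2,3)] by auto
qed

lemma couplings_coupling:
  assumes \<alpha>: "\<alpha> \<in> couplings s \<pi>"
  shows "coupling (\<lambda>l. \<alpha> $$ l)"
proof -
  have "(\<Sum>j\<in>S. \<alpha> $$ (i, j)) = pmf \<pi> i" "(\<Sum>j\<in>S. \<alpha> $$ (j, i)) = pmf \<pi> i" if "i \<in> S" for i
  proof -
    have i: "i < s" using pi that by auto
    have "(\<Sum>j\<in>S. \<alpha> $$ (i, j)) = (\<Sum>j<s. \<alpha> $$ (i, j))" "(\<Sum>j\<in>S. \<alpha> $$ (j, i)) = (\<Sum>j<s. \<alpha> $$ (j, i))"
      using couplings_zero[OF \<alpha>] i by (auto intro!: sum_restrict[symmetric])
    then show "(\<Sum>j\<in>S. \<alpha> $$ (i, j)) = pmf \<pi> i" "(\<Sum>j\<in>S. \<alpha> $$ (j, i)) = pmf \<pi> i"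
      using \<alpha> i by (auto simp: couplings_def)
  qed
  moreover have "\<alpha> $$ l \<ge> 0" if "l \<in> S \<times> S" for l
    using \<alpha> that by (auto simp: couplings_def S_less)
  ultimately show ?thesis by (auto simp: coupling_def)
qed

definition to_mat :: "(nat \<times> nat \<Rightarrow> real) \<Rightarrow> real mat" where
  "to_mat \<alpha> = mat s s (\<lambda>l. if l \<in> S \<times> S then \<alpha> l else 0)"

lemma to_mat_index: "l \<in> S \<times> S \<Longrightarrow> to_mat \<alpha> $$ l = \<alpha> l"
  by (auto simp: to_mat_def S_less)

lemma to_mat_couplings:
  assumes "coupling \<alpha>"
  shows "to_mat \<alpha> \<in> couplings s \<pi>"
proof -
  have "(\<Sum>j<s. to_mat \<alpha> $$ (i, j)) = pmf \<pi> i" if i: "i < s" for i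
  proof (cases "i \<in> S")
    case True
    have "(\<Sum>j<s. to_mat \<alpha> $$ (i, j)) = (\<Sum>j\<in>S. to_mat \<alpha> $$ (i, j))"
      using i by (intro sum_restrict) (auto simp: to_mat_def)
    also have "\<dots> = (\<Sum>j\<in>S. \<alpha> (i, j))" using True by (intro sum.cong) (auto simp: to_mat_index)
    finally show ?thesis using assms True by (auto simp: coupling_def)
  next
    case False
    then show ?thesis using i by (simp add: to_mat_def set_pmf_iff)
  qed
  moreover have "(\<Sum>j<s. to_mat \<alpha> $$ (j, i)) = pmf \<pi> i" if i: "i < s" for i
  proof (cases "i \<in> S")
    case True
    have "(\<Sum>j<s. to_mat \<alpha> $$ (j, i)) = (\<Sum>j\<in>S. to_mat \<alpha> $$ (j, i))"
      using i by (intro sum_restrict) (auto simp: to_mat_def)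
    also have "\<dots> = (\<Sum>j\<in>S. \<alpha> (j, i))" using True by (intro sum.cong) (auto simp: to_mat_index)
    finally show ?thesis using assms True by (auto simp: coupling_def)
  next
    case False
    then show ?thesis using i by (simp add: to_mat_def set_pmf_iff)
  qed
  moreover have "to_mat \<alpha> $$ (i, j) \<ge> 0" if "i < s" "j < s" for i j
    using assms that by (auto simp: to_mat_def coupling_def)
  ultimately show ?thesis by (simp add: couplings_def) (simp add: to_mat_def)
qed

lemma KL_div_eq:
  assumes \<alpha>: "\<alpha> \<in> couplings s \<pi>"
  shows "KL_div s \<alpha> (indep_coupling s \<pi>) = KL (\<lambda>l. \<alpha> $$ l)"
proof -
  have "KL_div s \<alpha> (indep_coupling s \<pi>) = (\<Sum>l\<in>S \<times> S. \<alpha> $$ l * ln (\<alpha> $$ l / indep_coupling s \<pi> $$ l))"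
    unfolding KL_div_def
    by (rule sum_pairs_restrict[where h = "\<lambda>l. \<alpha> $$ l * ln (\<alpha> $$ l / indep_coupling s \<pi> $$ l)"])
       (simp add: couplings_zero[OF \<alpha>])
  also have "\<dots> = KL (\<lambda>l. \<alpha> $$ l)"
    unfolding KL_def using pi by (intro sum.cong) (auto simp: indep_coupling_def subset_iff)
  finally show ?thesis .
qed

text \<open>The factor 1 / sqrt (2 d) occurs twice, so B \<otimes> B = A \<otimes> A / (2 d) = K /
  2, matching the 1/2 in \<open>quad\<close>. Subtracting p has no effect there because the
  eigenfunctions are centred.\<close>

lemma tensor_form_eq:
  assumes \<alpha>: "\<alpha> \<in> couplings s \<pi>" and A: "A = M - d \<cdot>\<^sub>m mat s s (\<lambda>_. 1)"
  shows "tensor_form s ((1 / sqrt (2 * d)) \<cdot>\<^sub>m A) (\<alpha> - indep_coupling s \<pi>) = quad (\<lambda>l. \<alpha> $$ l)"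
proof -
  let ?B = "(1 / sqrt (2 * d)) \<cdot>\<^sub>m A" and ?x = "\<alpha> - indep_coupling s \<pi>"
  have \<alpha>_c: "\<alpha> \<in> carrier_mat s s" using \<alpha> by (simp add: couplings_def)
  have x: "?x $$ (i, j) = \<alpha> $$ (i, j) - w (i, j)" if "i < s" "j < s" for i j
    using that \<alpha>_c by (simp add: indep_coupling_def)
  have x0: "?x $$ (i, j) = 0" if "i < s" "j < s" "(i, j) \<notin> S \<times> S" for i j
    using that couplings_zero[OF \<alpha> that] by (auto simp: x set_pmf_iff)
  have B: "?B $$ (i, j) = (M $$ (i, j) - d) / sqrt (2 * d)" if "i < s" "j < s" for i j
    using that M_carrier by (simp add: A)
  have BB: "?B $$ (i, k) * ?B $$ (j, l) = K (i, j) (k, l) / 2" if "i \<in> S" "j \<in> S" "k \<in> S" "l \<in> S" for i j k l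
  proof -
    have lt: "i < s" "j < s" "k < s" "l < s" using that by (auto simp: S_less)
    have "?B $$ (i, k) * ?B $$ (j, l) = (M $$ (i, k) - d) * (M $$ (j, l) - d) / (sqrt (2 * d) * sqrt (2 * d))"
      unfolding B[OF lt(1,3)] B[OF lt(2,4)] by (simp only: times_divide_times_eq)
    also have "sqrt (2 * d) * sqrt (2 * d) = 2 * d" using d by simp
    finally show ?thesis unfolding K_eq[OF that] by simp
  qed
  define y where "y l = \<alpha> $$ l - w l" for l
  have "tensor_form s ?B ?x = (\<Sum>i<s. \<Sum>j<s. \<Sum>l'\<in>S \<times> S. ?x $$ (i, j) * (?B $$ (i, fst l') * ?B $$ (j, snd l')) * ?x $$ l')"
    unfolding tensor_form_def
  proof (intro sum.cong refl)
    fix i j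
    show "(\<Sum>k<s. \<Sum>l<s. ?x $$ (i, j) * (?B $$ (i, k) * ?B $$ (j, l)) * ?x $$ (k, l)) =
      (\<Sum>l'\<in>S \<times> S. ?x $$ (i, j) * (?B $$ (i, fst l') * ?B $$ (j, snd l')) * ?x $$ l')"
      using sum_pairs_restrict[where h = "\<lambda>l'. ?x $$ (i, j) * (?B $$ (i, fst l') * ?B $$ (j, snd l')) * ?x $$ l'"]
        x0 by simp
  qed
  also have "\<dots> = (\<Sum>l\<in>S \<times> S. \<Sum>l'\<in>S \<times> S. ?x $$ l * (?B $$ (fst l, fst l') * ?B $$ (snd l, snd l')) * ?x $$ l')"
    using sum_pairs_restrict[where h = "\<lambda>l. \<Sum>l'\<in>S \<times> S. ?x $$ l * (?B $$ (fst l, fst l') * ?B $$ (snd l, snd l')) * ?x $$ l'"]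
      x0 by simp
  also have "\<dots> = (\<Sum>l\<in>S \<times> S. \<Sum>l'\<in>S \<times> S. y l * y l' * K l l') / 2"
    unfolding sum_divide_distrib
  proof (intro sum.cong refl)
    fix l l' assume l: "l \<in> S \<times> S" "l' \<in> S \<times> S"
    obtain i j k h where e: "l = (i, j)" "l' = (k, h)" by force
    have "i \<in> S" "j \<in> S" "k \<in> S" "h \<in> S" using l e by auto
    moreover from this have "i < s" "j < s" "k < s" "h < s" using pi by auto
    ultimately show "?x $$ l * (?B $$ (fst l, fst l') * ?B $$ (snd l, snd l')) * ?x $$ l' = y l * y l' * K l l' / 2"
      unfolding e fst_conv snd_conv BB[OF \<open>i \<in> S\<close> \<open>j \<in> S\<close> \<open>k \<in> S\<close> \<open>h \<in> S\<close>] y_def by (simp only: x) simp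
  qed
  also have "\<dots> = quad y" by (rule quad_eq[symmetric])
  also have "\<dots> = quad (\<lambda>l. \<alpha> $$ l)"
    unfolding quad_def y_def by (simp add: left_diff_distrib sum_subtractf mean)
  finally show ?thesis .
qed

lemma ratio_eq:
  assumes "\<alpha> \<in> couplings s \<pi>" "A = M - d \<cdot>\<^sub>m mat s s (\<lambda>_. 1)"
  shows "tensor_form s ((1 / sqrt (2 * d)) \<cdot>\<^sub>m A) (\<alpha> - indep_coupling s \<pi>) / KL_div s \<alpha> (indep_coupling s \<pi>) =
    quad (\<lambda>l. \<alpha> $$ l) / KL (\<lambda>l. \<alpha> $$ l)"
  by (simp add: tensor_form_eq[OF assms] KL_div_eq[OF assms(1)])

lemma couplings_KL_pos:
  assumes \<alpha>: "\<alpha> \<in> couplings s \<pi>" and ne: "\<alpha> \<noteq> indep_coupling s \<pi>"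
  shows "KL (\<lambda>l. \<alpha> $$ l) > 0"
proof (rule KL_pos)
  note c = couplings_coupling[OF \<alpha>]
  show "\<alpha> $$ l \<ge> 0" if "l \<in> S \<times> S" for l using c that by (auto simp: coupling_def)
  show "(\<Sum>l\<in>S \<times> S. \<alpha> $$ l) = 1" by (rule coupling_sum[OF c])
  show "\<exists>l\<in>S \<times> S. \<alpha> $$ l \<noteq> w l"
  proof (rule ccontr)
    assume eq: "\<not> (\<exists>l\<in>S \<times> S. \<alpha> $$ l \<noteq> w l)"
    have "\<alpha> = indep_coupling s \<pi>"
    proof (rule eq_matI)
      fix i j assume "i < dim_row (indep_coupling s \<pi>)" "j < dim_col (indep_coupling s \<pi>)"
      then have ij: "i < s" "j < s" by (auto simp: indep_coupling_def)
      show "\<alpha> $$ (i, j) = indep_coupling s \<pi> $$ (i, j)"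
      proof (cases "(i, j) \<in> S \<times> S")
        case True
        then have "\<alpha> $$ (i, j) = w (i, j)" using eq by blast
        then show ?thesis using ij by (simp add: indep_coupling_def)
      next
        case False
        then show ?thesis using ij couplings_zero[OF \<alpha> ij False] by (auto simp: indep_coupling_def set_pmf_iff)
      qed
    qed (use \<alpha> in \<open>auto simp: couplings_def indep_coupling_def\<close>)
    then show False using ne by simp
  qed
qed

text \<open>A strict bound on the supremum leaves room for a constant below 1 valid for all
  couplings at once; at p both sides of the inequality are 0.\<close>

lemma Q_sup_less_1:
  assumes A: "A = M - d \<cdot>\<^sub>m mat s s (\<lambda>_. 1)" and Q: "Q_sup s \<pi> ((1 / sqrt (2 * d)) \<cdot>\<^sub>m A) < 1"
  obtains r where "0 < r" "r < 1" "\<And>\<alpha>. coupling \<alpha> \<Longrightarrow> quad \<alpha> \<le> r * KL \<alpha>"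
proof -
  obtain c where c: "Q_sup s \<pi> ((1 / sqrt (2 * d)) \<cdot>\<^sub>m A) < ereal c" "ereal c < 1"
    using ereal_dense2[OF Q] by blast
  show thesis
  \<comment> \<open>The supremum may be negative or even -\<infinity>; the maximum with 1/2 keeps
    the constant positive.\<close>
  proof (rule that[of "max c (1 / 2)"])
    show "0 < max c (1 / 2)" by (simp add: less_max_iff_disj)
    show "max c (1 / 2) < 1" using c(2) by simp
    fix \<alpha> assume \<alpha>: "coupling \<alpha>"
    let ?\<alpha> = "to_mat \<alpha>"
    have m: "?\<alpha> \<in> couplings s \<pi>" by (rule to_mat_couplings[OF \<alpha>])
    have q: "quad (\<lambda>l. ?\<alpha> $$ l) = quad \<alpha>"
      unfolding quad_def by (simp add: to_mat_index cong: sum.cong)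
    have k: "KL (\<lambda>l. ?\<alpha> $$ l) = KL \<alpha>"
      unfolding KL_def by (intro sum.cong refl) (simp only: to_mat_index)
    show "quad \<alpha> \<le> max c (1 / 2) * KL \<alpha>"
    proof (cases "?\<alpha> = indep_coupling s \<pi>")
      case False
      then have "ereal (quad \<alpha> / KL \<alpha>) \<le> Q_sup s \<pi> ((1 / sqrt (2 * d)) \<cdot>\<^sub>m A)"
        unfolding Q_sup_def using m by (intro SUP_upper2[of ?\<alpha>]) (simp_all add: ratio_eq[OF m A] q k)
      then have "quad \<alpha> / KL \<alpha> \<le> c" using le_less_trans[OF _ c(1)] by fastforce
      moreover have pos: "KL \<alpha> > 0" using couplings_KL_pos[OF m False] by (simp add: k)
      ultimately have "quad \<alpha> \<le> c * KL \<alpha>" by (simp add: divide_le_eq)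
      also have "\<dots> \<le> max c (1 / 2) * KL \<alpha>" using pos by (intro mult_right_mono) auto
      finally show ?thesis .
    next
      case True
      have w: "\<alpha> l = w l" if "l \<in> S \<times> S" for l
        using to_mat_index[OF that, of \<alpha>] that pi unfolding True by (auto simp: indep_coupling_def subset_iff)
      have "quad \<alpha> = quad w" unfolding quad_def by (simp add: w cong: sum.cong)
      moreover have "KL \<alpha> = KL w" unfolding KL_def by (intro sum.cong refl) (simp only: w)
      ultimately show ?thesis by (simp add: KL_w quad_w)
    qed
  qed
qed

lemma Q_sup_greater_1:
  assumes A: "A = M - d \<cdot>\<^sub>m mat s s (\<lambda>_. 1)" and Q: "Q_sup s \<pi> ((1 / sqrt (2 * d)) \<cdot>\<^sub>m A) > 1"
  obtains \<alpha> where "coupling \<alpha>" "KL \<alpha> < quad \<alpha>"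
proof -
  from Q obtain \<alpha> where \<alpha>: "\<alpha> \<in> couplings s \<pi>" "\<alpha> \<noteq> indep_coupling s \<pi>"
    and gt: "1 < ereal (tensor_form s ((1 / sqrt (2 * d)) \<cdot>\<^sub>m A) (\<alpha> - indep_coupling s \<pi>) / KL_div s \<alpha> (indep_coupling s \<pi>))"
    unfolding Q_sup_def less_SUP_iff by blast
  have "1 < quad (\<lambda>l. \<alpha> $$ l) / KL (\<lambda>l. \<alpha> $$ l)" using gt unfolding ratio_eq[OF \<alpha>(1) A] by simp
  then have "KL (\<lambda>l. \<alpha> $$ l) < quad (\<lambda>l. \<alpha> $$ l)"
    using couplings_KL_pos[OF \<alpha>] by (simp add: less_divide_eq)
  then show thesis using that couplings_coupling[OF \<alpha>(1)] by blast
qed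

text \<open>Both factors of the eigenfunction have \<pi>-mean 0, so the perturbation leaves both
  marginals unchanged: eigenfunctions are admissible directions in the set of couplings.\<close>

lemma perturbed_coupling:
  assumes c: "a < m" "b < m" and t: "\<And>l. l \<in> S \<times> S \<Longrightarrow> \<bar>t * (case l of (i, j) \<Rightarrow> f a i * f b j)\<bar> \<le> 1 / 2"
  shows "coupling (\<lambda>l. w l * (1 + t * (case l of (i, j) \<Rightarrow> f a i * f b j)))"
proof -
  have "(\<Sum>j\<in>S. pmf \<pi> i * pmf \<pi> j * (1 + t * (f a i * f b j))) = pmf \<pi> i" for i
  proof -
    have "(\<Sum>j\<in>S. pmf \<pi> i * pmf \<pi> j * (1 + t * (f a i * f b j))) =
      pmf \<pi> i * (\<Sum>j\<in>S. pmf \<pi> j) + pmf \<pi> i * t * f a i * (\<Sum>j\<in>S. pmf \<pi> j * f b j)"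
      by (simp add: sum_distrib_left sum.distrib algebra_simps)
    then show ?thesis by (simp add: sum_pi f_mean c)
  qed
  moreover have "(\<Sum>i\<in>S. pmf \<pi> i * pmf \<pi> j * (1 + t * (f a i * f b j))) = pmf \<pi> j" for j
  proof -
    have "(\<Sum>i\<in>S. pmf \<pi> i * pmf \<pi> j * (1 + t * (f a i * f b j))) =
      pmf \<pi> j * (\<Sum>i\<in>S. pmf \<pi> i) + pmf \<pi> j * t * f b j * (\<Sum>i\<in>S. pmf \<pi> i * f a i)"
      by (simp add: sum_distrib_left sum.distrib algebra_simps)
    then show ?thesis by (simp add: sum_pi f_mean c)
  qed
  moreover have "w l * (1 + t * (case l of (i, j) \<Rightarrow> f a i * f b j)) \<ge> 0" if "l \<in> S \<times> S" for l
  proof (intro mult_nonneg_nonneg)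
    show "0 \<le> w l" by (auto split: prod.split)
    show "0 \<le> 1 + t * (case l of (i, j) \<Rightarrow> f a i * f b j)" using t[OF that] by (simp add: abs_le_iff)
  qed
  ultimately show ?thesis unfolding coupling_def by (simp del: mult_nonneg_nonneg)
qed

section \<open>The balance condition\<close>

lemma freq_marginals:
  assumes w: "\<omega> \<in> assignments (S \<times> S) n" and n: "n > 0" and i: "i \<in> S"
  shows "(\<Sum>j\<in>S. freq n \<omega> (i, j)) = card {u. u < n \<and> fst (\<omega> u) = i} / n"
    and "(\<Sum>j\<in>S. freq n \<omega> (j, i)) = card {u. u < n \<and> snd (\<omega> u) = i} / n"
proof -
  have "real (card {u. u < n \<and> fst (\<omega> u) = i}) = n * (\<Sum>l\<in>S \<times> S. freq n \<omega> l * (if fst l = i then 1 else 0))"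
    using sum_assignment_eq_freq[OF finL w, of "\<lambda>l. if fst l = i then 1 else 0"] by (simp only: sum_indicator_eq_card)
  also have "(\<Sum>l\<in>S \<times> S. freq n \<omega> l * (if fst l = i then 1 else 0)) =
      (\<Sum>k\<in>S. \<Sum>j\<in>S. freq n \<omega> (k, j) * (if k = i then 1 else 0))"
    by (simp add: sum.cartesian_product case_prod_beta)
  also have "\<dots> = (\<Sum>k\<in>S. if k = i then (\<Sum>j\<in>S. freq n \<omega> (i, j)) else 0)" by (intro sum.cong) auto
  finally show "(\<Sum>j\<in>S. freq n \<omega> (i, j)) = card {u. u < n \<and> fst (\<omega> u) = i} / n"
    using i finS n by simp
  have "real (card {u. u < n \<and> snd (\<omega> u) = i}) = n * (\<Sum>l\<in>S \<times> S. freq n \<omega> l * (if snd l = i then 1 else 0))"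
    using sum_assignment_eq_freq[OF finL w, of "\<lambda>l. if snd l = i then 1 else 0"] by (simp only: sum_indicator_eq_card)
  also have "(\<Sum>l\<in>S \<times> S. freq n \<omega> l * (if snd l = i then 1 else 0)) =
      (\<Sum>j\<in>S. \<Sum>k\<in>S. freq n \<omega> (j, k) * (if k = i then 1 else 0))"
    by (simp add: sum.cartesian_product case_prod_beta)
  also have "\<dots> = (\<Sum>j\<in>S. freq n \<omega> (j, i))"
    using i finS by (intro sum.cong) (auto simp: if_distrib cong: if_cong)
  finally show "(\<Sum>j\<in>S. freq n \<omega> (j, i)) = card {u. u < n \<and> snd (\<omega> u) = i} / n"
    using n by simp
qed

text \<open>Under any coupling both coordinates have law \<pi>, so a union bound over the 2 s label
  counts, with thresholds of larger order than sqrt n, shows the event to be typical. It serves the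
  product law and the tilted law alike.\<close>

lemma balanced_weight_tendsto_1:
  assumes v: "coupling v" and a_large: "filterlim (\<lambda>n. a n / sqrt (real n)) at_top sequentially"
  shows "(\<lambda>n. \<Sum>\<omega>\<in>balanced_pairs s \<pi> n (a n). weight v n \<omega>) \<longlonglongrightarrow> 1"
proof -
  have v0: "v l \<ge> 0" if "l \<in> S \<times> S" for l using v that by (auto simp: coupling_def)
  have v1: "(\<Sum>l\<in>S \<times> S. v l) = 1" by (rule coupling_sum[OF v])
  \<comment> \<open>The Boolean selects the first or second labelling; \<open>g\<close> is the
    centred indicator of label \<open>i\<close>.\<close>
  define g where "g b i l = (if (if b then fst l else snd l) = i then 1 else 0) - pmf \<pi> i" for b i and l :: "nat \<times> nat"
  have g_mean: "(\<Sum>l\<in>S \<times> S. v l * g b i l) = 0" if "i < s" for b i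
  proof -
    have e: "(\<Sum>l\<in>S \<times> S. v l * g b i l) = (\<Sum>l\<in>S \<times> S. v l * (if (if b then fst l else snd l) = i then 1 else 0)) - pmf \<pi> i"
      using v1 by (simp add: g_def right_diff_distrib sum_subtractf flip: sum_distrib_right)
    have "(\<Sum>l\<in>S \<times> S. v l * (if (if b then fst l else snd l) = i then 1 else 0)) = pmf \<pi> i"
    proof (cases "i \<in> S")
      case False
      then have "(\<Sum>l\<in>S \<times> S. v l * (if (if b then fst l else snd l) = i then 1 else 0)) = 0"
        by (intro sum.neutral) auto
      then show ?thesis using False by (simp add: set_pmf_iff)
    next
      case True
      show ?thesis
      proof (cases b)
        case True
        have "(\<Sum>l\<in>S \<times> S. v l * (if fst l = i then 1 else 0)) = (\<Sum>k\<in>S. \<Sum>j\<in>S. v (k, j) * (if k = i then 1 else 0))"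
          by (simp add: sum.cartesian_product case_prod_beta)
        also have "\<dots> = (\<Sum>k\<in>S. if k = i then (\<Sum>j\<in>S. v (i, j)) else 0)" by (intro sum.cong) auto
        finally show ?thesis using \<open>i \<in> S\<close> finS v True by (simp add: coupling_def)
      next
        case False
        have "(\<Sum>l\<in>S \<times> S. v l * (if snd l = i then 1 else 0)) = (\<Sum>j\<in>S. \<Sum>k\<in>S. v (j, k) * (if k = i then 1 else 0))"
          by (simp add: sum.cartesian_product case_prod_beta)
        also have "\<dots> = (\<Sum>j\<in>S. v (j, i))"
          using \<open>i \<in> S\<close> finS by (intro sum.cong) (auto simp: if_distrib cong: if_cong)
        finally show ?thesis using \<open>i \<in> S\<close> v False by (simp add: coupling_def)
      qed
    qed
    then show ?thesis using e by simp
  qed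
  define bad where "bad b i n = {\<omega> \<in> assignments (S \<times> S) n. \<bar>\<Sum>u<n. g b i (\<omega> u)\<bar> > a n}" for b i n
  have bad0: "(\<lambda>n. \<Sum>\<omega>\<in>bad b i n. weight v n \<omega>) \<longlonglongrightarrow> 0" if "i < s" for b i
    unfolding bad_def by (rule deviation_weight_tendsto_0[OF finL v0 v1 g_mean[OF that] a_large])
  have lim: "(\<lambda>n. \<Sum>b\<in>UNIV. \<Sum>i<s. \<Sum>\<omega>\<in>bad b i n. weight v n \<omega>) \<longlonglongrightarrow> (\<Sum>b\<in>(UNIV :: bool set). \<Sum>i<s. 0)"
    by (intro tendsto_sum bad0) auto
  have sum_g: "(\<Sum>u<n. g b i (\<omega> u)) = real (card {u. u < n \<and> (if b then fst (\<omega> u) else snd (\<omega> u)) = i}) - n * pmf \<pi> i" for b i \<omega> and n :: nat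
    by (simp only: g_def sum_subtractf sum_indicator_eq_card sum_constant card_lessThan)
  have w0: "weight v n \<omega> \<ge> 0" if "\<omega> \<in> assignments (S \<times> S) n" for n \<omega> by (rule weight_nonneg[OF v0 that])
  have sub: "balanced_pairs s \<pi> n (a n) \<subseteq> assignments (S \<times> S) n" for n by (auto simp: balanced_pairs_def)
  have up: "(\<Sum>\<omega>\<in>balanced_pairs s \<pi> n (a n). weight v n \<omega>) \<le> 1" for n
    using sum_mono2[OF finite_assignments[OF finL] sub, of n "weight v n"] w0 sum_weight[OF finL v1, of n] by auto
  have lo: "1 - (\<Sum>b\<in>UNIV. \<Sum>i<s. \<Sum>\<omega>\<in>bad b i n. weight v n \<omega>) \<le> (\<Sum>\<omega>\<in>balanced_pairs s \<pi> n (a n). weight v n \<omega>)" for n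
  proof -
    let ?U = "\<Union>(b, i)\<in>UNIV \<times> {..<s}. bad b i n"
    have fin: "finite (bad b i n)" for b i unfolding bad_def using finL by simp
    have "assignments (S \<times> S) n \<subseteq> balanced_pairs s \<pi> n (a n) \<union> ?U"
    proof
      fix \<omega> assume w: "\<omega> \<in> assignments (S \<times> S) n"
      show "\<omega> \<in> balanced_pairs s \<pi> n (a n) \<union> ?U"
      proof (rule ccontr)
        assume n: "\<omega> \<notin> balanced_pairs s \<pi> n (a n) \<union> ?U"
        have "\<bar>\<Sum>u<n. g b i (\<omega> u)\<bar> \<le> a n" if "i < s" for b i
        proof -
          have "\<omega> \<notin> bad b i n" using n that by blast
          then show ?thesis using w by (simp add: bad_def)
        qed
        from this[where b = True] this[where b = False] have "\<omega> \<in> balanced_pairs s \<pi> n (a n)"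
          using w by (simp add: balanced_pairs_def balanced_labels_def sum_g)
        then show False using n by simp
      qed
    qed
    then have "(\<Sum>\<omega>\<in>assignments (S \<times> S) n. weight v n \<omega>) \<le> (\<Sum>\<omega>\<in>balanced_pairs s \<pi> n (a n) \<union> ?U. weight v n \<omega>)"
      using finite_subset[OF sub] finL fin w0 by (intro sum_mono2) (auto simp: bad_def balanced_pairs_def)
    also have "\<dots> \<le> (\<Sum>\<omega>\<in>balanced_pairs s \<pi> n (a n). weight v n \<omega>) + (\<Sum>\<omega>\<in>?U. weight v n \<omega>)"
    proof -
      have "(\<Sum>\<omega>\<in>balanced_pairs s \<pi> n (a n) \<inter> ?U. weight v n \<omega>) \<ge> 0"
        using sub[of n] w0 by (intro sum_nonneg) auto
      then show ?thesis using finite_subset[OF sub] finL fin by (subst sum_Un) auto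
    qed
    also have "(\<Sum>\<omega>\<in>?U. weight v n \<omega>) \<le> (\<Sum>p\<in>UNIV \<times> {..<s}. \<Sum>\<omega>\<in>bad (fst p) (snd p) n. weight v n \<omega>)"
      unfolding case_prod_beta using fin w0 by (intro sum_UN_le) (auto simp: bad_def)
    also have "\<dots> = (\<Sum>b\<in>UNIV. \<Sum>i<s. \<Sum>\<omega>\<in>bad b i n. weight v n \<omega>)"
      by (simp add: sum.cartesian_product case_prod_beta)
    finally show ?thesis using sum_weight[OF finL v1, of n] by simp
  qed
  show ?thesis
  proof (rule tendsto_sandwich[OF always_eventually always_eventually _ tendsto_const])
    show "(\<lambda>n. 1 - (\<Sum>b\<in>UNIV. \<Sum>i<s. \<Sum>\<omega>\<in>bad b i n. weight v n \<omega>)) \<longlonglongrightarrow> 1"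
      using tendsto_diff[OF tendsto_const[of 1] lim] by simp
  qed (use up lo in auto)
qed

lemma balanced_marginal_gap:
  assumes \<omega>: "\<omega> \<in> balanced_pairs s \<pi> n a" and n: "n > 0"
  shows "(\<Sum>i\<in>S. \<bar>(\<Sum>j\<in>S. freq n \<omega> (i, j)) - pmf \<pi> i\<bar>) + (\<Sum>i\<in>S. \<bar>(\<Sum>j\<in>S. freq n \<omega> (j, i)) - pmf \<pi> i\<bar>)
    \<le> 2 * card S * (a / n)"
proof -
  have w: "\<omega> \<in> assignments (S \<times> S) n" using \<omega> by (simp add: balanced_pairs_def)
  have scale: "\<bar>x / n - p\<bar> \<le> a / n" if "\<bar>x - n * p\<bar> \<le> a" for x p :: real
  proof -
    have "x / n - p = (x - n * p) / n" using n by (simp add: field_simps)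
    then show ?thesis using that n by (simp add: divide_right_mono)
  qed
  have 1: "(\<Sum>i\<in>S. \<bar>(\<Sum>j\<in>S. freq n \<omega> (i, j)) - pmf \<pi> i\<bar>) \<le> (\<Sum>i\<in>S. a / n)"
  proof (rule sum_mono)
    fix i assume i: "i \<in> S"
    then show "\<bar>(\<Sum>j\<in>S. freq n \<omega> (i, j)) - pmf \<pi> i\<bar> \<le> a / n"
      unfolding freq_marginals[OF w n i] using \<omega>
      by (intro scale) (simp add: balanced_pairs_def balanced_labels_def S_less)
  qed
  have 2: "(\<Sum>i\<in>S. \<bar>(\<Sum>j\<in>S. freq n \<omega> (j, i)) - pmf \<pi> i\<bar>) \<le> (\<Sum>i\<in>S. a / n)"
  proof (rule sum_mono)
    fix i assume i: "i \<in> S"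
    then show "\<bar>(\<Sum>j\<in>S. freq n \<omega> (j, i)) - pmf \<pi> i\<bar> \<le> a / n"
      unfolding freq_marginals[OF w n i] using \<omega>
      by (intro scale) (simp add: balanced_pairs_def balanced_labels_def S_less)
  qed
  have 3: "(\<Sum>i\<in>S. a / n) + (\<Sum>i\<in>S. a / n) = 2 * card S * (a / n)" by simp
  show ?thesis using add_mono[OF 1 2] unfolding 3 .
qed

section \<open>The two regimes for the block model\<close>

lemma second_moment_eventually:
  assumes a_large: "filterlim (\<lambda>n. a n / sqrt (real n)) at_top sequentially"
  shows "\<forall>\<^sub>F n in sequentially. (\<Sum>\<omega>\<in>balanced_pairs s \<pi> n (a n). weight w n \<omega>) > 0 \<and>
    second_moment (sbm_cond s M \<pi> n (a n)) (erdos_renyi n (d / real n)) =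
    ennreal ((\<Sum>\<omega>\<in>balanced_pairs s \<pi> n (a n). weight w n \<omega> * lr n \<omega>) /
      (\<Sum>\<omega>\<in>balanced_pairs s \<pi> n (a n). weight w n \<omega>))"
proof -
  \<comment> \<open>Exceeds \<open>d\<close> and every entry of \<open>M\<close>; beyond it all edge
    parameters are genuine probabilities.\<close>
  define B where "B = d + 1 + (\<Sum>i<s. \<Sum>j<s. M $$ (i, j))"
  have B0: "(\<Sum>i<s. \<Sum>j<s. M $$ (i, j)) \<ge> 0" using M_nonneg by (intro sum_nonneg) auto
  have M_B: "M $$ (i, j) \<le> B" if "i < s" "j < s" for i j
  proof -
    have "M $$ (i, j) \<le> (\<Sum>j<s. M $$ (i, j))"
      using that M_nonneg by (intro member_le_sum[where f = "\<lambda>j. M $$ (i, j)"]) auto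
    also have "\<dots> \<le> (\<Sum>i<s. \<Sum>j<s. M $$ (i, j))"
      using that M_nonneg by (intro member_le_sum[where f = "\<lambda>i. \<Sum>j<s. M $$ (i, j)"] sum_nonneg) auto
    finally show ?thesis using d by (simp add: B_def)
  qed
  have "\<forall>\<^sub>F n in sequentially. (\<Sum>\<omega>\<in>balanced_pairs s \<pi> n (a n). weight w n \<omega>) > 0"
    by (rule order_tendstoD[OF balanced_weight_tendsto_1[OF coupling_w a_large]]) simp
  moreover have "\<forall>\<^sub>F n in sequentially. real n \<ge> B"
    using filterlim_real_sequentially by (auto simp: filterlim_at_top)
  ultimately show ?thesis
  proof eventually_elim
    case (elim n)
    have dn: "d < real n" using elim(2) B0 by (simp add: B_def)
    have le: "M $$ (i, j) \<le> real n" if "i < s" "j < s" for i j using M_B[OF that] elim(2) by linarith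
    have "second_moment (sbm_cond s M \<pi> n (a n)) (erdos_renyi n (d / real n)) =
      ennreal ((\<Sum>\<omega>\<in>balanced_pairs s \<pi> n (a n). weight w n \<omega> *
        (\<Prod>(u, v)\<in>vertex_pairs n. 1 + (M $$ (fst (\<omega> u), fst (\<omega> v)) - d) * (M $$ (snd (\<omega> u), snd (\<omega> v)) - d) / d / (n - d))) /
      (\<Sum>\<omega>\<in>balanced_pairs s \<pi> n (a n). weight w n \<omega>))"
      by (rule second_moment_sbm[OF pi M_nonneg le d dn elim(1)])
    also have "(\<Sum>\<omega>\<in>balanced_pairs s \<pi> n (a n). weight w n \<omega> *
        (\<Prod>(u, v)\<in>vertex_pairs n. 1 + (M $$ (fst (\<omega> u), fst (\<omega> v)) - d) * (M $$ (snd (\<omega> u), snd (\<omega> v)) - d) / d / (n - d))) =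
      (\<Sum>\<omega>\<in>balanced_pairs s \<pi> n (a n). weight w n \<omega> * lr n \<omega>)"
    proof (rule sum.cong)
      fix \<omega> assume "\<omega> \<in> balanced_pairs s \<pi> n (a n)"
      then have "\<omega> \<in> assignments (S \<times> S) n" by (simp add: balanced_pairs_def)
      from lr_eq[OF this] show "weight w n \<omega> *
        (\<Prod>(u, v)\<in>vertex_pairs n. 1 + (M $$ (fst (\<omega> u), fst (\<omega> v)) - d) * (M $$ (snd (\<omega> u), snd (\<omega> v)) - d) / d / (n - d)) =
        weight w n \<omega> * lr n \<omega>" by simp
    qed simp
    finally show ?case using elim(1) by simp
  qed
qed

text \<open>Numerator and normalisation are treated separately: the numerator is split by
  \<open>dev\<close> into a part with the Gaussian limit and a negligible one, and the total weight
  of balanced pairs tends to 1.\<close>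

lemma second_moment_limit:
  assumes A: "A = M - d \<cdot>\<^sub>m mat s s (\<lambda>_. 1)" and Q: "Q_sup s \<pi> ((1 / sqrt (2 * d)) \<cdot>\<^sub>m A) < 1"
    and a_small: "a \<in> o(\<lambda>n. real n)"
    and a_large: "filterlim (\<lambda>n. a n / sqrt (real n)) at_top sequentially"
  shows "(\<lambda>n. second_moment (sbm_cond s M \<pi> n (a n)) (erdos_renyi n (d / real n)))
      \<longlonglongrightarrow> (\<Prod>i<m. \<Prod>j<m. psi (d * \<mu> i * \<mu> j))"
    and "(\<Prod>i<m. \<Prod>j<m. psi (d * \<mu> i * \<mu> j)) < \<infinity>"
proof -
  obtain r where r: "0 < r" "r < 1" and le: "\<And>\<alpha>. coupling \<alpha> \<Longrightarrow> quad \<alpha> \<le> r * KL \<alpha>"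
    using Q_sup_less_1[OF A Q] by blast
  \<comment> \<open>The inequality for couplings, tested on perturbations of p, bounds every
    eigenvalue away from 1.\<close>
  have \<kappa>: "d * \<mu> i * \<mu> j \<le> r" if ij: "i < m" "j < m" for i j
  proof -
    have "(case (i, j) of (i, j) \<Rightarrow> d * \<mu> i * \<mu> j) \<le> r"
      by (rule kappa_le) (use r ij in \<open>auto intro!: le perturbed_coupling[OF ij]\<close>)
    then show ?thesis by simp
  qed
  let ?\<Lambda> = "\<lambda>n. balanced_pairs s \<pi> n (a n)"
  have \<Lambda>: "?\<Lambda> n \<subseteq> assignments (S \<times> S) n" for n by (auto simp: balanced_pairs_def)
  have \<Lambda>1: "(\<lambda>n. \<Sum>\<omega>\<in>?\<Lambda> n. weight w n \<omega>) \<longlonglongrightarrow> 1"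
    by (rule balanced_weight_tendsto_1[OF coupling_w a_large])
  define P where "P = (\<Prod>c\<in>{..<m} \<times> {..<m}. (1 - (case c of (i, j) \<Rightarrow> d * \<mu> i * \<mu> j)) powr (- 1 / 2))"
  obtain \<epsilon> where \<epsilon>: "\<epsilon> > 0" and near: "(\<lambda>n. \<Sum>\<omega>\<in>{\<omega>\<in>?\<Lambda> n. dev n \<omega> \<le> \<epsilon>}. weight w n \<omega> * lr n \<omega>)
      \<longlonglongrightarrow> exp (- c0) * P"
    unfolding P_def by (rule near_limit[OF \<Lambda> \<Lambda>1 r]) (use \<kappa> in auto)
  \<comment> \<open>The total defect of the two marginals. On the balance event it is at most 2 |S|
    a_n / n, so a_n = o(n) brings it below the gap.\<close>
  define g where "g \<alpha> = (\<Sum>i\<in>S. \<bar>(\<Sum>j\<in>S. \<alpha> (i, j)) - pmf \<pi> i\<bar>) + (\<Sum>i\<in>S. \<bar>(\<Sum>j\<in>S. \<alpha> (j, i)) - pmf \<pi> i\<bar>)"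
    for \<alpha> :: "nat \<times> nat \<Rightarrow> real"
  have g_cont: "continuous_on UNIV g"
    unfolding g_def by (intro continuous_intros) auto
  have g_le: "quad \<alpha> \<le> r * KL \<alpha>" if \<alpha>: "\<And>l. l \<in> S \<times> S \<Longrightarrow> \<alpha> l \<ge> 0" "g \<alpha> \<le> 0" for \<alpha>
  proof (rule le)
    have "(\<Sum>i\<in>S. \<bar>(\<Sum>j\<in>S. \<alpha> (i, j)) - pmf \<pi> i\<bar>) = 0" "(\<Sum>i\<in>S. \<bar>(\<Sum>j\<in>S. \<alpha> (j, i)) - pmf \<pi> i\<bar>) = 0"
      using \<alpha>(2) sum_nonneg[of S "\<lambda>i. \<bar>(\<Sum>j\<in>S. \<alpha> (i, j)) - pmf \<pi> i\<bar>"]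
        sum_nonneg[of S "\<lambda>i. \<bar>(\<Sum>j\<in>S. \<alpha> (j, i)) - pmf \<pi> i\<bar>"] unfolding g_def by linarith+
    then show "coupling \<alpha>"
      using \<alpha>(1) finS by (auto simp: coupling_def sum_nonneg_eq_0_iff)
  qed
  obtain \<eta> where \<eta>: "\<eta> > 0" and gap: "\<And>n \<omega>. \<omega> \<in> assignments (S \<times> S) n \<Longrightarrow> n > 0 \<Longrightarrow> dev n \<omega> > \<epsilon> \<Longrightarrow>
    g (freq n \<omega>) < \<eta> \<Longrightarrow> KL (freq n \<omega>) - quad (freq n \<omega>) \<ge> \<eta>"
    using coupling_gap[OF g_cont \<epsilon> r(2)] g_le by blast
  have "(\<lambda>n. a n / real n) \<longlonglongrightarrow> 0" using smalloD_tendsto[OF a_small] by simp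
  then have "(\<lambda>n. 2 * card S * (a n / real n)) \<longlonglongrightarrow> 2 * card S * (0 :: real)" by (intro tendsto_mult tendsto_const)
  then have "\<forall>\<^sub>F n in sequentially. 2 * card S * (a n / real n) < \<eta>"
    using \<eta> by (intro order_tendstoD) auto
  then have "\<forall>\<^sub>F n in sequentially. \<forall>\<omega>\<in>?\<Lambda> n. dev n \<omega> > \<epsilon> \<longrightarrow> KL (freq n \<omega>) - quad (freq n \<omega>) \<ge> \<eta>"
    using eventually_gt_at_top[of 0]
  proof eventually_elim
    case (elim n)
    have "g (freq n \<omega>) < \<eta>" if "\<omega> \<in> ?\<Lambda> n" for \<omega>
      using balanced_marginal_gap[OF that elim(2)] elim(1) unfolding g_def by linarith
    then show ?case using gap \<Lambda> elim(2) by blast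
  qed
  then have far: "(\<lambda>n. \<Sum>\<omega>\<in>{\<omega>\<in>?\<Lambda> n. dev n \<omega> > \<epsilon>}. weight w n \<omega> * lr n \<omega>) \<longlonglongrightarrow> 0"
    by (rule far_limit[OF \<Lambda> \<eta>])
  have split: "(\<Sum>\<omega>\<in>?\<Lambda> n. weight w n \<omega> * lr n \<omega>) =
    (\<Sum>\<omega>\<in>{\<omega>\<in>?\<Lambda> n. dev n \<omega> \<le> \<epsilon>}. weight w n \<omega> * lr n \<omega>) + (\<Sum>\<omega>\<in>{\<omega>\<in>?\<Lambda> n. dev n \<omega> > \<epsilon>}. weight w n \<omega> * lr n \<omega>)" for n
    using finite_subset[OF \<Lambda>] finL by (subst sum.union_disjoint[symmetric]) (auto intro!: sum.cong)
  have "(\<lambda>n. (\<Sum>\<omega>\<in>?\<Lambda> n. weight w n \<omega> * lr n \<omega>) / (\<Sum>\<omega>\<in>?\<Lambda> n. weight w n \<omega>)) \<longlonglongrightarrow> (exp (- c0) * P + 0) / 1"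
    unfolding split by (intro tendsto_divide tendsto_add near far \<Lambda>1) simp
  then have "(\<lambda>n. ennreal ((\<Sum>\<omega>\<in>?\<Lambda> n. weight w n \<omega> * lr n \<omega>) / (\<Sum>\<omega>\<in>?\<Lambda> n. weight w n \<omega>))) \<longlonglongrightarrow> ennreal (exp (- c0) * P)"
    by (intro tendsto_ennrealI) simp
  then have lim: "(\<lambda>n. second_moment (sbm_cond s M \<pi> n (a n)) (erdos_renyi n (d / real n))) \<longlonglongrightarrow> ennreal (exp (- c0) * P)"
    by (rule Lim_transform_eventually) (rule eventually_mono[OF second_moment_eventually[OF a_large]], simp)
  have P: "(\<Prod>i<m. \<Prod>j<m. psi (d * \<mu> i * \<mu> j)) = ennreal (exp (- c0) * P)"
  proof -
    define k where "k c = (case c of (i, j) \<Rightarrow> d * \<mu> i * \<mu> j)" for c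
    have k: "k c \<le> r" if "c \<in> {..<m} \<times> {..<m}" for c using that \<kappa> by (auto simp: k_def)
    have "(\<Prod>i<m. \<Prod>j<m. psi (d * \<mu> i * \<mu> j)) = (\<Prod>c\<in>{..<m} \<times> {..<m}. psi (k c))"
      by (simp add: prod.cartesian_product k_def case_prod_beta)
    also have "\<dots> = (\<Prod>c\<in>{..<m} \<times> {..<m}. ennreal ((1 - k c) powr (- 1 / 2) * exp (- k c / 2 - (k c)\<^sup>2 / 4)))"
      using k r(2) by (intro prod.cong) (force simp: psi_def)+
    also have "\<dots> = ennreal (\<Prod>c\<in>{..<m} \<times> {..<m}. (1 - k c) powr (- 1 / 2) * exp (- k c / 2 - (k c)\<^sup>2 / 4))"
      by (intro prod_ennreal) simp
    also have "(\<Prod>c\<in>{..<m} \<times> {..<m}. (1 - k c) powr (- 1 / 2) * exp (- k c / 2 - (k c)\<^sup>2 / 4)) =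
      P * exp (\<Sum>c\<in>{..<m} \<times> {..<m}. - k c / 2 - (k c)\<^sup>2 / 4)"
      unfolding P_def prod.distrib k_def by (subst exp_sum) auto
    \<comment> \<open>Summed over all eigenvalues, the exponents in \<open>psi\<close> give the
      constant from the logarithmic expansion.\<close>
    also have "(\<Sum>c\<in>{..<m} \<times> {..<m}. - k c / 2 - (k c)\<^sup>2 / 4) = - c0"
      unfolding c0_def k_def by (simp add: sum_subtractf sum_negf sum_divide_distrib)
    finally show ?thesis by (simp add: mult.commute)
  qed
  show "(\<lambda>n. second_moment (sbm_cond s M \<pi> n (a n)) (erdos_renyi n (d / real n)))
      \<longlonglongrightarrow> (\<Prod>i<m. \<Prod>j<m. psi (d * \<mu> i * \<mu> j))" unfolding P by (rule lim)
  show "(\<Prod>i<m. \<Prod>j<m. psi (d * \<mu> i * \<mu> j)) < \<infinity>" unfolding P by simp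
qed

text \<open>The balance event is typical under the tilted coupling too, so conditioning leaves the
  exponential lower bound intact.\<close>

lemma second_moment_diverges:
  assumes A: "A = M - d \<cdot>\<^sub>m mat s s (\<lambda>_. 1)" and Q: "Q_sup s \<pi> ((1 / sqrt (2 * d)) \<cdot>\<^sub>m A) > 1"
    and a_large: "filterlim (\<lambda>n. a n / sqrt (real n)) at_top sequentially"
  shows "(\<lambda>n. second_moment (sbm_cond s M \<pi> n (a n)) (erdos_renyi n (d / real n))) \<longlonglongrightarrow> \<infinity>"
proof -
  obtain \<alpha> where \<alpha>: "coupling \<alpha>" "KL \<alpha> < quad \<alpha>" using Q_sup_greater_1[OF A Q] by blast
  let ?\<Lambda> = "\<lambda>n. balanced_pairs s \<pi> n (a n)"
  have \<Lambda>: "?\<Lambda> n \<subseteq> assignments (S \<times> S) n" for n by (auto simp: balanced_pairs_def)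
  have top: "filterlim (\<lambda>n. \<Sum>\<omega>\<in>?\<Lambda> n. weight w n \<omega> * lr n \<omega>) at_top sequentially"
    by (rule tilted_divergence[OF _ coupling_sum[OF \<alpha>(1)] \<alpha>(2) \<Lambda> balanced_weight_tendsto_1[OF \<alpha>(1) a_large]])
       (use \<alpha>(1) in \<open>auto simp: coupling_def\<close>)
  have "(\<lambda>n. \<Sum>\<omega>\<in>?\<Lambda> n. weight w n \<omega>) \<longlonglongrightarrow> 1"
    by (rule balanced_weight_tendsto_1[OF coupling_w a_large])
  then have "(\<lambda>n. inverse (\<Sum>\<omega>\<in>?\<Lambda> n. weight w n \<omega>)) \<longlonglongrightarrow> inverse 1" by (intro tendsto_inverse) auto
  then have "(\<lambda>n. inverse (\<Sum>\<omega>\<in>?\<Lambda> n. weight w n \<omega>)) \<longlonglongrightarrow> 1" by simp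
  from filterlim_at_top_mult_tendsto_pos[OF this _ top]
  have "filterlim (\<lambda>n. (\<Sum>\<omega>\<in>?\<Lambda> n. weight w n \<omega> * lr n \<omega>) / (\<Sum>\<omega>\<in>?\<Lambda> n. weight w n \<omega>)) at_top sequentially"
    by (simp add: divide_inverse)
  then have "(\<lambda>n. ennreal ((\<Sum>\<omega>\<in>?\<Lambda> n. weight w n \<omega> * lr n \<omega>) / (\<Sum>\<omega>\<in>?\<Lambda> n. weight w n \<omega>))) \<longlonglongrightarrow> \<infinity>"
    unfolding infinity_ennreal_def by (simp only: ennreal_tendsto_top_eq_at_top)
  then show ?thesis
    by (rule Lim_transform_eventually) (rule eventually_mono[OF second_moment_eventually[OF a_large]], simp)
qed

end

theorem theorem3p8:
  fixes s :: nat and \<pi> :: "nat pmf" and M A T :: "real mat" and d :: real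
    and ev :: "nat \<Rightarrow> real" and a :: "nat \<Rightarrow> real"
  assumes s: "s \<ge> 2"
    and pi: "set_pmf \<pi> \<subseteq> {..<s}"
    and M_carrier: "M \<in> carrier_mat s s"
    and M_symmetric: "transpose_mat M = M"
    and M_nonneg: "\<And>i j. i < s \<Longrightarrow> j < s \<Longrightarrow> M $$ (i, j) \<ge> 0"
    and d_pos: "d > 0"
    and d_eq: "\<And>i. i < s \<Longrightarrow> (\<Sum>j<s. M $$ (i, j) * pmf \<pi> j) = d"
    and A_eq: "A = M - d \<cdot>\<^sub>m mat s s (\<lambda>_. 1)"
    and T_eq: "T = (1 / d) \<cdot>\<^sub>m (mat_diag s (pmf \<pi>) * M)"
    and ev_char_poly: "char_poly T = (\<Prod>i<s. [:- ev i, 1:])"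
    and ev_0: "ev 0 = 1"
    and ev_sorted: "\<And>i j. i \<le> j \<Longrightarrow> j < s \<Longrightarrow> \<bar>ev j\<bar> \<le> \<bar>ev i\<bar>"
    and a_small: "a \<in> o(\<lambda>n. real n)"
    and a_large: "filterlim (\<lambda>n. a n / sqrt (real n)) at_top sequentially"
  shows "(Q_sup s \<pi> ((1 / sqrt (2 * d)) \<cdot>\<^sub>m A) < 1 \<longrightarrow>
            (\<lambda>n. second_moment (sbm_cond s M \<pi> n (a n)) (erdos_renyi n (d / real n)))
              \<longlonglongrightarrow> (\<Prod>i\<in>{1..<s}. \<Prod>j\<in>{1..<s}. psi (d * ev i * ev j))
            \<and> (\<Prod>i\<in>{1..<s}. \<Prod>j\<in>{1..<s}. psi (d * ev i * ev j)) < \<infinity>)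
       \<and> (Q_sup s \<pi> ((1 / sqrt (2 * d)) \<cdot>\<^sub>m A) > 1 \<longrightarrow>
            (\<lambda>n. second_moment (sbm_cond s M \<pi> n (a n)) (erdos_renyi n (d / real n)))
              \<longlonglongrightarrow> \<infinity>)"
proof -
  have s0: "s > 0" using s by simp
  obtain m \<mu> f where
    f: "\<And>a b. a < m \<Longrightarrow> b < m \<Longrightarrow> (\<Sum>i\<in>set_pmf \<pi>. pmf \<pi> i * f a i * f b i) = (if a = b then 1 else (0::real))"
      "\<And>a. a < m \<Longrightarrow> (\<Sum>i\<in>set_pmf \<pi>. pmf \<pi> i * f a i) = 0"
      "\<And>i j. i \<in> set_pmf \<pi> \<Longrightarrow> j \<in> set_pmf \<pi> \<Longrightarrow> M $$ (i, j) - d = d * (\<Sum>a<m::nat. \<mu> a * f a i * f a j)"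
    and ev_\<mu>: "\<And>g :: real \<Rightarrow> ennreal. g 0 = 1 \<Longrightarrow> (\<Prod>i\<in>{1..<s}. g (ev i)) = (\<Prod>a<m. g (\<mu> a))"
    by (rule sbm_spectrum[OF pi M_carrier M_symmetric d_pos d_eq T_eq ev_char_poly ev_0 s0]) (assumption, (rule that; assumption))
  interpret sbm_spectral s \<pi> M d m \<mu> f
    by unfold_locales (use pi M_carrier M_nonneg d_pos f in auto)
  have psi0: "psi 0 = 1" by (simp add: psi_def)
  \<comment> \<open>The spectrum is exchanged one index at a time. Since \<open>psi 0 = 1\<close>,
    zero eigenvalues drop out on either side, and their multiplicities need not agree.\<close>
  have "(\<Prod>i\<in>{1..<s}. \<Prod>j\<in>{1..<s}. psi (d * ev i * ev j)) = (\<Prod>i\<in>{1..<s}. \<Prod>b<m. psi (d * ev i * \<mu> b))"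
    by (intro prod.cong refl ev_\<mu>) (simp add: psi0)
  also have "\<dots> = (\<Prod>a<m. \<Prod>b<m. psi (d * \<mu> a * \<mu> b))"
    by (rule ev_\<mu>) (simp add: psi0)
  finally have prod: "(\<Prod>i\<in>{1..<s}. \<Prod>j\<in>{1..<s}. psi (d * ev i * ev j)) = (\<Prod>a<m. \<Prod>b<m. psi (d * \<mu> a * \<mu> b))" .
  show ?thesis
    unfolding prod using second_moment_limit[OF A_eq _ a_small a_large] second_moment_diverges[OF A_eq _ a_large]
    by blast
qed

end
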